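(* In the completely randomized $2^K$ factorial design setup of the context, let $\hat{\mathbb M}$ be the output of the forward screening procedure with $D=K$, and for a fixed weighting vector $f\in\mathbb R^Q$ let $\gamma=f^\top\bar Y$, $\hat\gamma_{\mathrm R}=f[\hat{\mathbb M}]^\top\hat Y$, $\hat v_{\mathrm R}^2=f[\hat{\mathbb M}]^\top\hat V_{\hat Y}f[\hat{\mathbb M}]$. Assume conditions (C1)–(C4) of the context (with $D=K$, and (C4) of the same heredity type as the procedure). Let $f^\star=f[\mathbb M^\star]$ and $v_{\mathrm R}^2=f^{\star\top}V_{\hat Y}f^\star$. Then, as $N\to\infty$, $(\hat\gamma_{\mathrm R}-\gamma)/v_{\mathrm R}\rightsquigarrow\mathcal N(0,1)$. If moreover $\|f^\star\|_\infty=O(Q^{-1})$, then $N(\hat v_{\mathrm R}^2-v_{\mathrm R,\lim}^2)\to0$ in probability, where $v_{\mathrm R,\lim}^2=f^{\star\top}D_{\hat Y}f^\star\ge v_{\mathrm R}^2$.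
   Context: Setup. Let $K\ge 2$, $\mathcal T=\{0,1\}^K$ with $Q=2^K$ elements ordered lexicographically. For $\mathcal K\subseteq[K]$ let $g_{\mathcal K}(z)=\prod_{k\in\mathcal K}(2z_k-1)$, $g_\emptyset=\mathbf 1_Q$; $G$ is the $Q\times Q$ matrix with columns $g_{\mathcal K}$, $\mathcal K\subseteq[K]$. For a set $\mathbb M$ of subsets of $[K]$, $G(\cdot,\mathbb M)$ is the submatrix of columns indexed by $\mathbb M$ and $f[\mathbb M]=Q^{-1}G(\cdot,\mathbb M)G(\cdot,\mathbb M)^\top f$. $N$ units with potential outcomes $Y_i(z)$; $\bar Y(z)=N^{-1}\sum_iY_i(z)$, $S(z,z')=(N-1)^{-1}\sum_i(Y_i(z)-\bar Y(z))(Y_i(z')-\bar Y(z'))$; $\tau_{\mathcal K}=Q^{-1}g_{\mathcal K}^\top\bar Y$; a parent of $\mathcal K$ is a subset of size $|\mathcal K|-1$. Design: fixed $N(z)\ge2$ summing to $N$, assignment uniform over assignments with $N(z)$ units at $z$; $Y_i=Y_i(Z_i)$; $\hat Y(z)$, $\hat S(z,z)$ the sample mean and sample variance (divisor $N(z)-1$) of observed outcomes in arm $z$; $V_{\hat Y}=\mathrm{Cov}(\hat Y)=D_{\hat Y}-N^{-1}S$ with $D_{\hat Y}=\mathrm{diag}(N(z)^{-1}S(z,z))$; $\hat V_{\hat Y}=\mathrm{diag}(N(z)^{-1}\hat S(z,z))$. $\mathbb M^\star_d=\{\mathcal K:|\mathcal K|=d,\tau_{\mathcal K}\ne0\}$,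 $\mathbb M^\star_{1:D}=\bigcup_{d\le D}\mathbb M^\star_d$, and $\mathbb M^\star=\{\emptyset\}\cup\mathbb M^\star_{1:K}$. Forward screening procedure: $\hat{\mathbb M}=\{\emptyset\}$; for $d=1,\dots,D$: let $C_d$ be the $\mathcal K$ with $|\mathcal K|=d$ having at least one parent (weak heredity) or all parents (strong heredity) in $\hat{\mathbb M}$; compute $\hat\tau_{\mathcal K}=Q^{-1}g_{\mathcal K}^\top\hat Y$, $\hat\sigma^2_{\mathcal K}=Q^{-2}g_{\mathcal K}^\top\hat V_{\hat Y}g_{\mathcal K}$; add to $\hat{\mathbb M}$ those $\mathcal K\in C_d$ with $|\hat\tau_{\mathcal K}/\hat\sigma_{\mathcal K}|\ge\Phi^{-1}(1-\min\{\alpha_d/|C_d|,1\}/2)$. Output $\hat{\mathbb M}$. Asymptotics as $N\to\infty$, everything may depend on $N$, constants do not. (C1) $N(z)=c(z)N_0\ge2$ with integer $N_0$ and constants $0<\underline c\le c(z)\le\overline c$. (C2) (i) $|\tau_{\mathcal K}|=\Theta(N^\delta)$ for all $\mathcal K\in\mathbb M^\star_{1:D}$, some $-1/2<\delta\le0$; (ii) $\alpha_d=\Theta(N^{-\delta'})$, some $\delta'>0$; (iii) $\sum_{d\le D}|\mathbb M^\star_d|=\Theta(N^{\delta''})$, some $0\le\delta''<1/3$. (C3) (i) condition number of the correlation matrix of $\hat Y$ at most $\sigma^2$; (ii) $\max_zN^{-1}\sum_i(Y_i(z)-\bar Y(z))^4\le\Delta^4$; (iii) $\max_{i,z}|Y_i(z)-\bar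 Y(z)|/\{\min_zS(z,z)\}^{1/2}\le M$, for constants $\sigma,\Delta,M$. (C4) weak heredity: $\tau_{\mathcal K}\ne0$ only if some parent has nonzero effect; strong heredity: only if all parents have nonzero effects. *)

theory Defs
  imports "HOL-Probability.Probability"
begin

(* Treatment combinations z in {0,1}^K are encoded as subsets z of {..<K}
   (z_k = 1 iff k in z).  Factorial effects are indexed by subsets of {..<K}.
   Vectors in R^Q are functions on the set of treatment combinations. *)

definition treatments :: "nat \<Rightarrow> nat set set" where
  "treatments K = Pow {..<K}"

definition Qnum :: "nat \<Rightarrow> real" where
  "Qnum K = 2 ^ K"

definition geff :: "nat set \<Rightarrow> nat set \<Rightarrow> real" where
  "geff KK z = (\<Prod>k\<in>KK. (if k \<in> z then 1 else -1))"

definition quad :: "nat \<Rightarrow> (nat set \<Rightarrow> nat set \<Rightarrow> real) \<Rightarrow> (nat set \<Rightarrow> real) \<Rightarrow> real" where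
  "quad K A x = (\<Sum>z\<in>treatments K. \<Sum>z'\<in>treatments K. x z * A z z' * x z')"

(* f[M] = Q^{-1} G(.,M) G(.,M)^T f *)
definition proj :: "nat \<Rightarrow> nat set set \<Rightarrow> (nat set \<Rightarrow> real) \<Rightarrow> nat set \<Rightarrow> real" where
  "proj K M f z = (1 / Qnum K) * (\<Sum>KK\<in>M. geff KK z * (\<Sum>z'\<in>treatments K. geff KK z' * f z'))"

(* population quantities; units are 0..N-1, Y i z is the potential outcome *)
definition Ybar :: "nat \<Rightarrow> (nat \<Rightarrow> nat set \<Rightarrow> real) \<Rightarrow> nat set \<Rightarrow> real" where
  "Ybar N Y z = (\<Sum>i<N. Y i z) / real N"

definition Spop :: "nat \<Rightarrow> (nat \<Rightarrow> nat set \<Rightarrow> real) \<Rightarrow> nat set \<Rightarrow> nat set \<Rightarrow> real" where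
  "Spop N Y z z' = (\<Sum>i<N. (Y i z - Ybar N Y z) * (Y i z' - Ybar N Y z')) / (real N - 1)"

definition tau :: "nat \<Rightarrow> nat \<Rightarrow> (nat \<Rightarrow> nat set \<Rightarrow> real) \<Rightarrow> nat set \<Rightarrow> real" where
  "tau K N Y KK = (1 / Qnum K) * (\<Sum>z\<in>treatments K. geff KK z * Ybar N Y z)"

definition Mstar_d :: "nat \<Rightarrow> nat \<Rightarrow> (nat \<Rightarrow> nat set \<Rightarrow> real) \<Rightarrow> nat \<Rightarrow> nat set set" where
  "Mstar_d K N Y d = {KK \<in> Pow {..<K}. card KK = d \<and> tau K N Y KK \<noteq> 0}"

definition Mstar_upto :: "nat \<Rightarrow> nat \<Rightarrow> (nat \<Rightarrow> nat set \<Rightarrow> real) \<Rightarrow> nat \<Rightarrow> nat set set" where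
  "Mstar_upto K N Y D = (\<Union>d\<in>{1..D}. Mstar_d K N Y d)"

definition Mstar :: "nat \<Rightarrow> nat \<Rightarrow> (nat \<Rightarrow> nat set \<Rightarrow> real) \<Rightarrow> nat set set" where
  "Mstar K N Y = {{}} \<union> Mstar_upto K N Y K"

definition DY :: "nat \<Rightarrow> (nat set \<Rightarrow> nat) \<Rightarrow> (nat \<Rightarrow> nat set \<Rightarrow> real) \<Rightarrow> nat set \<Rightarrow> nat set \<Rightarrow> real" where
  "DY N Nz Y z z' = (if z = z' then Spop N Y z z / real (Nz z) else 0)"

definition VY :: "nat \<Rightarrow> (nat set \<Rightarrow> nat) \<Rightarrow> (nat \<Rightarrow> nat set \<Rightarrow> real) \<Rightarrow> nat set \<Rightarrow> nat set \<Rightarrow> real" where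
  "VY N Nz Y z z' = DY N Nz Y z z' - Spop N Y z z' / real N"

definition corrY :: "nat \<Rightarrow> (nat set \<Rightarrow> nat) \<Rightarrow> (nat \<Rightarrow> nat set \<Rightarrow> real) \<Rightarrow> nat set \<Rightarrow> nat set \<Rightarrow> real" where
  "corrY N Nz Y z z' = VY N Nz Y z z' / sqrt (VY N Nz Y z z * VY N Nz Y z' z')"

definition is_eigenvalue :: "nat \<Rightarrow> (nat set \<Rightarrow> nat set \<Rightarrow> real) \<Rightarrow> real \<Rightarrow> bool" where
  "is_eigenvalue K A lam \<longleftrightarrow>
     (\<exists>x. (\<exists>z\<in>treatments K. x z \<noteq> 0) \<and>
          (\<forall>z\<in>treatments K. (\<Sum>z'\<in>treatments K. A z z' * x z') = lam * x z))"

definition cond_number_le :: "nat \<Rightarrow> (nat set \<Rightarrow> nat set \<Rightarrow> real) \<Rightarrow> real \<Rightarrow> bool" where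
  "cond_number_le K A c \<longleftrightarrow>
     (\<forall>lam mu. is_eigenvalue K A lam \<and> is_eigenvalue K A mu \<longrightarrow> lam \<le> c * mu)"

definition assignments :: "nat \<Rightarrow> nat \<Rightarrow> (nat set \<Rightarrow> nat) \<Rightarrow> (nat \<Rightarrow> nat set) set" where
  "assignments K N Nz = {Z \<in> {..<N} \<rightarrow>\<^sub>E treatments K.
       \<forall>z\<in>treatments K. card {i\<in>{..<N}. Z i = z} = Nz z}"

definition design :: "nat \<Rightarrow> nat \<Rightarrow> (nat set \<Rightarrow> nat) \<Rightarrow> (nat \<Rightarrow> nat set) pmf" where
  "design K N Nz = pmf_of_set (assignments K N Nz)"

(* observed-data estimators; Z is the realised assignment, Y_i = Y_i(Z_i) *)
definition Yhat :: "nat \<Rightarrow> (nat set \<Rightarrow> nat) \<Rightarrow> (nat \<Rightarrow> nat set \<Rightarrow> real) \<Rightarrow> (nat \<Rightarrow> nat set) \<Rightarrow> nat set \<Rightarrow> real" where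
  "Yhat N Nz Y Z z = (\<Sum>i\<in>{i\<in>{..<N}. Z i = z}. Y i (Z i)) / real (Nz z)"

definition Shat :: "nat \<Rightarrow> (nat set \<Rightarrow> nat) \<Rightarrow> (nat \<Rightarrow> nat set \<Rightarrow> real) \<Rightarrow> (nat \<Rightarrow> nat set) \<Rightarrow> nat set \<Rightarrow> real" where
  "Shat N Nz Y Z z = (\<Sum>i\<in>{i\<in>{..<N}. Z i = z}. (Y i (Z i) - Yhat N Nz Y Z z)^2) / (real (Nz z) - 1)"

definition Vhat :: "nat \<Rightarrow> (nat set \<Rightarrow> nat) \<Rightarrow> (nat \<Rightarrow> nat set \<Rightarrow> real) \<Rightarrow> (nat \<Rightarrow> nat set) \<Rightarrow> nat set \<Rightarrow> nat set \<Rightarrow> real" where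
  "Vhat N Nz Y Z z z' = (if z = z' then Shat N Nz Y Z z / real (Nz z) else 0)"

definition std_normal_cdf :: "real \<Rightarrow> real" where
  "std_normal_cdf x = measure std_normal_distribution {..x}"

definition std_normal_quantile :: "real \<Rightarrow> real" where
  "std_normal_quantile p = (THE x. std_normal_cdf x = p)"

definition candidates :: "bool \<Rightarrow> nat \<Rightarrow> nat set set \<Rightarrow> nat \<Rightarrow> nat set set" where
  "candidates strong K Mh d =
     {KK \<in> Pow {..<K}. card KK = d \<and>
        (if strong then (\<forall>k\<in>KK. KK - {k} \<in> Mh) else (\<exists>k\<in>KK. KK - {k} \<in> Mh))}"

fun screen :: "bool \<Rightarrow> nat \<Rightarrow> (nat \<Rightarrow> real) \<Rightarrow> (nat set \<Rightarrow> real) \<Rightarrow> (nat set \<Rightarrow> real)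
                 \<Rightarrow> nat \<Rightarrow> nat set set" where
  "screen strong K alpha tauh sigh 0 = {{}}"
| "screen strong K alpha tauh sigh (Suc d) =
     (let Mh = screen strong K alpha tauh sigh d;
          C = candidates strong K Mh (Suc d)
      in Mh \<union> {KK \<in> C. \<bar>tauh KK / sigh KK\<bar> \<ge>
                 std_normal_quantile (1 - min (alpha (Suc d) / real (card C)) 1 / 2)})"

definition tauhat :: "nat \<Rightarrow> nat \<Rightarrow> (nat set \<Rightarrow> nat) \<Rightarrow> (nat \<Rightarrow> nat set \<Rightarrow> real) \<Rightarrow> (nat \<Rightarrow> nat set) \<Rightarrow> nat set \<Rightarrow> real" where
  "tauhat K N Nz Y Z KK = (1 / Qnum K) * (\<Sum>z\<in>treatments K. geff KK z * Yhat N Nz Y Z z)"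

definition sigmahat :: "nat \<Rightarrow> nat \<Rightarrow> (nat set \<Rightarrow> nat) \<Rightarrow> (nat \<Rightarrow> nat set \<Rightarrow> real) \<Rightarrow> (nat \<Rightarrow> nat set) \<Rightarrow> nat set \<Rightarrow> real" where
  "sigmahat K N Nz Y Z KK = sqrt ((1 / Qnum K ^ 2) * quad K (Vhat N Nz Y Z) (geff KK))"

definition Mhat :: "bool \<Rightarrow> nat \<Rightarrow> nat \<Rightarrow> (nat set \<Rightarrow> nat) \<Rightarrow> (nat \<Rightarrow> nat set \<Rightarrow> real) \<Rightarrow> (nat \<Rightarrow> real)
                    \<Rightarrow> (nat \<Rightarrow> nat set) \<Rightarrow> nat set set" where
  "Mhat strong K N Nz Y alpha Z = screen strong K alpha (tauhat K N Nz Y Z) (sigmahat K N Nz Y Z) K"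

definition heredity :: "bool \<Rightarrow> nat \<Rightarrow> nat \<Rightarrow> (nat \<Rightarrow> nat set \<Rightarrow> real) \<Rightarrow> bool" where
  "heredity strong K N Y \<longleftrightarrow>
     (\<forall>KK\<in>Pow {..<K}. KK \<noteq> {} \<and> tau K N Y KK \<noteq> 0 \<longrightarrow>
        (if strong then (\<forall>k\<in>KK. KK - {k} \<in> Mstar K N Y) else (\<exists>k\<in>KK. KK - {k} \<in> Mstar K N Y)))"


definition gamma :: "nat \<Rightarrow> nat \<Rightarrow> (nat \<Rightarrow> nat set \<Rightarrow> real) \<Rightarrow> (nat set \<Rightarrow> real) \<Rightarrow> real" where
  "gamma K N Y f = (\<Sum>z\<in>treatments K. f z * Ybar N Y z)"

definition fstar :: "nat \<Rightarrow> nat \<Rightarrow> (nat \<Rightarrow> nat set \<Rightarrow> real) \<Rightarrow> (nat set \<Rightarrow> real) \<Rightarrow> nat set \<Rightarrow> real" where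
  "fstar K N Y f = proj K (Mstar K N Y) f"

definition vR2 :: "nat \<Rightarrow> nat \<Rightarrow> (nat set \<Rightarrow> nat) \<Rightarrow> (nat \<Rightarrow> nat set \<Rightarrow> real) \<Rightarrow> (nat set \<Rightarrow> real) \<Rightarrow> real" where
  "vR2 K N Nz Y f = quad K (VY N Nz Y) (fstar K N Y f)"

definition vRlim2 :: "nat \<Rightarrow> nat \<Rightarrow> (nat set \<Rightarrow> nat) \<Rightarrow> (nat \<Rightarrow> nat set \<Rightarrow> real) \<Rightarrow> (nat set \<Rightarrow> real) \<Rightarrow> real" where
  "vRlim2 K N Nz Y f = quad K (DY N Nz Y) (fstar K N Y f)"

definition gammaR_hat :: "bool \<Rightarrow> nat \<Rightarrow> nat \<Rightarrow> (nat set \<Rightarrow> nat) \<Rightarrow> (nat \<Rightarrow> nat set \<Rightarrow> real) \<Rightarrow> (nat \<Rightarrow> real)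
                          \<Rightarrow> (nat set \<Rightarrow> real) \<Rightarrow> (nat \<Rightarrow> nat set) \<Rightarrow> real" where
  "gammaR_hat strong K N Nz Y alpha f Z =
     (\<Sum>z\<in>treatments K. proj K (Mhat strong K N Nz Y alpha Z) f z * Yhat N Nz Y Z z)"

definition vR2_hat :: "bool \<Rightarrow> nat \<Rightarrow> nat \<Rightarrow> (nat set \<Rightarrow> nat) \<Rightarrow> (nat \<Rightarrow> nat set \<Rightarrow> real) \<Rightarrow> (nat \<Rightarrow> real)
                          \<Rightarrow> (nat set \<Rightarrow> real) \<Rightarrow> (nat \<Rightarrow> nat set) \<Rightarrow> real" where
  "vR2_hat strong K N Nz Y alpha f Z =
     quad K (Vhat N Nz Y Z) (proj K (Mhat strong K N Nz Y alpha Z) f)"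

end

theory Submission
  imports Defs "HOL-Real_Asymp.Real_Asymp"
begin

text \<open>
  Under the design every assignment with the prescribed arm sizes is equally likely, so swapping the
  arms of two units preserves the distribution. Conditioning on one unit at a time and coupling by
  such a swap gives a McDiarmid inequality for functions with bounded swap differences. For a centred
  linear statistic \<open>X Z = (\<Sum>i. a i (Z i))\<close>, averaging \<open>X - X \<circ> swap\<close> over all pairs returns a multiple
  of \<open>X\<close>. This exchangeable-pair identity yields first-order differential inequalities for the
  moment generating function and for the characteristic function of \<open>X\<close>; they involve the
  conditional variance of a random swap, which concentrates by McDiarmid. The first inequality is a
  sub-Gaussian tail bound whose variance factor is sharp up to \<open>1 + 2\<eta>\<close>, the second a central limit theorem.

  All estimated effects share the same \<open>\<sigma>\<close>-hat because \<open>g\<^sup>2 = 1\<close>. A level-\<open>d\<close> null effect is selected with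
  probability at most a constant times \<open>(\<alpha>\<^sub>d / |C\<^sub>d|)\<close> to the power \<open>1 - 5\<eta>\<close>; since \<open>|C\<^sub>d| \<le> N\<close>, \<open>K \<le> log\<^sub>2 N\<close> and \<open>\<alpha>\<^sub>d\<close> is a negative
  power of \<open>N\<close>, a small \<open>\<eta>\<close> makes the total vanish. Nonzero effects are found by McDiarmid. So the
  selected model equals the true one with probability tending to one, and the central limit theorem
  applies to the contrast \<open>f\<^sup>\<star>\<close>: the condition number bounds \<open>v\<^sub>R\<^sup>2\<close> below by a multiple of \<open>\<parallel>f\<^sup>\<star>\<parallel>\<^sup>2\<close>, and as \<open>f\<^sup>\<star>\<close> lies
  in the span of the true model, \<open>\<parallel>f\<^sup>\<star>\<parallel>\<^sub>\<infinity>\<^sup>2 \<le> |M\<^sup>\<star>| \<parallel>f\<^sup>\<star>\<parallel>\<^sup>2 / Q\<close>.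
\<close>

section \<open>Concentration under random assignment\<close>

text \<open>\<open>K\<close> may grow with \<open>N\<close> while single arms keep as few as two
  units, so no individual arm obeys a limit theorem. Every bound below is for a statistic pooled
  over all arms, with constants that do not involve \<open>K\<close>. The Bonferroni levels dictate
  where sharp constants are needed. At level d up to |C_d| null effects are tested, each at level
  \<alpha>_d / |C_d|, and |C_d| may be a power of \<open>N\<close>. The McDiarmid exponent for a
  standardised effect is off by a constant factor, which would replace \<alpha>_d / |C_d| by a fixed
  smaller power of it and ruin the sum when \<delta>' is small. The differential inequality for the
  moment generating function loses only a factor that \<eta> brings as close to 1 as desired. Its
  error term is harmless: the swap variance of a standardised effect is off by more than \<eta> with
  probability exp(-cN), whereas exp(tX) never exceeds exp(c' t sqrt N), and the thresholds t grow
  only like sqrt(log N). McDiarmid alone suffices where a deviation is large compared with the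
  noise: for variance estimators up to a factor 1 + \<eta> and for signals of size \<open>N\<close>
  to the power \<delta>.\<close>

definition assigns :: "'i set \<Rightarrow> 'a set \<Rightarrow> ('a \<Rightarrow> nat) \<Rightarrow> ('i \<Rightarrow> 'a) set" where
  "assigns I T n = {Z \<in> I \<rightarrow>\<^sub>E T. \<forall>z\<in>T. card {i\<in>I. Z i = z} = n z}"

text \<open>Expectation under the uniform law on a finite set. A general normed field as codomain
  lets the same rules serve exponential moments and characteristic functions; on the empty set the
  value is 0.\<close>

definition avg :: "'c set \<Rightarrow> ('c \<Rightarrow> 'b::real_normed_field) \<Rightarrow> 'b" where
  "avg A F = (\<Sum>Z\<in>A. F Z) / of_nat (card A)"

definition swp :: "'i \<Rightarrow> 'i \<Rightarrow> ('i \<Rightarrow> 'a) \<Rightarrow> 'i \<Rightarrow> 'a" where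
  "swp i j Z = Z(i := Z j, j := Z i)"

lemma swp_swp [simp]: "swp i j (swp i j Z) = Z"
  by (auto simp: swp_def fun_eq_iff)

lemma swp_same [simp]: "swp i i Z = Z"
  by (auto simp: swp_def)

lemma finite_assigns: "finite I \<Longrightarrow> finite T \<Longrightarrow> finite (assigns I T n)"
  unfolding assigns_def by (rule finite_subset[of _ "I \<rightarrow>\<^sub>E T"]) (auto intro!: finite_PiE)

lemma swp_assigns:
  assumes "Z \<in> assigns I T n" "i \<in> I" "j \<in> I"
  shows "swp i j Z \<in> assigns I T n"
proof -
  have "card {k\<in>I. swp i j Z k = z} = card {k\<in>I. Z k = z}" for z
  proof (rule bij_betw_same_card[of "\<lambda>k. if k = i then j else if k = j then i else k"])
    show "bij_betw (\<lambda>k. if k = i then j else if k = j then i else k)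
        {k\<in>I. swp i j Z k = z} {k\<in>I. Z k = z}"
      by (rule bij_betwI[where g = "\<lambda>k. if k = i then j else if k = j then i else k"])
        (use assms in \<open>auto simp: swp_def split: if_splits\<close>)
  qed
  then show ?thesis
    using assms by (auto simp: assigns_def swp_def PiE_iff extensional_def)
qed

lemma bij_betw_swp:
  assumes "i \<in> I" "j \<in> I"
  shows "bij_betw (swp i j) (assigns I T n) (assigns I T n)"
  by (rule bij_betwI[where g = "swp i j"]) (use assms swp_assigns in auto)

lemma sum_swp:
  assumes "i \<in> I" "j \<in> I"
  shows "(\<Sum>Z\<in>assigns I T n. F (swp i j Z)) = (\<Sum>Z\<in>assigns I T n. F Z)"
  using sum.reindex_bij_betw[OF bij_betw_swp[OF assms]] .

text \<open>The linear term disappears on averaging: a centred variable bounded by c has exponential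
  moment at most exp(c^2). This is the one-step estimate of the McDiarmid induction.\<close>

lemma exp_le_add_exp_square: "exp (x::real) \<le> x + exp (x\<^sup>2)"
proof -
  have e: "1 + x\<^sup>2 \<le> exp (x\<^sup>2)" by (rule exp_ge_add_one_self)
  consider "x > 1" | "0 \<le> x" "x \<le> 1" | "-1 \<le> x" "x < 0" | "x < -1" by linarith
  then show ?thesis
  proof cases
    case 1
    then have "x \<le> x\<^sup>2" by (simp add: power2_eq_square)
    then have "exp x \<le> exp (x\<^sup>2)" by simp
    then show ?thesis using 1 by linarith
  next
    case 2
    then show ?thesis using exp_bound[of x] e by linarith
  next
    case 3
    define y where "y = -x"
    have y: "0 < y" "y \<le> 1" using 3 by (auto simp: y_def)
    have "exp x = 1 / exp y" by (simp add: y_def exp_minus field_simps)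
    also have "\<dots> \<le> 1 / (1 + y)"
      using y exp_ge_add_one_self[of y] by (intro divide_left_mono) auto
    also have "\<dots> \<le> 1 - y + y\<^sup>2"
    proof -
      have "(1 - y + y\<^sup>2) * (1 + y) = 1 + y ^ 3" by (simp add: algebra_simps power2_eq_square power3_eq_cube)
      moreover have "0 \<le> y ^ 3" using y by simp
      ultimately show ?thesis using y by (simp add: pos_divide_le_eq)
    qed
    finally have "exp x \<le> 1 + x + x\<^sup>2" by (simp add: y_def)
    then show ?thesis using e by linarith
  next
    case 4
    then have "0 \<le> x * (x + 1)" by (intro mult_nonpos_nonpos) auto
    then have "0 \<le> x + x\<^sup>2" by (simp add: algebra_simps power2_eq_square)
    moreover have "exp x \<le> 1" using 4 by simp
    ultimately show ?thesis using e by linarith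
  qed
qed

text \<open>Conditioning on the arm of unit i leaves a uniform assignment of the other units with
  one place fewer in arm z; \<open>assigns\<close> allows arbitrary unit sets and arm sizes so as to
  be closed under this. The inverse map resets coordinate i to \<open>undefined\<close>, its value
  outside the domain.\<close>

lemma assigns_insert_bij:
  assumes "i \<notin> I" "finite I" "z \<in> T" "n z > 0"
  shows "bij_betw (\<lambda>Z. Z(i := z)) (assigns I T (n(z := n z - 1)))
           {Z \<in> assigns (insert i I) T n. Z i = z}"
proof (rule bij_betwI[where g = "\<lambda>Z. Z(i := undefined)"])
  have c1: "{k\<in>insert i I. (Z(i := z)) k = w} =
      (if w = z then insert i {k\<in>I. Z k = w} else {k\<in>I. Z k = w})" for Z :: "'a \<Rightarrow> 'b" and w
    using assms by auto
  have c2: "{k\<in>I. (Z(i := undefined)) k = w} = {k\<in>insert i I. Z k = w} - (if w = Z i then {i} else {})"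
    for Z :: "'a \<Rightarrow> 'b" and w using assms(1) by (cases "w = Z i") (simp_all, blast, blast)
  show "(\<lambda>Z. Z(i := z)) \<in> assigns I T (n(z := n z - 1)) \<rightarrow> {Z \<in> assigns (insert i I) T n. Z i = z}"
  proof
    fix Z assume Z: "Z \<in> assigns I T (n(z := n z - 1))"
    have "card {k\<in>insert i I. (Z(i := z)) k = w} = n w" if "w \<in> T" for w
      unfolding c1 using Z that assms by (auto simp: assigns_def)
    then show "Z(i := z) \<in> {Z \<in> assigns (insert i I) T n. Z i = z}"
      using Z assms by (auto simp: assigns_def PiE_iff extensional_def)
  qed
  show "(\<lambda>Z. Z(i := undefined)) \<in> {Z \<in> assigns (insert i I) T n. Z i = z} \<rightarrow> assigns I T (n(z := n z - 1))"
  proof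
    fix Z assume Z: "Z \<in> {Z \<in> assigns (insert i I) T n. Z i = z}"
    have "card {k\<in>I. (Z(i := undefined)) k = w} = (n(z := n z - 1)) w" if "w \<in> T" for w
      unfolding c2 using Z that assms by (auto simp: assigns_def card_Diff_singleton)
    then show "Z(i := undefined) \<in> assigns I T (n(z := n z - 1))"
      using Z assms by (auto simp: assigns_def PiE_iff extensional_def)
  qed
next
  fix Z assume "Z \<in> assigns I T (n(z := n z - 1))"
  then have "Z i = undefined" using assms(1) by (simp add: assigns_def PiE_iff extensional_def)
  then show "(Z(i := z))(i := undefined) = Z" by (simp add: fun_eq_iff)
qed auto

lemma assigns_nonempty:
  assumes "finite I" "finite T" "(\<Sum>z\<in>T. n z) = card I"
  shows "assigns I T n \<noteq> {}"
  using assms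
proof (induction I arbitrary: n rule: finite_induct)
  case empty
  then show ?case by (auto simp: assigns_def)
next
  case (insert i I)
  then have "(\<Sum>z\<in>T. n z) \<noteq> 0" by simp
  then obtain z where z: "z \<in> T" "n z > 0"
    by (auto simp: insert.prems(1))
  have "(\<Sum>w\<in>T. (n(z := n z - 1)) w) = (\<Sum>w\<in>T - {z}. n w) + (n z - 1)"
    using z insert.prems(1) by (subst sum.remove[of T z]) (auto intro!: sum.cong)
  also have "\<dots> = card I"
    using insert z sum.remove[of T z n] by simp
  finally have "assigns I T (n(z := n z - 1)) \<noteq> {}"
    by (rule insert.IH[OF insert.prems(1)])
  then obtain Z where "Z \<in> assigns I T (n(z := n z - 1))" by blast
  then have "Z(i := z) \<in> assigns (insert i I) T n"
    using bij_betw_apply[OF assigns_insert_bij[where n = n, OF insert(2,1) z]] by blast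
  then show ?case by blast
qed

text \<open>Assignments with \<open>Z i = z\<close> and with \<open>Z i = z'\<close> are coupled by swapping \<open>i\<close> with a uniformly
  chosen unit of the other arm; counting the pairs in two ways identifies both conditional means.\<close>

lemma mean_swap_diff:
  fixes F :: "('i \<Rightarrow> 'a) \<Rightarrow> real"
  assumes fin: "finite I" "finite T" and i: "i \<in> I"
    and z: "z \<in> T" "z' \<in> T"
    and ne: "{Z \<in> assigns I T n. Z i = z} \<noteq> {}" "{Z \<in> assigns I T n. Z i = z'} \<noteq> {}"
    and F: "\<And>Z j. Z \<in> assigns I T n \<Longrightarrow> j \<in> I \<Longrightarrow> \<bar>F Z - F (swp i j Z)\<bar> \<le> c"
  shows "\<bar>avg {Z \<in> assigns I T n. Z i = z} F - avg {Z \<in> assigns I T n. Z i = z'} F\<bar> \<le> c"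
proof (cases "z = z'")
  case True
  obtain Z where "Z \<in> assigns I T n" using ne by auto
  from F[OF this i] have "0 \<le> c" by simp
  then show ?thesis using True by simp
next
  case False
  define A where "A w = {Z \<in> assigns I T n. Z i = w}" for w
  \<comment> \<open>The number of partners j in arm w is n w for every Z, so weighting assignments
    by pairs leaves their mean unchanged.\<close>
  define P where "P v w = Sigma (A v) (\<lambda>Z. {j\<in>I. Z j = w})" for v w
  have finA: "finite (A w)" for w unfolding A_def using finite_assigns[OF fin] by auto
  have sumP: "(\<Sum>p\<in>P v w. G (fst p)) = real (n w) * (\<Sum>Z\<in>A v. G Z)"
    if "w \<in> T" for v w and G :: "('i \<Rightarrow> 'a) \<Rightarrow> real"
  proof -
    have "(\<Sum>p\<in>P v w. G (fst p)) = (\<Sum>Z\<in>A v. \<Sum>j\<in>{j\<in>I. Z j = w}. G Z)"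
      unfolding P_def using finA fin by (subst sum.Sigma) (auto intro!: sum.cong)
    also have "\<dots> = (\<Sum>Z\<in>A v. real (n w) * G Z)"
      using that by (intro sum.cong) (auto simp: A_def assigns_def)
    finally show ?thesis by (simp add: sum_distrib_left)
  qed
  have bij: "bij_betw (\<lambda>(Z, j). (swp i j Z, j)) (P z z') (P z' z)"
    by (rule bij_betwI[where g = "\<lambda>(Z, j). (swp i j Z, j)"])
      (use i swp_assigns False in \<open>auto simp: P_def A_def swp_def\<close>)
  have card: "real (card (P v w)) = real (n w) * real (card (A v))" if "w \<in> T" for v w
    using sumP[OF that, where v = v and G = "\<lambda>_. 1"] by simp
  have cP: "card (P z z') = card (P z' z)" using bij by (rule bij_betw_same_card)
  have pos: "card (A v) > 0" if "v = z \<or> v = z'" for v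
    using ne that finA[of v] by (auto simp: A_def card_gt_0_iff)
  have npos: "n v > 0" if "v = z \<or> v = z'" for v
  proof -
    have "A v \<noteq> {}" using pos[OF that] by auto
    then obtain Z where Z: "Z \<in> A v" by blast
    then have n: "n v = card {k\<in>I. Z k = v}" and mem: "i \<in> {k\<in>I. Z k = v}"
      using that z i by (auto simp: A_def assigns_def)
    have "finite {k\<in>I. Z k = v}" using fin by simp
    then show ?thesis unfolding n using mem card_gt_0_iff by blast
  qed
  define q where "q = real (card (P z z'))"
  have q: "q = real (n z') * real (card (A z))" "q = real (n z) * real (card (A z'))"
    using card[OF z(2), of z] card[OF z(1), of z'] cP by (auto simp: q_def)
  have qpos: "q > 0" unfolding q using pos npos by simp
  have "avg (A z) F = (\<Sum>p\<in>P z z'. F (fst p)) / q"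
    unfolding sumP[OF z(2)] q(1) avg_def using npos[of z'] by simp
  moreover have "avg (A z') F = (\<Sum>p\<in>P z' z. F (fst p)) / q"
    unfolding sumP[OF z(1)] q(2) avg_def using npos[of z] by simp
  moreover have "(\<Sum>p\<in>P z' z. F (fst p)) = (\<Sum>p\<in>P z z'. F (swp i (snd p) (fst p)))"
    by (subst sum.reindex_bij_betw[OF bij, symmetric]) (auto intro!: sum.cong)
  ultimately have "avg (A z) F - avg (A z') F = (\<Sum>p\<in>P z z'. F (fst p) - F (swp i (snd p) (fst p))) / q"
    by (simp add: sum_subtractf diff_divide_distrib)
  moreover have "\<bar>\<Sum>p\<in>P z z'. F (fst p) - F (swp i (snd p) (fst p))\<bar> \<le> (\<Sum>p\<in>P z z'. c)"
    by (intro order_trans[OF sum_abs] sum_mono F) (auto simp: P_def A_def)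
  ultimately show ?thesis
    using qpos by (simp add: A_def q_def abs_divide pos_divide_le_eq mult.commute)
qed

text \<open>Induction on the units: conditioning on unit i splits F minus its mean into F - h z,
  controlled by the induction hypothesis within the class Z i = z, and h z - H, of size at most c by
  \<open>mean_swap_diff\<close>. Each unit costs a factor exp(c^2). The form without division also
  covers arm sizes that admit no assignment.\<close>

lemma exp_moment_bounded_differences:
  fixes F :: "('i \<Rightarrow> 'a) \<Rightarrow> real"
  assumes "finite I" "finite T"
    and "\<And>Z i j. Z \<in> assigns I T n \<Longrightarrow> i \<in> I \<Longrightarrow> j \<in> I \<Longrightarrow> \<bar>F Z - F (swp i j Z)\<bar> \<le> c"
  shows "(\<Sum>Z\<in>assigns I T n. exp (F Z - avg (assigns I T n) F))
     \<le> card (assigns I T n) * exp (real (card I) * c\<^sup>2)"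
  using assms(1,3)
proof (induction I arbitrary: n F rule: finite_induct)
  case empty
  have "assigns ({}::'i set) T n \<subseteq> {\<lambda>_. undefined}" by (auto simp: assigns_def)
  then have "assigns ({}::'i set) T n = {} \<or> assigns ({}::'i set) T n = {\<lambda>_. undefined}"
    by (rule subset_singletonD)
  then show ?case by (elim disjE) (simp_all add: avg_def)
next
  case (insert i I)
  let ?A = "assigns (insert i I) T n"
  define Az where "Az z = {Z \<in> ?A. Z i = z}" for z
  define T' where "T' = {z\<in>T. Az z \<noteq> {}}"
  define h where "h z = avg (Az z) F" for z
  define H where "H = avg ?A F"
  have finA: "finite ?A" by (rule finite_assigns) (use insert.hyps(1) assms(2) in simp_all)
  have finT': "finite T'" using assms(2) by (auto simp: T'_def)
  have finAz: "finite (Az z)" for z using finA by (auto simp: Az_def)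
  have "Z i \<in> T" if "Z \<in> ?A" for Z using that by (simp add: assigns_def PiE_iff)
  then have U: "?A = (\<Union>z\<in>T'. Az z)"
    unfolding Az_def T'_def by blast
  have sumA: "(\<Sum>Z\<in>?A. G Z) = (\<Sum>z\<in>T'. \<Sum>Z\<in>Az z. G Z)" for G :: "('i \<Rightarrow> 'a) \<Rightarrow> real"
    by (subst U, rule sum.UNION_disjoint) (use finT' finAz in \<open>auto simp: Az_def\<close>)
  have cardA: "real (card ?A) = (\<Sum>z\<in>T'. real (card (Az z)))"
    using sumA[of "\<lambda>_. 1"] by simp
  have IH: "(\<Sum>Z\<in>Az z. exp (F Z - h z)) \<le> card (Az z) * exp (real (card I) * c\<^sup>2)" if "z \<in> T'" for z
  proof -
    have zT: "z \<in> T" and "Az z \<noteq> {}" using that by (auto simp: T'_def)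
    then obtain Z0 where Z0: "Z0 \<in> ?A" "Z0 i = z" by (auto simp: Az_def)
    then have nz: "n z = card {k\<in>insert i I. Z0 k = z}" using zT by (auto simp: assigns_def)
    have "{k\<in>insert i I. Z0 k = z} \<noteq> {}" using Z0 by auto
    then have nz: "n z > 0" unfolding nz using insert(1) by (subst card_gt_0_iff) auto
    let ?n = "n(z := n z - 1)"
    let ?B = "assigns I T ?n"
    have bij: "bij_betw (\<lambda>Z. Z(i := z)) ?B (Az z)"
      unfolding Az_def by (rule assigns_insert_bij[where n = n, OF insert(2,1) zT nz])
    have s: "(\<Sum>Z\<in>Az z. G Z) = (\<Sum>Z\<in>?B. G (Z(i := z)))" for G :: "('i \<Rightarrow> 'a) \<Rightarrow> real"
      using sum.reindex_bij_betw[OF bij] by metis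
    have cd: "card (Az z) = card ?B" using bij_betw_same_card[OF bij] by simp
    have h: "h z = avg ?B (\<lambda>Z. F (Z(i := z)))" unfolding h_def avg_def s cd ..
    have "(\<Sum>Z\<in>?B. exp (F (Z(i := z)) - avg ?B (\<lambda>Z. F (Z(i := z)))))
        \<le> card ?B * exp (real (card I) * c\<^sup>2)"
    proof (rule insert.IH)
      fix Z j k assume Z: "Z \<in> ?B" and jk: "j \<in> I" "k \<in> I"
      have "Z(i := z) \<in> ?A" using bij Z by (auto simp: bij_betw_def Az_def)
      then have "\<bar>F (Z(i := z)) - F (swp j k (Z(i := z)))\<bar> \<le> c"
        by (rule insert.prems) (use jk in blast)+
      moreover have "swp j k (Z(i := z)) = (swp j k Z)(i := z)"
        using jk insert(2) by (auto simp: swp_def fun_eq_iff)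
      ultimately show "\<bar>F (Z(i := z)) - F ((swp j k Z)(i := z))\<bar> \<le> c" by simp
    qed
    then show ?thesis by (simp add: s cd h)
  qed
  have hdiff: "\<bar>h z - h w\<bar> \<le> c" if "z \<in> T'" "w \<in> T'" for z w
    unfolding h_def Az_def
  proof (rule mean_swap_diff)
    show "\<bar>F Z - F (swp i j Z)\<bar> \<le> c" if "Z \<in> ?A" "j \<in> insert i I" for Z j
      by (rule insert.prems) (use that in auto)
  qed (use that insert.hyps(1) assms(2) in \<open>auto simp: T'_def Az_def\<close>)
  have hAz: "(\<Sum>Z\<in>Az z. F Z) = real (card (Az z)) * h z" for z
    using finAz[of z] by (cases "Az z = {}") (auto simp: h_def avg_def)
  have main: "(\<Sum>Z\<in>?A. exp (F Z - H)) \<le> card ?A * exp (real (card (insert i I)) * c\<^sup>2)"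
  proof (cases "?A = {}")
    case False
    then have cpos: "real (card ?A) > 0" using finA by (simp add: card_gt_0_iff)
    have H: "real (card ?A) * H = (\<Sum>z\<in>T'. real (card (Az z)) * h z)"
      unfolding H_def avg_def sumA hAz using cpos by simp
    have hH: "\<bar>h z - H\<bar> \<le> c" if z: "z \<in> T'" for z
    proof -
      have "real (card ?A) * (h z - H) = (\<Sum>w\<in>T'. real (card (Az w)) * (h z - h w))"
        unfolding right_diff_distrib H unfolding cardA by (simp add: sum_subtractf sum_distrib_right)
      also have "\<bar>\<dots>\<bar> \<le> (\<Sum>w\<in>T'. real (card (Az w)) * c)"
        by (intro order_trans[OF sum_abs] sum_mono) (auto simp: abs_mult intro!: mult_left_mono hdiff z)
      also have "\<dots> = real (card ?A) * c" unfolding cardA by (simp add: sum_distrib_right)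
      finally show ?thesis using cpos by (simp add: abs_mult)
    qed
    have "(\<Sum>Z\<in>?A. exp (F Z - H)) = (\<Sum>z\<in>T'. exp (h z - H) * (\<Sum>Z\<in>Az z. exp (F Z - h z)))"
      unfolding sumA sum_distrib_left by (simp add: mult_exp_exp)
    also have "\<dots> \<le> (\<Sum>z\<in>T'. exp (h z - H) * (card (Az z) * exp (real (card I) * c\<^sup>2)))"
      by (intro sum_mono mult_left_mono IH) auto
    also have "\<dots> = exp (real (card I) * c\<^sup>2) * (\<Sum>z\<in>T'. card (Az z) * exp (h z - H))"
      by (simp add: sum_distrib_left mult_ac)
    \<comment> \<open>H is the average of the h z weighted by class size, so the linear terms
      produced here sum to zero.\<close>
    also have "(\<Sum>z\<in>T'. card (Az z) * exp (h z - H)) \<le> (\<Sum>z\<in>T'. card (Az z) * ((h z - H) + exp (c\<^sup>2)))"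
    proof (intro sum_mono mult_left_mono)
      fix z assume "z \<in> T'"
      have "(h z - H)\<^sup>2 \<le> c\<^sup>2" using power_mono[OF hH[OF \<open>z \<in> T'\<close>], of 2] by simp
      then have "exp ((h z - H)\<^sup>2) \<le> exp (c\<^sup>2)" by simp
      then show "exp (h z - H) \<le> (h z - H) + exp (c\<^sup>2)"
        using exp_le_add_exp_square[of "h z - H"] by linarith
    qed auto
    also have "\<dots> = (\<Sum>z\<in>T'. card (Az z) * h z) - real (card ?A) * H + card ?A * exp (c\<^sup>2)"
      unfolding cardA by (simp add: algebra_simps sum.distrib sum_subtractf sum_distrib_left)
    also have "\<dots> = card ?A * exp (c\<^sup>2)" using H by simp
    finally show ?thesis using insert(1,2)
      by (simp add: exp_add distrib_right mult_ac)
  qed simp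
  then show ?case by (simp add: H_def)
qed

section \<open>Rules for averages over assignments\<close>

lemma avg_mono:
  fixes F G :: "'c \<Rightarrow> real"
  assumes "\<And>Z. Z \<in> A \<Longrightarrow> F Z \<le> G Z"
  shows "avg A F \<le> avg A G"
  unfolding avg_def by (intro divide_right_mono sum_mono assms) auto

lemma avg_cong: "(\<And>Z. Z \<in> A \<Longrightarrow> F Z = G Z) \<Longrightarrow> avg A F = avg A G"
  unfolding avg_def by (simp cong: sum.cong)

lemma avg_add: "avg A (\<lambda>Z. F Z + G Z) = avg A F + avg A G"
  by (simp add: avg_def sum.distrib add_divide_distrib)

lemma avg_diff: "avg A (\<lambda>Z. F Z - G Z) = avg A F - avg A G"
  by (simp add: avg_def sum_subtractf diff_divide_distrib)

lemma avg_cmult: "avg A (\<lambda>Z. c * F Z) = c * avg A F"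
  by (simp add: avg_def sum_distrib_left[symmetric])

lemma avg_cmult_right: "avg A (\<lambda>Z. F Z * c) = avg A F * c"
  by (simp add: avg_def sum_distrib_right[symmetric])

lemma avg_divide: "avg A (\<lambda>Z. F Z / c) = avg A F / c"
  using avg_cmult_right[of A F "inverse c"] by (simp add: divide_inverse)

lemma avg_sum: "avg A (\<lambda>Z. \<Sum>i\<in>J. F i Z) = (\<Sum>i\<in>J. avg A (F i))"
  unfolding avg_def by (subst sum.swap) (simp add: sum_divide_distrib)

lemma avg_zero [simp]: "avg A (\<lambda>Z. 0) = 0"
  by (simp add: avg_def)

lemma norm_avg_le: "norm (avg A F) \<le> avg A (\<lambda>Z. norm (F Z))"
  by (simp add: avg_def norm_divide norm_sum divide_right_mono)

lemma DERIV_avg: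
  fixes F :: "real \<Rightarrow> 'c \<Rightarrow> real"
  assumes "\<And>Z. Z \<in> A \<Longrightarrow> ((\<lambda>s. F s Z) has_real_derivative F' Z) (at s)"
  shows "((\<lambda>s. avg A (F s)) has_real_derivative avg A F') (at s)"
  unfolding avg_def by (intro DERIV_cdivide DERIV_sum assms)

lemma has_vector_derivative_avg:
  fixes F :: "real \<Rightarrow> 'c \<Rightarrow> complex"
  assumes "\<And>Z. Z \<in> A \<Longrightarrow> ((\<lambda>s. F s Z) has_vector_derivative F' Z) (at s)"
  shows "((\<lambda>s. avg A (F s)) has_vector_derivative avg A F') (at s)"
  unfolding avg_def by (intro has_vector_derivative_divide has_vector_derivative_sum assms)

text \<open>The logarithmic mean of exp x and exp y is at most their arithmetic mean, multiplied out
  to avoid dividing by x - y. The right side is symmetric in x and y, which matters when they belong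
  to an assignment and its swap.\<close>

lemma exp_diff_mult_le:
  fixes x y :: real
  shows "(x - y) * (exp x - exp y) \<le> (x - y)\<^sup>2 * ((exp x + exp y) / 2)"
proof -
  have pos: "(1 - exp (- d)) \<le> d * ((1 + exp (- d)) / 2)" if "0 \<le> d" for d :: real
  proof -
    have "(\<lambda>d::real. d * ((1 + exp (- d)) / 2) - (1 - exp (- d))) 0 \<le>
        (\<lambda>d. d * ((1 + exp (- d)) / 2) - (1 - exp (- d))) d"
    proof (rule DERIV_nonneg_imp_nondecreasing[OF that])
      fix x :: real assume x: "0 \<le> x"
      have "(1 + x) * exp (- x) \<le> exp x * exp (- x)"
        using exp_ge_add_one_self[of x] by (intro mult_right_mono) auto
      then have "0 \<le> (1 - exp (- x) - x * exp (- x)) / 2"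
        by (simp add: exp_minus_inverse algebra_simps)
      moreover have "((\<lambda>d::real. d * ((1 + exp (- d)) / 2) - (1 - exp (- d))) has_real_derivative
          (1 - exp (- x) - x * exp (- x)) / 2) (at x)"
        by (auto intro!: derivative_eq_intros simp: field_simps)
      ultimately show "\<exists>y. ((\<lambda>d::real. d * ((1 + exp (- d)) / 2) - (1 - exp (- d))) has_real_derivative y) (at x) \<and> 0 \<le> y"
        by blast
    qed
    then show ?thesis by simp
  qed
  have ord: "(x - y) * (exp x - exp y) \<le> (x - y)\<^sup>2 * ((exp x + exp y) / 2)" if "y \<le> x" for x y :: real
  proof -
    have e: "exp y = exp x * exp (- (x - y))" by (simp add: exp_add[symmetric])
    have "(x - y) * (exp x - exp y) = (x - y) * exp x * (1 - exp (- (x - y)))"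
      by (subst e) (simp add: algebra_simps)
    also have "\<dots> \<le> (x - y) * exp x * ((x - y) * ((1 + exp (- (x - y))) / 2))"
      using that by (intro mult_left_mono pos) auto
    also have "\<dots> = (x - y)\<^sup>2 * ((exp x + exp x * exp (- (x - y))) / 2)"
      by (simp add: power2_eq_square field_simps)
    finally show ?thesis by (simp only: e[symmetric])
  qed
  show ?thesis
  proof (cases "y \<le> x")
    case False
    then have "(y - x) * (exp y - exp x) \<le> (y - x)\<^sup>2 * ((exp y + exp x) / 2)" by (intro ord) simp
    then show ?thesis by (simp add: power2_commute add.commute algebra_simps)
  qed (rule ord)
qed

section \<open>Tail bounds and mixed moments of a uniform random assignment\<close>

locale randomization =
  fixes I :: "'i set" and T :: "'a set" and n :: "'a \<Rightarrow> nat"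
  assumes finite_I: "finite I" and finite_T: "finite T"
    and n_sum: "(\<Sum>z\<in>T. n z) = card I" and I_nonempty: "I \<noteq> {}"
begin

abbreviation Om :: "('i \<Rightarrow> 'a) set" where "Om \<equiv> assigns I T n"
abbreviation "NN \<equiv> real (card I)"

text \<open>An average of indicators, so Chernoff bounds are instances of \<open>avg_mono\<close>;
  \<open>design_prob\<close> identifies it with the measure of the design.\<close>

definition prob :: "(('i \<Rightarrow> 'a) \<Rightarrow> bool) \<Rightarrow> real" where
  "prob P = avg Om (\<lambda>Z. of_bool (P Z))"

lemma finite_Om: "finite Om" using finite_assigns finite_I finite_T by blast
lemma Om_nonempty: "Om \<noteq> {}" using assigns_nonempty finite_I finite_T n_sum by blast
lemma card_Om_pos: "card Om > 0" using finite_Om Om_nonempty by (simp add: card_gt_0_iff)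
lemma NN_pos: "NN > 0" using finite_I I_nonempty by (simp add: card_gt_0_iff)

lemma avg_const [simp]: "avg Om (\<lambda>Z. c) = c"
  using card_Om_pos by (simp add: avg_def)

lemma avg_swp: "i \<in> I \<Longrightarrow> j \<in> I \<Longrightarrow> avg Om (\<lambda>Z. F (swp i j Z)) = avg Om F"
  by (simp add: avg_def sum_swp)

lemma prob_mono: "(\<And>Z. Z \<in> Om \<Longrightarrow> P Z \<Longrightarrow> R Z) \<Longrightarrow> prob P \<le> prob R"
  unfolding prob_def by (intro avg_mono) auto

lemma prob_disj_le: "prob (\<lambda>Z. P Z \<or> R Z) \<le> prob P + prob R"
  unfolding prob_def avg_add[symmetric] by (intro avg_mono) auto

lemma prob_Bex_le: "finite J \<Longrightarrow> prob (\<lambda>Z. \<exists>j\<in>J. P j Z) \<le> (\<Sum>j\<in>J. prob (P j))"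
proof (induction J rule: finite_induct)
  case empty
  then show ?case by (simp add: prob_def)
next
  case (insert x F)
  have "prob (\<lambda>Z. \<exists>j\<in>insert x F. P j Z) \<le> prob (P x) + prob (\<lambda>Z. \<exists>j\<in>F. P j Z)"
    using prob_disj_le[of "P x" "\<lambda>Z. \<exists>j\<in>F. P j Z"] by simp
  then show ?case using insert by simp
qed

lemma bounded_differences_tail_upper:
  fixes F :: "('i \<Rightarrow> 'a) \<Rightarrow> real"
  assumes F: "\<And>Z i j. Z \<in> Om \<Longrightarrow> i \<in> I \<Longrightarrow> j \<in> I \<Longrightarrow> \<bar>F Z - F (swp i j Z)\<bar> \<le> c"
    and c: "0 < c" and \<epsilon>: "0 < \<epsilon>"
  shows "prob (\<lambda>Z. F Z - avg Om F \<ge> \<epsilon>) \<le> exp (- (\<epsilon>\<^sup>2 / (4 * NN * c\<^sup>2)))"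
proof -
  \<comment> \<open>The minimiser of - l \<epsilon> + NN (l c)^2, the Chernoff exponent.\<close>
  define l where "l = \<epsilon> / (2 * NN * c\<^sup>2)"
  have l: "l > 0" using c \<epsilon> NN_pos by (simp add: l_def)
  have al: "avg Om (\<lambda>Z. l * F Z) = l * avg Om F" by (rule avg_cmult)
  have "(\<Sum>Z\<in>Om. exp (l * F Z - avg Om (\<lambda>Z. l * F Z))) \<le> card Om * exp (NN * (l * c)\<^sup>2)"
  proof (rule exp_moment_bounded_differences[OF finite_I finite_T])
    fix Z i j assume "Z \<in> Om" "i \<in> I" "j \<in> I"
    then have "\<bar>l * (F Z - F (swp i j Z))\<bar> \<le> l * c" using F l by (simp add: abs_mult)
    then show "\<bar>l * F Z - l * F (swp i j Z)\<bar> \<le> l * c" by (simp add: right_diff_distrib)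
  qed
  then have "avg Om (\<lambda>Z. exp (l * F Z - avg Om (\<lambda>Z. l * F Z))) \<le> exp (NN * (l * c)\<^sup>2)"
    using card_Om_pos by (simp add: avg_def pos_divide_le_eq mult.commute)
  then have m: "avg Om (\<lambda>Z. exp (l * (F Z - avg Om F))) \<le> exp (NN * (l * c)\<^sup>2)"
    by (simp only: al right_diff_distrib)
  have "prob (\<lambda>Z. F Z - avg Om F \<ge> \<epsilon>) \<le> avg Om (\<lambda>Z. exp (- (l * \<epsilon>)) * exp (l * (F Z - avg Om F)))"
    unfolding prob_def
  proof (rule avg_mono)
    fix Z
    show "of_bool (F Z - avg Om F \<ge> \<epsilon>) \<le> exp (- (l * \<epsilon>)) * exp (l * (F Z - avg Om F))"
      using l by (auto simp: exp_add[symmetric])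
  qed
  also have "\<dots> \<le> exp (- (l * \<epsilon>)) * exp (NN * (l * c)\<^sup>2)"
    unfolding avg_cmult using m by (intro mult_left_mono) auto
  also have "\<dots> = exp (- (\<epsilon>\<^sup>2 / (4 * NN * c\<^sup>2)))"
  proof -
    have "- (l * \<epsilon>) + NN * (l * c)\<^sup>2 = - (\<epsilon>\<^sup>2 / (4 * NN * c\<^sup>2))"
      using c NN_pos by (simp add: l_def field_simps power2_eq_square)
    then show ?thesis by (simp add: exp_add[symmetric])
  qed
  finally show ?thesis .
qed

lemma bounded_differences_tail:
  fixes F :: "('i \<Rightarrow> 'a) \<Rightarrow> real"
  assumes F: "\<And>Z i j. Z \<in> Om \<Longrightarrow> i \<in> I \<Longrightarrow> j \<in> I \<Longrightarrow> \<bar>F Z - F (swp i j Z)\<bar> \<le> c"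
    and c: "0 < c" and \<epsilon>: "0 < \<epsilon>"
  shows "prob (\<lambda>Z. \<bar>F Z - avg Om F\<bar> \<ge> \<epsilon>) \<le> 2 * exp (- (\<epsilon>\<^sup>2 / (4 * NN * c\<^sup>2)))"
proof -
  have "prob (\<lambda>Z. (- F Z) - avg Om (\<lambda>Z. - F Z) \<ge> \<epsilon>) \<le> exp (- (\<epsilon>\<^sup>2 / (4 * NN * c\<^sup>2)))"
  proof (rule bounded_differences_tail_upper[OF _ c \<epsilon>])
    fix Z i j assume "Z \<in> Om" "i \<in> I" "j \<in> I"
    from F[OF this] show "\<bar>- F Z - - F (swp i j Z)\<bar> \<le> c" by linarith
  qed
  moreover have "avg Om (\<lambda>Z. - F Z) = - avg Om F" using avg_cmult[of Om "-1" F] by simp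
  moreover have "prob (\<lambda>Z. F Z - avg Om F \<ge> \<epsilon>) \<le> exp (- (\<epsilon>\<^sup>2 / (4 * NN * c\<^sup>2)))"
    using assms by (rule bounded_differences_tail_upper)
  moreover have "prob (\<lambda>Z. \<bar>F Z - avg Om F\<bar> \<ge> \<epsilon>) \<le>
      prob (\<lambda>Z. F Z - avg Om F \<ge> \<epsilon> \<or> (- F Z) - (- avg Om F) \<ge> \<epsilon>)"
    by (rule prob_mono) linarith
  moreover note prob_disj_le[of "\<lambda>Z. F Z - avg Om F \<ge> \<epsilon>" "\<lambda>Z. (- F Z) - (- avg Om F) \<ge> \<epsilon>"]
  ultimately show ?thesis by simp
qed

text \<open>At the scale s = sqrt NN * c both exponential moments of the deviation D, measured in
  units of s, are at most e; |D| \<le> exp D + exp (-D) and 2e \<le> 6 give the constant.\<close>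

lemma bounded_differences_mean_abs:
  fixes F :: "('i \<Rightarrow> 'a) \<Rightarrow> real"
  assumes F: "\<And>Z i j. Z \<in> Om \<Longrightarrow> i \<in> I \<Longrightarrow> j \<in> I \<Longrightarrow> \<bar>F Z - F (swp i j Z)\<bar> \<le> c"
    and c: "0 < c"
  shows "avg Om (\<lambda>Z. \<bar>F Z - avg Om F\<bar>) \<le> 6 * sqrt NN * c"
proof -
  define s where "s = sqrt NN * c"
  have s: "s > 0" using c NN_pos by (simp add: s_def)
  have m: "avg Om (\<lambda>Z. exp ((e * F Z - avg Om (\<lambda>Z. e * F Z)))) \<le> exp 1" if e: "\<bar>e\<bar> = 1 / s" for e
  proof -
    have "(\<Sum>Z\<in>Om. exp (e * F Z - avg Om (\<lambda>Z. e * F Z))) \<le> card Om * exp (NN * (c / s)\<^sup>2)"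
    proof (rule exp_moment_bounded_differences[OF finite_I finite_T])
      fix Z i j assume "Z \<in> Om" "i \<in> I" "j \<in> I"
      then have "\<bar>e * (F Z - F (swp i j Z))\<bar> \<le> c / s"
        using F s e by (simp add: abs_mult divide_right_mono)
      then show "\<bar>e * F Z - e * F (swp i j Z)\<bar> \<le> c / s" by (simp add: right_diff_distrib)
    qed
    also have "NN * (c / s)\<^sup>2 = 1" using c NN_pos by (simp add: s_def power_divide power_mult_distrib)
    finally show ?thesis using card_Om_pos by (simp add: avg_def pos_divide_le_eq mult.commute)
  qed
  have "avg Om (\<lambda>Z. \<bar>F Z - avg Om F\<bar>) \<le> avg Om (\<lambda>Z. s * (exp ((1/s) * F Z - avg Om (\<lambda>Z. (1/s) * F Z)) +
      exp ((-1/s) * F Z - avg Om (\<lambda>Z. (-1/s) * F Z))))"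
  proof (rule avg_mono)
    fix Z
    define D where "D = (F Z - avg Om F) / s"
    have "\<bar>D\<bar> \<le> exp D + exp (- D)"
      using exp_ge_add_one_self[of D] exp_ge_add_one_self[of "- D"] exp_gt_zero[of D] exp_gt_zero[of "-D"]
      by linarith
    moreover have "\<bar>F Z - avg Om F\<bar> = s * \<bar>D\<bar>" using s by (simp add: D_def abs_divide)
    moreover have "(1/s) * F Z - avg Om (\<lambda>Z. (1/s) * F Z) = D"
      unfolding avg_cmult by (simp add: D_def diff_divide_distrib)
    moreover have "(-1/s) * F Z - avg Om (\<lambda>Z. (-1/s) * F Z) = - D"
      unfolding avg_cmult by (simp add: D_def diff_divide_distrib)
    ultimately show "\<bar>F Z - avg Om F\<bar> \<le> s * (exp ((1/s) * F Z - avg Om (\<lambda>Z. (1/s) * F Z)) +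
      exp ((-1/s) * F Z - avg Om (\<lambda>Z. (-1/s) * F Z)))"
      using s by simp
  qed
  also have "\<dots> \<le> s * (exp 1 + exp 1)"
    unfolding avg_cmult[of _ s] avg_add using s by (intro mult_left_mono add_mono m) auto
  also have "\<dots> \<le> s * 6" using exp_le s by (intro mult_left_mono) auto
  finally show ?thesis by (simp add: s_def mult_ac)
qed

lemma sum_over_units:
  fixes g :: "'a \<Rightarrow> 'b::real_algebra_1"
  assumes "Z \<in> Om"
  shows "(\<Sum>i\<in>I. g (Z i)) = (\<Sum>z\<in>T. of_nat (n z) * g z)"
proof -
  have im: "Z ` I \<subseteq> T" using assms by (auto simp: assigns_def PiE_iff)
  have "(\<Sum>i\<in>I. g (Z i)) = (\<Sum>z\<in>T. \<Sum>i\<in>{i\<in>I. Z i = z}. g (Z i))"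
    by (rule sum.group[symmetric, OF finite_I finite_T im])
  also have "\<dots> = (\<Sum>z\<in>T. of_nat (n z) * g z)"
    by (intro sum.cong) (use assms in \<open>auto simp: assigns_def\<close>)
  finally show ?thesis .
qed

text \<open>Swap invariance makes the mean the same for all units, and the sum over units is not
  random because the arm sizes are fixed.\<close>

lemma avg_unit:
  fixes \<phi> :: "'a \<Rightarrow> real"
  assumes i: "i \<in> I"
  shows "avg Om (\<lambda>Z. \<phi> (Z i)) = (\<Sum>z\<in>T. n z * \<phi> z) / NN"
proof -
  have "avg Om (\<lambda>Z. \<phi> (Z j)) = avg Om (\<lambda>Z. \<phi> (Z i))" if "j \<in> I" for j
    using avg_swp[OF i that, of "\<lambda>Z. \<phi> (Z i)"] by (cases "i = j") (simp_all add: swp_def)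
  then have "NN * avg Om (\<lambda>Z. \<phi> (Z i)) = (\<Sum>j\<in>I. avg Om (\<lambda>Z. \<phi> (Z j)))" by simp
  also have "\<dots> = avg Om (\<lambda>Z. \<Sum>z\<in>T. n z * \<phi> z)"
    unfolding avg_sum[symmetric] using sum_over_units[of _ \<phi>] by (intro avg_cong) simp
  finally show ?thesis using NN_pos by (simp add: field_simps)
qed

text \<open>The argument for one unit applied to ordered pairs: the double sum over all units is
  deterministic, its diagonal is subtracted, and the NN (NN - 1) remaining pairs share one
  mean.\<close>

lemma avg_pair:
  fixes \<phi> :: "'a \<Rightarrow> 'a \<Rightarrow> real"
  assumes i: "i \<in> I" and j: "j \<in> I" and ij: "i \<noteq> j"
  shows "avg Om (\<lambda>Z. \<phi> (Z i) (Z j)) =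
    ((\<Sum>z\<in>T. \<Sum>w\<in>T. n z * n w * \<phi> z w) - (\<Sum>z\<in>T. n z * \<phi> z z)) / (NN * (NN - 1))"
proof -
  define M where "M i j = avg Om (\<lambda>Z. \<phi> (Z i) (Z j))" for i j
  have M1: "M i j = M k j" if "i \<in> I" "k \<in> I" "k \<noteq> j" "i \<noteq> j" for i j k
    using avg_swp[OF that(1,2), of "\<lambda>Z. \<phi> (Z i) (Z j)"] that by (cases "i = k") (simp_all add: swp_def M_def)
  have M2: "M i j = M i l" if "j \<in> I" "l \<in> I" "l \<noteq> i" "i \<noteq> j" for i j l
    using avg_swp[OF that(1,2), of "\<lambda>Z. \<phi> (Z i) (Z j)"] that by (cases "j = l") (simp_all add: swp_def M_def)
  have M3: "M i j = M j i" if "i \<in> I" "j \<in> I" for i j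
    using avg_swp[OF that(1,2), of "\<lambda>Z. \<phi> (Z i) (Z j)"] that by (cases "i = j") (simp_all add: swp_def M_def)
  \<comment> \<open>Any ordered pair of distinct units is carried to (i, j) by changing one entry at
    a time or exchanging both; the cases keep the intermediate entries distinct.\<close>
  have eq: "M k l = M i j" if "k \<in> I" "l \<in> I" "k \<noteq> l" for k l
  proof -
    consider "k = i" | "k = j" | "k \<noteq> i" "k \<noteq> j" by blast
    then show ?thesis
    proof cases
      case 1
      then show ?thesis using M2[of j l i] that i j ij by simp
    next
      case 2
      then show ?thesis using M3[OF i j] M2[of i l j] that i j ij by simp
    next
      case 3
      then show ?thesis using M1[of i k j] M2[of j l k] that i j ij by simp
    qed
  qed
  have "(\<Sum>k\<in>I. \<Sum>l\<in>I - {k}. M k l) = (\<Sum>k\<in>I. \<Sum>l\<in>I - {k}. M i j)"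
    by (intro sum.cong refl eq) auto
  also have "\<dots> = NN * ((NN - 1) * M i j)"
    using finite_I NN_pos by (simp add: card_Diff_singleton of_nat_diff Suc_leI)
  finally have 1: "(\<Sum>k\<in>I. \<Sum>l\<in>I - {k}. M k l) = NN * ((NN - 1) * M i j)" .
  have "(\<Sum>k\<in>I. \<Sum>l\<in>I - {k}. M k l) = avg Om (\<lambda>Z. \<Sum>k\<in>I. \<Sum>l\<in>I - {k}. \<phi> (Z k) (Z l))"
    unfolding avg_sum M_def ..
  also have "\<dots> = avg Om (\<lambda>Z. (\<Sum>z\<in>T. \<Sum>w\<in>T. n z * n w * \<phi> z w) - (\<Sum>z\<in>T. n z * \<phi> z z))"
  proof (rule avg_cong)
    fix Z assume Z: "Z \<in> Om"
    have "(\<Sum>k\<in>I. \<Sum>l\<in>I - {k}. \<phi> (Z k) (Z l)) = (\<Sum>k\<in>I. (\<Sum>l\<in>I. \<phi> (Z k) (Z l)) - \<phi> (Z k) (Z k))"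
      using finite_I by (intro sum.cong) (auto simp: sum_diff1)
    also have "\<dots> = (\<Sum>k\<in>I. (\<Sum>w\<in>T. n w * \<phi> (Z k) w)) - (\<Sum>z\<in>T. n z * \<phi> z z)"
      unfolding sum_subtractf using sum_over_units[OF Z, of "\<lambda>z. \<phi> z z"] sum_over_units[OF Z, of "\<phi> _"] by simp
    also have "(\<Sum>k\<in>I. (\<Sum>w\<in>T. n w * \<phi> (Z k) w)) = (\<Sum>z\<in>T. n z * (\<Sum>w\<in>T. n w * \<phi> z w))"
      using sum_over_units[OF Z, of "\<lambda>z. \<Sum>w\<in>T. n w * \<phi> z w"] by simp
    finally show "(\<Sum>k\<in>I. \<Sum>l\<in>I - {k}. \<phi> (Z k) (Z l)) =
        (\<Sum>z\<in>T. \<Sum>w\<in>T. n z * n w * \<phi> z w) - (\<Sum>z\<in>T. n z * \<phi> z z)"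
      by (simp add: sum_distrib_left mult.assoc)
  qed
  also have "\<dots> = (\<Sum>z\<in>T. \<Sum>w\<in>T. n z * n w * \<phi> z w) - (\<Sum>z\<in>T. n z * \<phi> z z)" by simp
  finally have 2: "NN * ((NN - 1) * M i j) = \<dots>" using 1 by simp
  have "card {i, j} \<le> card I" using i j finite_I by (intro card_mono) auto
  then have "NN - 1 \<noteq> 0" using ij by simp
  then show ?thesis using 2 NN_pos unfolding M_def by (simp add: field_simps)
qed

end

section \<open>Linear statistics: variance, sharp exponential tail, characteristic function\<close>

locale linear_statistic = randomization I T n
  for I :: "'i set" and T :: "'a set" and n :: "'a \<Rightarrow> nat" +
  fixes a :: "'i \<Rightarrow> 'a \<Rightarrow> real" and B :: real
  assumes centred: "z \<in> T \<Longrightarrow> (\<Sum>i\<in>I. a i z) = 0"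
    and bounded: "i \<in> I \<Longrightarrow> z \<in> T \<Longrightarrow> \<bar>a i z\<bar> \<le> B" and B_pos: "B > 0"
begin

definition X :: "('i \<Rightarrow> 'a) \<Rightarrow> real" where "X Z = (\<Sum>i\<in>I. a i (Z i))"

definition d :: "'i \<Rightarrow> 'i \<Rightarrow> ('i \<Rightarrow> 'a) \<Rightarrow> real" where
  "d i j Z = a i (Z i) + a j (Z j) - a i (Z j) - a j (Z i)"

text \<open>For (i, j) uniform on I x I the swap forms an exchangeable pair with regression
  coefficient 2/NN (see \<open>sum_d\<close>). \<open>Delta\<close> is the conditional mean of the
  squared change of \<open>X\<close>, divided by twice this coefficient, as in Stein's
  method.\<close>

definition Delta :: "('i \<Rightarrow> 'a) \<Rightarrow> real" where
  "Delta Z = (\<Sum>i\<in>I. \<Sum>j\<in>I. (d i j Z)\<^sup>2) / (4 * NN)"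

lemma Om_T: "Z \<in> Om \<Longrightarrow> i \<in> I \<Longrightarrow> Z i \<in> T"
  by (auto simp: assigns_def PiE_iff)

lemma X_swp:
  assumes "i \<in> I" "j \<in> I"
  shows "X Z - X (swp i j Z) = d i j Z"
proof (cases "i = j")
  case True
  then show ?thesis by (simp add: d_def)
next
  case False
  have "X Z - X (swp i j Z) = (\<Sum>k\<in>I. a k (Z k) - a k (swp i j Z k))"
    by (simp add: X_def sum_subtractf)
  also have "\<dots> = (\<Sum>k\<in>{i,j}. a k (Z k) - a k (swp i j Z k))"
    using assms finite_I by (intro sum.mono_neutral_right) (auto simp: swp_def)
  also have "\<dots> = d i j Z" using False by (simp add: d_def swp_def)
  finally show ?thesis .
qed

lemma d_swp: "d i j (swp i j Z) = - d i j Z"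
  by (auto simp: d_def swp_def)

lemma abs_d_le:
  assumes "Z \<in> Om" "i \<in> I" "j \<in> I"
  shows "\<bar>d i j Z\<bar> \<le> 4 * B"
  unfolding d_def
  using bounded[OF assms(2) Om_T[OF assms(1,2)]] bounded[OF assms(3) Om_T[OF assms(1,3)]]
    bounded[OF assms(2) Om_T[OF assms(1,3)]] bounded[OF assms(3) Om_T[OF assms(1,2)]]
  by linarith

lemma d_squared_le:
  assumes "Z \<in> Om" "i \<in> I" "j \<in> I"
  shows "(d i j Z)\<^sup>2 \<le> 16 * B\<^sup>2"
  using power_mono[OF abs_d_le[OF assms], of 2] by (simp add: power_mult_distrib)

lemma sum_d:
  assumes "Z \<in> Om"
  shows "(\<Sum>i\<in>I. \<Sum>j\<in>I. d i j Z) = 2 * NN * X Z"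
proof -
  have "(\<Sum>i\<in>I. \<Sum>j\<in>I. a i (Z j)) = (\<Sum>i\<in>I. \<Sum>z\<in>T. n z * a i z)"
    using sum_over_units[OF assms, of "a _"] by simp
  also have "\<dots> = (\<Sum>z\<in>T. n z * (\<Sum>i\<in>I. a i z))"
    by (subst sum.swap) (simp add: sum_distrib_left)
  also have "\<dots> = 0" using centred by simp
  finally have zero: "(\<Sum>i\<in>I. \<Sum>j\<in>I. a i (Z j)) = 0" .
  then have zero': "(\<Sum>i\<in>I. \<Sum>j\<in>I. a j (Z i)) = 0" by (subst sum.swap)
  show ?thesis
    unfolding d_def sum_subtractf sum.distrib zero zero' by (simp add: X_def sum_distrib_left mult.assoc)
qed

text \<open>Only column centring is needed: summed over all pairs, the terms \<open>a i (Z j)\<close> cancel.\<close>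

lemma exchangeable_pair_identity:
  fixes h :: "('i \<Rightarrow> 'a) \<Rightarrow> 'b::real_normed_field"
  shows "avg Om (\<lambda>Z. of_real (X Z) * h Z) =
    (\<Sum>i\<in>I. \<Sum>j\<in>I. avg Om (\<lambda>Z. of_real (d i j Z) * (h Z - h (swp i j Z)))) / of_real (4 * NN)"
proof -
  have half: "(\<Sum>i\<in>I. \<Sum>j\<in>I. avg Om (\<lambda>Z. of_real (d i j Z) * h Z)) = of_real (2 * NN) * avg Om (\<lambda>Z. of_real (X Z) * h Z)"
  proof -
    have "(\<Sum>i\<in>I. \<Sum>j\<in>I. avg Om (\<lambda>Z. of_real (d i j Z) * h Z)) =
        avg Om (\<lambda>Z. of_real (\<Sum>i\<in>I. \<Sum>j\<in>I. d i j Z) * h Z)"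
      by (simp add: avg_sum[symmetric] sum_distrib_right)
    also have "\<dots> = avg Om (\<lambda>Z. of_real (2 * NN) * (of_real (X Z) * h Z))"
      by (rule avg_cong) (simp add: sum_d)
    finally show ?thesis unfolding avg_cmult .
  qed
  \<comment> \<open>The increment changes sign under its own swap, so the swapped term doubles the
    direct one; hence 4 NN where \<open>sum_d\<close> has 2 NN.\<close>
  have "avg Om (\<lambda>Z. of_real (d i j Z) * h (swp i j Z)) = - avg Om (\<lambda>Z. of_real (d i j Z) * h Z)"
    if "i \<in> I" "j \<in> I" for i j
  proof -
    have "avg Om (\<lambda>Z. of_real (d i j Z) * h (swp i j Z)) = avg Om (\<lambda>Z. -1 * (of_real (d i j Z) * h Z))"
      using avg_swp[OF that, of "\<lambda>Z. of_real (d i j Z) * h (swp i j Z)"] by (simp add: d_swp)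
    then show ?thesis unfolding avg_cmult by simp
  qed
  then have "(\<Sum>i\<in>I. \<Sum>j\<in>I. avg Om (\<lambda>Z. of_real (d i j Z) * (h Z - h (swp i j Z)))) =
      (\<Sum>i\<in>I. \<Sum>j\<in>I. 2 * avg Om (\<lambda>Z. of_real (d i j Z) * h Z))"
    by (intro sum.cong refl) (simp add: right_diff_distrib avg_diff)
  also have "\<dots> = of_real (4 * NN) * avg Om (\<lambda>Z. of_real (X Z) * h Z)"
    unfolding sum_distrib_left[symmetric] half by simp
  finally show ?thesis using NN_pos by simp
qed

lemma avg_X: "avg Om X = 0"
  using exchangeable_pair_identity[of "\<lambda>_. 1::real"] by simp

text \<open>The exchangeable-pair identity at h = \<open>X\<close>. It makes the variance of
  \<open>X\<close> the value around which \<open>Delta\<close> concentrates.\<close>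

lemma avg_Delta: "avg Om Delta = avg Om (\<lambda>Z. (X Z)\<^sup>2)"
proof -
  have "avg Om (\<lambda>Z. (X Z)\<^sup>2) = (\<Sum>i\<in>I. \<Sum>j\<in>I. avg Om (\<lambda>Z. d i j Z * (X Z - X (swp i j Z)))) / (4 * NN)"
    using exchangeable_pair_identity[of X] by (simp add: power2_eq_square)
  also have "\<dots> = (\<Sum>i\<in>I. \<Sum>j\<in>I. avg Om (\<lambda>Z. (d i j Z)\<^sup>2)) / (4 * NN)"
    by (simp add: X_swp power2_eq_square)
  also have "\<dots> = avg Om (\<lambda>Z. (\<Sum>i\<in>I. \<Sum>j\<in>I. (d i j Z)\<^sup>2) / (4 * NN))"
    by (simp only: divide_inverse avg_cmult_right avg_sum)
  finally show ?thesis by (simp add: Delta_def[abs_def])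
qed

lemma Delta_le:
  assumes "Z \<in> Om"
  shows "Delta Z \<le> 4 * NN * B\<^sup>2"
proof -
  have "(\<Sum>i\<in>I. \<Sum>j\<in>I. (d i j Z)\<^sup>2) \<le> (\<Sum>i\<in>I. \<Sum>j\<in>I. 16 * B\<^sup>2)"
    by (intro sum_mono d_squared_le assms)
  also have "\<dots> = (4 * NN * B\<^sup>2) * (4 * NN)" by (simp add: power2_eq_square)
  finally show ?thesis unfolding Delta_def using NN_pos by (simp add: pos_divide_le_eq)
qed

lemma abs_X_le:
  assumes "Z \<in> Om"
  shows "\<bar>X Z\<bar> \<le> NN * B"
proof -
  have "\<bar>X Z\<bar> \<le> (\<Sum>i\<in>I. B)" unfolding X_def
    by (intro order_trans[OF sum_abs] sum_mono bounded) (use Om_T[OF assms] in auto)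
  then show ?thesis by simp
qed

text \<open>Exchanging k and l affects only pairs that meet {k, l}, at most 4 NN ordered pairs; each
  squared increment moves by at most 16 B^2, and the normalisation 4 NN cancels their
  number.\<close>

lemma Delta_swp:
  assumes Z: "Z \<in> Om" and k: "k \<in> I" and l: "l \<in> I"
  shows "\<bar>Delta Z - Delta (swp k l Z)\<bar> \<le> 16 * B\<^sup>2"
proof -
  let ?Z = "swp k l Z"
  have Z': "?Z \<in> Om" by (rule swp_assigns[OF Z k l])
  have b: "\<bar>(d i j Z)\<^sup>2 - (d i j ?Z)\<^sup>2\<bar> \<le> 16 * B\<^sup>2 * (of_bool (i \<in> {k,l}) + of_bool (j \<in> {k,l}))"
    if ij: "i \<in> I" "j \<in> I" for i j
  proof (cases "i \<in> {k,l} \<or> j \<in> {k,l}")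
    case True
    have "\<bar>(d i j Z)\<^sup>2 - (d i j ?Z)\<^sup>2\<bar> \<le> 16 * B\<^sup>2 * 1"
      using d_squared_le[OF Z ij] d_squared_le[OF Z' ij] zero_le_power2[of "d i j Z"] zero_le_power2[of "d i j ?Z"]
      by linarith
    also have "\<dots> \<le> 16 * B\<^sup>2 * (of_bool (i \<in> {k,l}) + of_bool (j \<in> {k,l}))"
      using True by (intro mult_left_mono) auto
    finally show ?thesis .
  next
    case False
    then have "d i j ?Z = d i j Z" by (auto simp: d_def swp_def)
    then show ?thesis by simp
  qed
  have c: "(\<Sum>i\<in>I. of_bool (i \<in> {k,l}) :: real) \<le> 2"
  proof -
    have "(\<Sum>i\<in>I. of_bool (i \<in> {k,l}) :: real) \<le> (\<Sum>i\<in>I. of_bool (i = k) + of_bool (i = l))"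
      by (intro sum_mono) auto
    also have "\<dots> = 2" using finite_I k l by (simp add: sum.distrib of_bool_def)
    finally show ?thesis .
  qed
  have "\<bar>(\<Sum>i\<in>I. \<Sum>j\<in>I. (d i j Z)\<^sup>2) - (\<Sum>i\<in>I. \<Sum>j\<in>I. (d i j ?Z)\<^sup>2)\<bar> = \<bar>\<Sum>i\<in>I. \<Sum>j\<in>I. (d i j Z)\<^sup>2 - (d i j ?Z)\<^sup>2\<bar>"
    by (simp add: sum_subtractf)
  also have "\<dots> \<le> (\<Sum>i\<in>I. \<Sum>j\<in>I. 16 * B\<^sup>2 * (of_bool (i \<in> {k,l}) + of_bool (j \<in> {k,l})))"
    by (intro order_trans[OF sum_abs] sum_mono b)
  also have "\<dots> = 16 * B\<^sup>2 * (NN * (\<Sum>i\<in>I. of_bool (i \<in> {k,l})) + NN * (\<Sum>i\<in>I. of_bool (i \<in> {k,l})))"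
    by (simp add: sum_distrib_left[symmetric] sum.distrib)
  also have "\<dots> \<le> 16 * B\<^sup>2 * (NN * 2 + NN * 2)"
    using c by (intro mult_left_mono add_mono) auto
  finally have "\<bar>(\<Sum>i\<in>I. \<Sum>j\<in>I. (d i j Z)\<^sup>2) - (\<Sum>i\<in>I. \<Sum>j\<in>I. (d i j ?Z)\<^sup>2)\<bar> \<le> 16 * B\<^sup>2 * (4 * NN)"
    by simp
  then show ?thesis
    unfolding Delta_def diff_divide_distrib[symmetric] abs_divide using NN_pos by (simp add: pos_divide_le_eq)
qed

text \<open>\<open>avg_unit\<close> gives the diagonal and \<open>avg_pair\<close> the rest. Column
  centring collapses the sum over j \<noteq> i to minus its missing term, leaving only squares of
  the row sums r i.\<close>

lemma avg_X_squared:
  assumes "NN > 1"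
  shows "avg Om (\<lambda>Z. (X Z)\<^sup>2) =
    (\<Sum>i\<in>I. (\<Sum>z\<in>T. n z * (a i z)\<^sup>2) - (\<Sum>z\<in>T. n z * a i z)\<^sup>2 / NN) / (NN - 1)"
proof -
  define r where "r i = (\<Sum>z\<in>T. n z * a i z)" for i
  define q where "q = (\<Sum>i\<in>I. \<Sum>z\<in>T. n z * (a i z)\<^sup>2)"
  have r0: "(\<Sum>i\<in>I. r i) = 0"
    unfolding r_def by (subst sum.swap) (simp add: sum_distrib_left[symmetric] centred)
  have off: "(\<Sum>j\<in>I - {i}. G j) = - G i" if "i \<in> I" "(\<Sum>j\<in>I. G j) = 0" for i and G :: "'i \<Rightarrow> real"
    using that finite_I by (simp add: sum_diff1)
  have pair: "avg Om (\<lambda>Z. a i (Z i) * a j (Z j)) = (r i * r j - (\<Sum>z\<in>T. n z * (a i z * a j z))) / (NN * (NN - 1))"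
    if "i \<in> I" "j \<in> I" "i \<noteq> j" for i j
  proof -
    have "(\<Sum>z\<in>T. \<Sum>w\<in>T. n z * n w * (a i z * a j w)) = r i * r j"
      unfolding r_def sum_product by (simp add: mult_ac)
    then show ?thesis using avg_pair[OF that, of "\<lambda>z w. a i z * a j w"] by simp
  qed
  have "(X Z)\<^sup>2 = (\<Sum>i\<in>I. (a i (Z i))\<^sup>2 + (\<Sum>j\<in>I - {i}. a i (Z i) * a j (Z j)))" for Z
    unfolding X_def power2_eq_square sum_product
    by (intro sum.cong refl sum.remove finite_I)
  then have "avg Om (\<lambda>Z. (X Z)\<^sup>2) =
      (\<Sum>i\<in>I. avg Om (\<lambda>Z. (a i (Z i))\<^sup>2) + (\<Sum>j\<in>I - {i}. avg Om (\<lambda>Z. a i (Z i) * a j (Z j))))"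
    by (simp only: avg_sum avg_add)
  also have "\<dots> = (\<Sum>i\<in>I. (\<Sum>z\<in>T. n z * (a i z)\<^sup>2) / NN +
      (- (r i)\<^sup>2 + (\<Sum>z\<in>T. n z * (a i z)\<^sup>2)) / (NN * (NN - 1)))"
  proof (intro sum.cong refl arg_cong2[where f = "(+)"])
    fix i assume i: "i \<in> I"
    show "avg Om (\<lambda>Z. (a i (Z i))\<^sup>2) = (\<Sum>z\<in>T. n z * (a i z)\<^sup>2) / NN"
      using avg_unit[OF i, of "\<lambda>z. (a i z)\<^sup>2"] .
    have "(\<Sum>j\<in>I - {i}. avg Om (\<lambda>Z. a i (Z i) * a j (Z j))) =
        (\<Sum>j\<in>I - {i}. (r i * r j - (\<Sum>z\<in>T. n z * (a i z * a j z)))) / (NN * (NN - 1))"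
      unfolding sum_divide_distrib by (intro sum.cong refl pair) (use i in auto)
    also have "(\<Sum>j\<in>I - {i}. (r i * r j - (\<Sum>z\<in>T. n z * (a i z * a j z)))) =
        - (r i * r i - (\<Sum>z\<in>T. n z * (a i z * a i z)))"
    proof (rule off[OF i])
      have "(\<Sum>j\<in>I. \<Sum>z\<in>T. n z * (a i z * a j z)) = (\<Sum>z\<in>T. n z * a i z * (\<Sum>j\<in>I. a j z))"
        by (subst sum.swap) (simp add: sum_distrib_left mult_ac)
      also have "\<dots> = 0" by (simp add: centred)
      finally show "(\<Sum>j\<in>I. r i * r j - (\<Sum>z\<in>T. n z * (a i z * a j z))) = 0"
        by (simp add: sum_subtractf sum_distrib_left[symmetric] r0)
    qed
    finally show "(\<Sum>j\<in>I - {i}. avg Om (\<lambda>Z. a i (Z i) * a j (Z j))) =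
        (- (r i)\<^sup>2 + (\<Sum>z\<in>T. n z * (a i z)\<^sup>2)) / (NN * (NN - 1))"
      by (simp add: power2_eq_square)
  qed
  also have "\<dots> = (\<Sum>i\<in>I. ((\<Sum>z\<in>T. n z * (a i z)\<^sup>2) - (r i)\<^sup>2 / NN) / (NN - 1))"
  proof (intro sum.cong refl)
    fix i
    have "s / NN + (- t + s) / (NN * (NN - 1)) = (s - t / NN) / (NN - 1)" for s t
      using assms by (simp add: field_simps)
    then show "(\<Sum>z\<in>T. n z * (a i z)\<^sup>2) / NN + (- (r i)\<^sup>2 + (\<Sum>z\<in>T. n z * (a i z)\<^sup>2)) / (NN * (NN - 1)) =
       ((\<Sum>z\<in>T. n z * (a i z)\<^sup>2) - (r i)\<^sup>2 / NN) / (NN - 1)" .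
  qed
  finally show ?thesis by (simp add: r_def sum_divide_distrib)
qed

lemma avg_Delta_mult:
  fixes g :: "('i \<Rightarrow> 'a) \<Rightarrow> 'b::real_normed_field"
  shows "avg Om (\<lambda>Z. of_real (Delta Z) * g Z) =
    (\<Sum>i\<in>I. \<Sum>j\<in>I. avg Om (\<lambda>Z. of_real ((d i j Z)\<^sup>2) * g Z)) / of_real (4 * NN)"
proof -
  have "of_real (Delta Z) * g Z = (\<Sum>i\<in>I. \<Sum>j\<in>I. of_real ((d i j Z)\<^sup>2) * g Z) / of_real (4 * NN)" for Z
    by (simp add: Delta_def sum_distrib_right)
  then show ?thesis by (simp only: avg_divide avg_sum)
qed

text \<open>With m the moment generating function, the pair identity yields m' \<le> s
  E[Delta exp(sX)]. Where \<open>Delta\<close> < 1 + \<eta> this is at most (1 + \<eta>) s m.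
  Elsewhere the crude bounds \<open>Delta_le\<close> and \<open>abs_X_le\<close> are weighed against
  the McDiarmid tail of \<open>Delta\<close>; \<open>small\<close> says their product is at most
  \<eta>, hence at most \<eta> m because m \<ge> 1.\<close>

lemma mgf_le:
  assumes var: "avg Om (\<lambda>Z. (X Z)\<^sup>2) \<le> 1" and \<eta>: "0 < \<eta>" and \<theta>: "0 \<le> \<theta>"
    and small: "4 * NN * B\<^sup>2 * exp (\<theta> * (NN * B) - \<eta>\<^sup>2 / (4 * NN * (16 * B\<^sup>2)\<^sup>2)) \<le> \<eta>"
  shows "avg Om (\<lambda>Z. exp (\<theta> * X Z)) \<le> exp ((1 + 2 * \<eta>) * \<theta>\<^sup>2 / 2)"
proof -
  define m where "m s = avg Om (\<lambda>Z. exp (s * X Z))" for s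
  define m' where "m' s = avg Om (\<lambda>Z. X Z * exp (s * X Z))" for s
  have dm: "(m has_real_derivative m' s) (at s)" for s
    unfolding m_def[abs_def] m'_def
    by (rule DERIV_avg) (auto intro!: derivative_eq_intros)
  have m1: "1 \<le> m s" for s
  proof -
    have "avg Om (\<lambda>Z. 1 + s * X Z) \<le> m s"
      unfolding m_def by (intro avg_mono exp_ge_add_one_self)
    then show ?thesis unfolding avg_add avg_cmult avg_X by simp
  qed
  have DE: "avg Om (\<lambda>Z. Delta Z * exp (s * X Z)) \<le> (1 + 2 * \<eta>) * m s" if s: "0 \<le> s" "s \<le> \<theta>" for s
  proof -
    have tail: "prob (\<lambda>Z. Delta Z \<ge> 1 + \<eta>) \<le> exp (- (\<eta>\<^sup>2 / (4 * NN * (16 * B\<^sup>2)\<^sup>2)))"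
    proof (rule order_trans[OF prob_mono bounded_differences_tail_upper])
      show "\<eta> \<le> Delta Z - avg Om Delta" if "Delta Z \<ge> 1 + \<eta>" for Z
        using that var unfolding avg_Delta by linarith
    qed (use Delta_swp B_pos \<eta> in auto)
    have "avg Om (\<lambda>Z. Delta Z * exp (s * X Z)) \<le>
       avg Om (\<lambda>Z. (1 + \<eta>) * exp (s * X Z) + (4 * NN * B\<^sup>2 * exp (\<theta> * (NN * B))) * of_bool (Delta Z \<ge> 1 + \<eta>))"
    proof (rule avg_mono)
      fix Z assume Z: "Z \<in> Om"
      show "Delta Z * exp (s * X Z) \<le>
          (1 + \<eta>) * exp (s * X Z) + (4 * NN * B\<^sup>2 * exp (\<theta> * (NN * B))) * of_bool (Delta Z \<ge> 1 + \<eta>)"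
      proof (cases "Delta Z \<ge> 1 + \<eta>")
        case True
        have "s * X Z \<le> \<bar>s * X Z\<bar>" by simp
        also have "\<dots> \<le> \<theta> * (NN * B)" unfolding abs_mult using s abs_X_le[OF Z] by (intro mult_mono) auto
        finally have "Delta Z * exp (s * X Z) \<le> 4 * NN * B\<^sup>2 * exp (\<theta> * (NN * B))"
          using Delta_le[OF Z] by (intro mult_mono) auto
        moreover have "0 \<le> (1 + \<eta>) * exp (s * X Z)" using \<eta> by simp
        ultimately show ?thesis using True by simp
      next
        case False
        then have "Delta Z * exp (s * X Z) \<le> (1 + \<eta>) * exp (s * X Z)" by (intro mult_right_mono) auto
        then show ?thesis using False by simp
      qed
    qed
    also have "\<dots> = (1 + \<eta>) * m s + 4 * NN * B\<^sup>2 * exp (\<theta> * (NN * B)) * prob (\<lambda>Z. Delta Z \<ge> 1 + \<eta>)"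
      unfolding avg_add avg_cmult m_def prob_def ..
    also have "\<dots> \<le> (1 + \<eta>) * m s +
        4 * NN * B\<^sup>2 * exp (\<theta> * (NN * B)) * exp (- (\<eta>\<^sup>2 / (4 * NN * (16 * B\<^sup>2)\<^sup>2)))"
      using NN_pos by (intro add_left_mono mult_left_mono tail) auto
    also have "\<dots> \<le> (1 + \<eta>) * m s + \<eta>"
      using small by (simp only: diff_conv_add_uminus exp_add mult.assoc add_left_mono)
    also have "\<dots> \<le> (1 + 2 * \<eta>) * m s"
      using mult_left_mono[OF m1[of s], of \<eta>] \<eta> by (simp add: algebra_simps)
    finally show ?thesis .
  qed
  have m'_le: "m' s \<le> s * ((1 + 2 * \<eta>) * m s)" if s: "0 \<le> s" "s \<le> \<theta>" for s
  proof -
    have "m' s = avg Om (\<lambda>Z. of_real (X Z) * exp (s * X Z))"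
      by (simp add: m'_def)
    also have "\<dots> = (\<Sum>i\<in>I. \<Sum>j\<in>I. avg Om (\<lambda>Z. d i j Z * (exp (s * X Z) - exp (s * X (swp i j Z))))) / (4 * NN)"
      unfolding exchangeable_pair_identity by simp
    also have "\<dots> \<le> (\<Sum>i\<in>I. \<Sum>j\<in>I. s * avg Om (\<lambda>Z. (d i j Z)\<^sup>2 * exp (s * X Z))) / (4 * NN)"
    proof (intro divide_right_mono sum_mono)
      fix i j assume ij: "i \<in> I" "j \<in> I"
      \<comment> \<open>\<open>exp_diff_mult_le\<close> bounds the integrand by a sum symmetric in Z
        and its swap; swap invariance then makes the two halves equal on average.\<close>
      have "avg Om (\<lambda>Z. d i j Z * (exp (s * X Z) - exp (s * X (swp i j Z)))) \<le>
          avg Om (\<lambda>Z. s / 2 * ((d i j Z)\<^sup>2 * exp (s * X Z) + (d i j (swp i j Z))\<^sup>2 * exp (s * X (swp i j Z))))"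
      proof (rule avg_mono)
        fix Z
        let ?x = "s * X Z" and ?y = "s * X (swp i j Z)"
        have xy: "?x - ?y = s * d i j Z" using X_swp[OF ij, of Z] by (simp add: right_diff_distrib[symmetric])
        show "d i j Z * (exp ?x - exp ?y) \<le> s / 2 * ((d i j Z)\<^sup>2 * exp ?x + (d i j (swp i j Z))\<^sup>2 * exp ?y)"
        proof (cases "s = 0")
          case False
          then have sp: "s > 0" using s by simp
          have "s * (d i j Z * (exp ?x - exp ?y)) \<le> (s * d i j Z)\<^sup>2 * ((exp ?x + exp ?y) / 2)"
            using exp_diff_mult_le[of ?x ?y] unfolding xy by (simp add: mult.assoc)
          also have "\<dots> = s * (s / 2 * ((d i j Z)\<^sup>2 * exp ?x + (d i j (swp i j Z))\<^sup>2 * exp ?y))"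
            unfolding d_swp by (simp add: power2_eq_square field_simps)
          finally show ?thesis using sp by (rule mult_left_le_imp_le)
        qed simp
      qed
      also have "\<dots> = s * avg Om (\<lambda>Z. (d i j Z)\<^sup>2 * exp (s * X Z))"
        unfolding avg_cmult avg_add avg_swp[OF ij, of "\<lambda>Z. (d i j Z)\<^sup>2 * exp (s * X Z)"] by simp
      finally show "avg Om (\<lambda>Z. d i j Z * (exp (s * X Z) - exp (s * X (swp i j Z)))) \<le>
          s * avg Om (\<lambda>Z. (d i j Z)\<^sup>2 * exp (s * X Z))" .
    qed (use NN_pos in auto)
    also have "\<dots> = s * avg Om (\<lambda>Z. Delta Z * exp (s * X Z))"
      using avg_Delta_mult[of "\<lambda>Z. exp (s * X Z)"] by (simp add: sum_distrib_left)
    also have "\<dots> \<le> s * ((1 + 2 * \<eta>) * m s)" using s by (intro mult_left_mono DE) auto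
    finally show ?thesis .
  qed
  \<comment> \<open>Gronwall's argument: dividing m by the Gaussian comparison function leaves a
    nonincreasing function that starts at 1.\<close>
  define g where "g s = m s * exp (- ((1 + 2 * \<eta>) * s\<^sup>2 / 2))" for s
  have "g \<theta> \<le> g 0"
  proof (rule DERIV_nonpos_imp_nonincreasing[OF \<theta>])
    fix s assume s: "0 \<le> s" "s \<le> \<theta>"
    have "(g has_real_derivative (m' s - s * ((1 + 2 * \<eta>) * m s)) * exp (- ((1 + 2 * \<eta>) * s\<^sup>2 / 2))) (at s)"
      unfolding g_def[abs_def] using dm[of s]
      by (auto intro!: derivative_eq_intros simp: algebra_simps)
    moreover have "(m' s - s * ((1 + 2 * \<eta>) * m s)) * exp (- ((1 + 2 * \<eta>) * s\<^sup>2 / 2)) \<le> 0"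
      using m'_le[OF s] by (intro mult_nonpos_nonneg) auto
    ultimately show "\<exists>y. (g has_real_derivative y) (at s) \<and> y \<le> 0" by blast
  qed
  moreover have "g 0 = 1" by (simp add: g_def m_def)
  ultimately have "m \<theta> * exp (- ((1 + 2 * \<eta>) * \<theta>\<^sup>2 / 2)) \<le> 1" by (simp add: g_def)
  then show ?thesis unfolding m_def by (simp add: exp_minus field_simps)
qed

lemma tail_le:
  assumes var: "avg Om (\<lambda>Z. (X Z)\<^sup>2) \<le> 1" and \<eta>: "0 < \<eta>" and \<theta>: "0 \<le> \<theta>"
    and small: "4 * NN * B\<^sup>2 * exp (\<theta> * (NN * B) - \<eta>\<^sup>2 / (4 * NN * (16 * B\<^sup>2)\<^sup>2)) \<le> \<eta>"
  shows "prob (\<lambda>Z. X Z \<ge> t) \<le> exp ((1 + 2 * \<eta>) * \<theta>\<^sup>2 / 2 - \<theta> * t)"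
proof -
  have "prob (\<lambda>Z. X Z \<ge> t) \<le> avg Om (\<lambda>Z. exp (- (\<theta> * t)) * exp (\<theta> * X Z))"
    unfolding prob_def
  proof (rule avg_mono)
    fix Z
    show "of_bool (X Z \<ge> t) \<le> exp (- (\<theta> * t)) * exp (\<theta> * X Z)"
      using \<theta> by (auto simp: exp_add[symmetric] mult_left_mono)
  qed
  also have "\<dots> \<le> exp (- (\<theta> * t)) * exp ((1 + 2 * \<eta>) * \<theta>\<^sup>2 / 2)"
    unfolding avg_cmult by (intro mult_left_mono mgf_le assms) auto
  finally show ?thesis by (simp add: exp_add[symmetric] add.commute)
qed

text \<open>A Gaussian characteristic function solves \<phi>' = - s \<phi>, and the pair identity
  shows that \<phi> does so approximately. The error has two sources: \<open>Delta\<close> is not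
  exactly 1, where 96 = 6 * 16 combines \<open>bounded_differences_mean_abs\<close> with
  \<open>Delta_swp\<close>; and the expansion in one swap, where |d|^3 s^2 / 2 with |d| \<le> 4B
  gives 2 B s^2 after averaging.\<close>

lemma characteristic_function_bound:
  assumes var: "avg Om (\<lambda>Z. (X Z)\<^sup>2) = 1"
  shows "norm (avg Om (\<lambda>Z. iexp (t * X Z)) - of_real (exp (- (t\<^sup>2 / 2)))) \<le>
    \<bar>t\<bar> * (\<bar>t\<bar> * (96 * sqrt NN * B\<^sup>2) + 2 * B * t\<^sup>2)"
proof -
  define \<phi> where "\<phi> s = avg Om (\<lambda>Z. iexp (s * X Z))" for s
  define \<phi>' where "\<phi>' s = \<i> * avg Om (\<lambda>Z. of_real (X Z) * iexp (s * X Z))" for s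
  have d\<phi>: "(\<phi> has_vector_derivative \<phi>' s) (at s)" for s
  proof -
    have "(\<phi> has_vector_derivative avg Om (\<lambda>Z. \<i> * (of_real (X Z) * iexp (s * X Z)))) (at s)"
      unfolding \<phi>_def[abs_def]
    proof (rule has_vector_derivative_avg)
      fix Z
      have "((\<lambda>w. exp (\<i> * (w * of_real (X Z)))) has_field_derivative \<i> * (of_real (X Z) * exp (\<i> * (of_real s * of_real (X Z))))) (at (of_real s))"
        by (auto intro!: derivative_eq_intros)
      from has_vector_derivative_real_field[OF this]
      show "((\<lambda>s. iexp (s * X Z)) has_vector_derivative \<i> * (of_real (X Z) * iexp (s * X Z))) (at s)"
        by simp
    qed
    then show ?thesis unfolding avg_cmult \<phi>'_def .
  qed
  have c1: "avg Om (\<lambda>Z. \<bar>Delta Z - 1\<bar>) \<le> 96 * sqrt NN * B\<^sup>2"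
    using bounded_differences_mean_abs[of Delta "16 * B\<^sup>2"] Delta_swp B_pos avg_Delta var by simp
  have main: "norm (\<phi>' s + of_real s * \<phi> s) \<le> \<bar>s\<bar> * (96 * sqrt NN * B\<^sup>2) + 2 * B * s\<^sup>2" for s
  proof -
    let ?h = "\<lambda>Z. iexp (s * X Z)"
    \<comment> \<open>First-order expansion in the swap increment x, with the phase
      \<open>iexp y\<close> factored out; the remainder is (s x)^2 / 2.\<close>
    have e: "norm (\<i> * (of_real x * (iexp y - iexp (y - s * x))) + of_real (s * x\<^sup>2) * iexp y) \<le> \<bar>x\<bar> * x\<^sup>2 * (s\<^sup>2 / 2)"
      for x y
    proof -
      have "\<i> * (of_real x * (iexp y - iexp (y - s * x))) + of_real (s * x\<^sup>2) * iexp y =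
         - (\<i> * of_real x * iexp y) * (iexp (- (s * x)) - (1 + \<i> * of_real (- (s * x))))"
        by (simp add: exp_diff exp_minus divide_inverse right_diff_distrib algebra_simps power2_eq_square)
      moreover have "norm (iexp (- (s * x)) - (1 + \<i> * of_real (- (s * x)))) \<le> (s * x)\<^sup>2 / 2"
        using iexp_approx1[of "- (s * x)" 1] by (simp add: power2_eq_square)
      ultimately show ?thesis
        using mult_left_mono[of "norm (iexp (- (s * x)) - (1 + \<i> * of_real (- (s * x))))" "(s * x)\<^sup>2 / 2" "\<bar>x\<bar>"]
        by (simp add: norm_mult power_mult_distrib mult_ac)
    qed
    have "\<phi>' s = (\<Sum>i\<in>I. \<Sum>j\<in>I. avg Om (\<lambda>Z. \<i> * (of_real (d i j Z) * (?h Z - ?h (swp i j Z))))) / of_real (4 * NN)"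
      unfolding \<phi>'_def exchangeable_pair_identity avg_cmult sum_distrib_left[symmetric] by simp
    moreover have "avg Om (\<lambda>Z. of_real (s * Delta Z) * ?h Z) =
        (\<Sum>i\<in>I. \<Sum>j\<in>I. avg Om (\<lambda>Z. of_real (s * (d i j Z)\<^sup>2) * ?h Z)) / of_real (4 * NN)"
      using avg_Delta_mult[of "\<lambda>Z. of_real s * ?h Z"] by (simp only: of_real_mult mult_ac)
    ultimately have "\<phi>' s + avg Om (\<lambda>Z. of_real (s * Delta Z) * ?h Z) =
       (\<Sum>i\<in>I. \<Sum>j\<in>I. avg Om (\<lambda>Z. \<i> * (of_real (d i j Z) * (?h Z - ?h (swp i j Z))) + of_real (s * (d i j Z)\<^sup>2) * ?h Z)) / of_real (4 * NN)"
      by (simp only: avg_add sum.distrib add_divide_distrib)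
    also have "norm \<dots> \<le> (\<Sum>i\<in>I. \<Sum>j\<in>I. avg Om (\<lambda>Z. (d i j Z)\<^sup>2 * (2 * B * s\<^sup>2))) / (4 * NN)"
      unfolding norm_divide norm_of_real abs_of_pos[OF mult_pos_pos[OF zero_less_numeral NN_pos]]
    proof (intro divide_right_mono order_trans[OF norm_sum] sum_mono order_trans[OF norm_avg_le] avg_mono)
      fix i j Z assume ij: "i \<in> I" "j \<in> I" and Z: "Z \<in> Om"
      have "s * X (swp i j Z) = s * X Z - s * d i j Z"
        using X_swp[OF ij, of Z] by (simp add: right_diff_distrib[symmetric])
      then have "norm (\<i> * (of_real (d i j Z) * (?h Z - ?h (swp i j Z))) + of_real (s * (d i j Z)\<^sup>2) * ?h Z) \<le>
          \<bar>d i j Z\<bar> * (d i j Z)\<^sup>2 * (s\<^sup>2 / 2)"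
        using e[of "d i j Z" "s * X Z"] by simp
      also have "\<dots> \<le> (4 * B) * (d i j Z)\<^sup>2 * (s\<^sup>2 / 2)"
        using abs_d_le[OF Z ij] by (intro mult_right_mono) auto
      finally show "norm (\<i> * (of_real (d i j Z) * (?h Z - ?h (swp i j Z))) + of_real (s * (d i j Z)\<^sup>2) * ?h Z) \<le>
          (d i j Z)\<^sup>2 * (2 * B * s\<^sup>2)" by (simp add: mult_ac)
    qed (use NN_pos in auto)
    also have "\<dots> = 2 * B * s\<^sup>2 * avg Om Delta"
      using avg_Delta_mult[of "\<lambda>Z. 1 :: real"] unfolding avg_cmult_right sum_distrib_right[symmetric] by simp
    also have "avg Om Delta = 1" using avg_Delta var by simp
    finally have 1: "norm (\<phi>' s + avg Om (\<lambda>Z. of_real (s * Delta Z) * ?h Z)) \<le> 2 * B * s\<^sup>2" by simp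
    \<comment> \<open>Replacing \<open>Delta\<close> by its mean 1 costs |s| times its mean absolute
      deviation.\<close>
    have "of_real s * \<phi> s - avg Om (\<lambda>Z. of_real (s * Delta Z) * ?h Z) =
        avg Om (\<lambda>Z. of_real s * ?h Z - of_real (s * Delta Z) * ?h Z)"
      by (simp only: \<phi>_def avg_diff avg_cmult)
    also have "norm \<dots> \<le> avg Om (\<lambda>Z. \<bar>s\<bar> * \<bar>Delta Z - 1\<bar>)"
    proof (intro order_trans[OF norm_avg_le] avg_mono)
      fix Z
      have "of_real s * ?h Z - of_real (s * Delta Z) * ?h Z = of_real (s * (1 - Delta Z)) * ?h Z"
        by (simp add: algebra_simps)
      then show "norm (of_real s * ?h Z - of_real (s * Delta Z) * ?h Z) \<le> \<bar>s\<bar> * \<bar>Delta Z - 1\<bar>"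
        by (simp only: norm_mult norm_of_real norm_exp_i_times abs_mult abs_minus_commute)
    qed
    also have "\<dots> \<le> \<bar>s\<bar> * (96 * sqrt NN * B\<^sup>2)"
      unfolding avg_cmult by (intro mult_left_mono c1) auto
    finally have 2: "norm (of_real s * \<phi> s - avg Om (\<lambda>Z. of_real (s * Delta Z) * ?h Z)) \<le> \<bar>s\<bar> * (96 * sqrt NN * B\<^sup>2)" .
    show ?thesis
      using norm_triangle_mono[OF 2 1] by (simp add: algebra_simps)
  qed
  \<comment> \<open>Integrating factor: the derivative of \<psi> contains only the error \<phi>' + s
    \<phi>. The growth exp(t^2 / 2) picked up in \<open>Cb\<close> cancels when returning to
    \<phi>.\<close>
  define \<psi> where "\<psi> s = \<phi> s * of_real (exp (s\<^sup>2 / 2))" for s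
  have d\<psi>: "(\<psi> has_vector_derivative (\<phi>' s + of_real s * \<phi> s) * of_real (exp (s\<^sup>2 / 2))) (at s)" for s
  proof -
    have "((\<lambda>s. exp (s\<^sup>2 / 2)) has_real_derivative s * exp (s\<^sup>2 / 2)) (at s)"
      by (auto intro!: derivative_eq_intros)
    then have "((\<lambda>s. of_real (exp (s\<^sup>2 / 2)) :: complex) has_vector_derivative of_real (s * exp (s\<^sup>2 / 2))) (at s)"
      by (intro has_vector_derivative_of_real) (simp add: has_real_derivative_iff_has_vector_derivative)
    from has_vector_derivative_mult[OF d\<phi>[of s] this]
    show ?thesis unfolding \<psi>_def[abs_def] by (simp add: algebra_simps)
  qed
  define Cb where "Cb = exp (t\<^sup>2 / 2) * (\<bar>t\<bar> * (96 * sqrt NN * B\<^sup>2) + 2 * B * t\<^sup>2)"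
  have "norm (\<psi> t - \<psi> 0) \<le> Cb * norm (t - 0)"
  proof (rule differentiable_bound[where S = "closed_segment 0 t" and f' = "\<lambda>s x. x *\<^sub>R ((\<phi>' s + of_real s * \<phi> s) * of_real (exp (s\<^sup>2 / 2)))"])
    fix s assume s: "s \<in> closed_segment 0 t"
    then have st: "\<bar>s\<bar> \<le> \<bar>t\<bar>" by (auto simp: closed_segment_eq_real_ivl split: if_splits)
    then have st2: "s\<^sup>2 \<le> t\<^sup>2" using abs_le_square_iff by blast
    show "(\<psi> has_derivative (\<lambda>x. x *\<^sub>R ((\<phi>' s + of_real s * \<phi> s) * of_real (exp (s\<^sup>2 / 2))))) (at s within closed_segment 0 t)"
      using d\<psi>[of s] has_derivative_at_withinI unfolding has_vector_derivative_def by blast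
    have nb: "norm ((\<phi>' s + of_real s * \<phi> s) * of_real (exp (s\<^sup>2 / 2))) \<le> Cb"
    proof -
      have "norm ((\<phi>' s + of_real s * \<phi> s) * of_real (exp (s\<^sup>2 / 2))) =
          exp (s\<^sup>2 / 2) * norm (\<phi>' s + of_real s * \<phi> s)"
        by (simp only: norm_mult norm_of_real abs_exp_cancel mult.commute)
      also have "\<dots> \<le> exp (t\<^sup>2 / 2) * (\<bar>s\<bar> * (96 * sqrt NN * B\<^sup>2) + 2 * B * s\<^sup>2)"
        using main[of s] st2 by (intro mult_mono) auto
      also have "\<dots> \<le> Cb" unfolding Cb_def
        using st st2 B_pos NN_pos by (intro mult_left_mono add_mono mult_right_mono) auto
      finally show ?thesis .
    qed
    show "onorm (\<lambda>x. x *\<^sub>R ((\<phi>' s + of_real s * \<phi> s) * of_real (exp (s\<^sup>2 / 2)))) \<le> Cb"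
      using mult_left_mono[OF nb abs_ge_zero] by (intro onorm_le) (simp only: norm_scaleR real_norm_def mult.commute[of Cb])
  qed auto
  moreover have "\<psi> 0 = 1" by (simp add: \<psi>_def \<phi>_def)
  ultimately have A: "norm (\<psi> t - 1) \<le> Cb * \<bar>t\<bar>" by simp
  have "\<phi> t - of_real (exp (- (t\<^sup>2 / 2))) = of_real (exp (- (t\<^sup>2 / 2))) * (\<psi> t - 1)"
    by (simp add: \<psi>_def algebra_simps of_real_mult[symmetric] exp_add[symmetric] del: of_real_mult)
  then have "norm (\<phi> t - of_real (exp (- (t\<^sup>2 / 2)))) = exp (- (t\<^sup>2 / 2)) * norm (\<psi> t - 1)"
    by (simp only: norm_mult norm_of_real abs_exp_cancel)
  also have "\<dots> \<le> exp (- (t\<^sup>2 / 2)) * (Cb * \<bar>t\<bar>)" using A by (intro mult_left_mono) auto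
  also have "\<dots> = \<bar>t\<bar> * (\<bar>t\<bar> * (96 * sqrt NN * B\<^sup>2) + 2 * B * t\<^sup>2)"
    by (simp add: Cb_def exp_minus)
  finally show ?thesis by (simp add: \<phi>_def)
qed

end

section \<open>Contrasts and quadratic forms\<close>

lemma finite_treatments [simp]: "finite (treatments K)"
  by (simp add: treatments_def)

lemma card_treatments: "real (card (treatments K)) = Qnum K"
  by (simp add: treatments_def Qnum_def card_Pow)

lemma treatments_nonempty: "treatments K \<noteq> {}"
  by (auto simp: treatments_def)

lemma Qnum_pos: "Qnum K > 0"
  by (simp add: Qnum_def)

lemma abs_geff [simp]: "\<bar>geff KK z\<bar> = 1"
  unfolding geff_def abs_prod by (intro prod.neutral) auto

lemma geff_squared [simp]: "geff KK z * geff KK z = 1"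
  using power2_abs[of "geff KK z"] by (simp add: power2_eq_square)

text \<open>The sum is the expansion of the product of all 1 + w k over subsets; a coordinate in
  which z and z' differ contributes the factor 0.\<close>

lemma geff_complete:
  assumes "z \<in> treatments K" "z' \<in> treatments K"
  shows "(\<Sum>KK\<in>Pow {..<K}. geff KK z * geff KK z') = (if z = z' then Qnum K else 0)"
proof -
  define w where "w k = (if k \<in> z then 1 else -1) * (if k \<in> z' then 1 else - 1 :: real)" for k :: nat
  have "(\<Sum>KK\<in>Pow {..<K}. geff KK z * geff KK z') = (\<Prod>k<K. w k + 1)"
    by (simp add: prod_add geff_def w_def prod.distrib)
  also have "\<dots> = (if z = z' then Qnum K else 0)"
  proof (cases "z = z'")
    case True
    then have "w k = 1" for k by (simp add: w_def)
    then show ?thesis using True by (simp add: Qnum_def)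
  next
    case False
    then obtain k where k: "k \<in> z - z' \<or> k \<in> z' - z" by blast
    then have "k < K" using assms by (auto simp: treatments_def)
    moreover have "w k + 1 = 0" using k by (auto simp: w_def)
    ultimately show ?thesis using False by (auto intro!: prod_zero)
  qed
  finally show ?thesis .
qed

lemma geff_orthogonal:
  assumes "KK \<subseteq> {..<K}" "KK' \<subseteq> {..<K}"
  shows "(\<Sum>z\<in>treatments K. geff KK z * geff KK' z) = (if KK = KK' then Qnum K else 0)"
proof -
  \<comment> \<open>Written over the complement of z, each column becomes a product in which z only
    selects the factors; summing over all z is again the expansion of a product.\<close>
  define s where "s KK k = (if k \<in> KK then -1 else 1 :: real)" for KK :: "nat set" and k
  have g: "geff KK z = (\<Prod>k\<in>{..<K} - z. s KK k)" if "KK \<subseteq> {..<K}" for KK z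
  proof -
    have "geff KK z = (\<Prod>k\<in>KK. if k \<in> z then 1 else s KK k)"
      unfolding geff_def s_def by (intro prod.cong) auto
    also have "\<dots> = (\<Prod>k\<in>{..<K}. if k \<in> z then 1 else s KK k)"
      using that by (intro prod.mono_neutral_left) (auto simp: s_def)
    also have "\<dots> = (\<Prod>k\<in>{..<K} - z. if k \<in> z then 1 else s KK k)"
      by (intro prod.mono_neutral_right) auto
    also have "\<dots> = (\<Prod>k\<in>{..<K} - z. s KK k)"
      by (intro prod.cong) auto
    finally show ?thesis .
  qed
  have "(\<Sum>z\<in>treatments K. geff KK z * geff KK' z) = (\<Prod>k<K. 1 + s KK k * s KK' k)"
    unfolding treatments_def using g[OF assms(1)] g[OF assms(2)]
    by (simp add: prod_add prod.distrib)
  also have "\<dots> = (if KK = KK' then Qnum K else 0)"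
  proof (cases "KK = KK'")
    case True
    then have "s KK k * s KK' k = 1" for k by (simp add: s_def)
    then show ?thesis using True by (simp add: Qnum_def)
  next
    case False
    then obtain k where k: "k \<in> KK - KK' \<or> k \<in> KK' - KK" by blast
    then have "k < K" using assms by auto
    moreover have "1 + s KK k * s KK' k = 0" using k by (auto simp: s_def)
    ultimately show ?thesis using False by (auto intro!: prod_zero)
  qed
  finally show ?thesis .
qed

lemma proj_inner:
  "(\<Sum>z\<in>treatments K. proj K M f z * h z) =
     (\<Sum>KK\<in>M. (\<Sum>z\<in>treatments K. geff KK z * f z) * (\<Sum>z\<in>treatments K. geff KK z * h z)) / Qnum K"
proof -
  have "(\<Sum>z\<in>treatments K. proj K M f z * h z) =
      (\<Sum>z\<in>treatments K. \<Sum>KK\<in>M. (\<Sum>z\<in>treatments K. geff KK z * f z) * (geff KK z * h z)) / Qnum K"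
    unfolding proj_def sum_divide_distrib
    by (intro sum.cong refl) (simp add: sum_distrib_right sum_distrib_left sum_divide_distrib mult_ac)
  then show ?thesis by (subst (asm) sum.swap) (simp add: sum_distrib_left)
qed

lemma geff_parseval:
  "(\<Sum>KK\<in>Pow {..<K}. (\<Sum>z\<in>treatments K. geff KK z * f z) * (\<Sum>z\<in>treatments K. geff KK z * h z)) / Qnum K
     = (\<Sum>z\<in>treatments K. f z * h z)"
proof -
  have "(\<Sum>KK\<in>Pow {..<K}. (\<Sum>z\<in>treatments K. geff KK z * f z) * (\<Sum>z\<in>treatments K. geff KK z * h z)) =
    (\<Sum>KK\<in>Pow {..<K}. \<Sum>z\<in>treatments K. \<Sum>z'\<in>treatments K. geff KK z * geff KK z' * (f z * h z'))"
    unfolding sum_product by (simp add: mult_ac)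
  also have "\<dots> = (\<Sum>z\<in>treatments K. \<Sum>KK\<in>Pow {..<K}. \<Sum>z'\<in>treatments K. geff KK z * geff KK z' * (f z * h z'))"
    by (rule sum.swap)
  also have "\<dots> = (\<Sum>z\<in>treatments K. \<Sum>z'\<in>treatments K. \<Sum>KK\<in>Pow {..<K}. geff KK z * geff KK z' * (f z * h z'))"
    by (intro sum.cong refl sum.swap)
  also have "\<dots> = (\<Sum>z\<in>treatments K. \<Sum>z'\<in>treatments K. if z = z' then Qnum K * (f z * h z') else 0)"
    unfolding sum_distrib_right[symmetric] by (intro sum.cong refl) (simp add: geff_complete)
  also have "\<dots> = Qnum K * (\<Sum>z\<in>treatments K. f z * h z)"
    by (simp add: sum_distrib_left)
  finally show ?thesis using Qnum_pos[of K] by simp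
qed

text \<open>In the Parseval sum the terms outside M vanish. For h = \<open>Ybar\<close> and the true
  model this is why passing from f to \<open>fstar\<close> does not change the target
  \<open>gamma\<close>.\<close>

lemma proj_preserves_inner:
  assumes "M \<subseteq> Pow {..<K}"
    and "\<And>KK. KK \<in> Pow {..<K} - M \<Longrightarrow> (\<Sum>z\<in>treatments K. geff KK z * h z) = 0"
  shows "(\<Sum>z\<in>treatments K. proj K M f z * h z) = (\<Sum>z\<in>treatments K. f z * h z)"
  unfolding proj_inner geff_parseval[where K = K and f = f and h = h, symmetric]
  by (intro arg_cong2[where f = "(/)"] sum.mono_neutral_left refl) (use assms in auto)

lemma geff_proj:
  assumes "M \<subseteq> Pow {..<K}" "KK \<subseteq> {..<K}"
  shows "(\<Sum>z\<in>treatments K. geff KK z * proj K M f z) =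
    (if KK \<in> M then (\<Sum>z\<in>treatments K. geff KK z * f z) else 0)"
proof -
  have finM: "finite M" using assms(1) finite_subset by blast
  have "(\<Sum>z\<in>treatments K. geff KK z * proj K M f z) = (\<Sum>z\<in>treatments K. proj K M f z * geff KK z)"
    by (simp add: mult.commute)
  also have "\<dots> = (\<Sum>L\<in>M. (\<Sum>z\<in>treatments K. geff L z * f z) * (if L = KK then Qnum K else 0)) / Qnum K"
    unfolding proj_inner
  proof (intro arg_cong2[where f = "(/)"] arg_cong2[where f = "(*)"] sum.cong refl)
    fix L assume "L \<in> M"
    then show "(\<Sum>z\<in>treatments K. geff L z * geff KK z) = (if L = KK then Qnum K else 0)"
      using assms by (intro geff_orthogonal) auto
  qed
  also have "\<dots> = (if KK \<in> M then (\<Sum>z\<in>treatments K. geff KK z * f z) else 0)"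
    using finM Qnum_pos[of K] by (simp add: if_distrib[of "\<lambda>x. _ * x"] sum.delta cong: if_cong)
  finally show ?thesis .
qed

text \<open>A vector in the span of few contrasts cannot concentrate on few treatments: all contrast
  entries are 1 or -1, and Cauchy-Schwarz over the coefficients compares their absolute sum with the
  norm.\<close>

lemma proj_sup_le:
  assumes "M \<subseteq> Pow {..<K}"
  shows "(proj K M f z)\<^sup>2 \<le> real (card M) / Qnum K * (\<Sum>w\<in>treatments K. (proj K M f w)\<^sup>2)"
proof -
  define u where "u KK = (\<Sum>z\<in>treatments K. geff KK z * f z)" for KK
  have "(\<Sum>w\<in>treatments K. (proj K M f w)\<^sup>2) =
      (\<Sum>KK\<in>M. u KK * (\<Sum>z\<in>treatments K. geff KK z * proj K M f z)) / Qnum K"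
    unfolding power2_eq_square u_def by (rule proj_inner)
  also have "\<dots> = (\<Sum>KK\<in>M. (u KK)\<^sup>2) / Qnum K"
  proof (intro arg_cong2[where f = "(/)"] sum.cong refl)
    fix KK assume "KK \<in> M"
    then show "u KK * (\<Sum>z\<in>treatments K. geff KK z * proj K M f z) = (u KK)\<^sup>2"
      using geff_proj[OF assms, of KK f] assms by (auto simp: u_def power2_eq_square)
  qed
  finally have n: "(\<Sum>w\<in>treatments K. (proj K M f w)\<^sup>2) = (\<Sum>KK\<in>M. (u KK)\<^sup>2) / Qnum K" .
  have "\<bar>proj K M f z\<bar> \<le> (\<Sum>KK\<in>M. \<bar>u KK\<bar>) / Qnum K"
  proof -
    have "\<bar>\<Sum>KK\<in>M. geff KK z * u KK\<bar> \<le> (\<Sum>KK\<in>M. \<bar>u KK\<bar>)"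
      by (rule order_trans[OF sum_abs]) (simp add: abs_mult)
    then show ?thesis unfolding proj_def u_def[symmetric]
      using Qnum_pos[of K] by (simp add: abs_mult divide_right_mono)
  qed
  then have "(proj K M f z)\<^sup>2 \<le> ((\<Sum>KK\<in>M. \<bar>u KK\<bar>) / Qnum K)\<^sup>2"
    by (metis abs_ge_zero power2_abs power_mono)
  also have "\<dots> = (\<Sum>KK\<in>M. 1 * \<bar>u KK\<bar>)\<^sup>2 / (Qnum K)\<^sup>2" by (simp add: power_divide)
  also have "\<dots> \<le> ((\<Sum>KK\<in>M. 1\<^sup>2) * (\<Sum>KK\<in>M. \<bar>u KK\<bar>\<^sup>2)) / (Qnum K)\<^sup>2"
    by (intro divide_right_mono Cauchy_Schwarz_ineq_sum) auto
  also have "\<dots> = real (card M) / Qnum K * (\<Sum>w\<in>treatments K. (proj K M f w)\<^sup>2)"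
    unfolding n by (simp add: power2_eq_square)
  finally show ?thesis .
qed

text \<open>The unit sphere is a closed subset of a compact box in a finite product topology, so the
  continuous form attains a minimum there; homogeneity extends the inequality to all y. Points of
  the box are \<open>undefined\<close> off the treatments, which shapes the normalised vector
  below.\<close>

lemma quad_attains_min:
  "\<exists>x. (\<Sum>z\<in>treatments K. (x z)\<^sup>2) = 1 \<and>
     (\<forall>y. quad K A x * (\<Sum>z\<in>treatments K. (y z)\<^sup>2) \<le> quad K A y)"
proof -
  let ?T = "treatments K"
  let ?P = "product_topology (\<lambda>_. euclideanreal) ?T"
  define B where "B = (\<Pi>\<^sub>E z\<in>?T. {-1..1::real})"
  define S where "S = {x \<in> B. (\<Sum>z\<in>?T. (x z)\<^sup>2) \<in> {1::real}}"
  have proj: "continuous_map ?P euclideanreal (\<lambda>x. x z)" if "z \<in> ?T" for z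
    using continuous_map_product_projection[OF that, of "\<lambda>_. euclideanreal"] .
  have cB: "compactin ?P B"
    unfolding B_def compactin_PiE by simp
  have "closedin ?P S" unfolding S_def
  proof (rule closedin_continuous_map_preimage_gen[where Y = euclideanreal])
    show "continuous_map ?P euclideanreal (\<lambda>x. \<Sum>z\<in>?T. (x z)\<^sup>2)"
      unfolding power2_eq_square by (intro continuous_map_sum continuous_map_real_mult proj) auto
    show "closedin ?P B" unfolding B_def closedin_product_topology by simp
  qed auto
  then have cS: "compactin ?P S"
    by (intro closed_compactin[OF cB]) (auto simp: S_def)
  have "continuous_map ?P euclideanreal (quad K A)"
    unfolding quad_def
    by (intro continuous_map_sum continuous_map_real_mult proj finite_treatments) auto
  then have cimg: "compact (quad K A ` S)"
    using image_compactin[OF cS, of euclideanreal "quad K A"] by simp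
  have inS: "(\<lambda>z. if z \<in> ?T then y z / sqrt (\<Sum>z\<in>?T. (y z)\<^sup>2) else undefined) \<in> S"
    if pos: "(\<Sum>z\<in>?T. (y z)\<^sup>2) > 0" for y
  proof -
    let ?r = "\<Sum>z\<in>?T. (y z)\<^sup>2"
    have "(\<Sum>z\<in>?T. (y z / sqrt ?r)\<^sup>2) = 1"
      using pos by (simp add: power_divide sum_divide_distrib[symmetric])
    moreover have "- 1 \<le> y z / sqrt ?r \<and> y z / sqrt ?r \<le> 1" if "z \<in> ?T" for z
    proof -
      have "(y z)\<^sup>2 \<le> ?r" using that by (intro member_le_sum) auto
      then have "\<bar>y z\<bar> \<le> sqrt ?r" using real_le_rsqrt by (metis abs_ge_zero power2_abs)
      then have "\<bar>y z / sqrt ?r\<bar> \<le> 1" using pos by simp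
      then show ?thesis by linarith
    qed
    ultimately show ?thesis by (auto simp: S_def B_def)
  qed
  have "{} \<in> ?T" by (simp add: treatments_def)
  then have "(\<Sum>z\<in>?T. ((\<lambda>_. 1) z)\<^sup>2) > (0::real)" using card_gt_0_iff[of ?T] by auto
  from inS[OF this] have "quad K A ` S \<noteq> {}" by blast
  from compact_attains_inf[OF cimg this] obtain x where x: "x \<in> S"
    and min: "\<And>y. y \<in> S \<Longrightarrow> quad K A x \<le> quad K A y" by auto
  have "quad K A x * (\<Sum>z\<in>?T. (y z)\<^sup>2) \<le> quad K A y" for y
  proof -
    let ?r = "\<Sum>z\<in>?T. (y z)\<^sup>2"
    have "?r \<ge> 0" by (intro sum_nonneg) auto
    then consider "?r = 0" | "?r > 0" by linarith
    then show ?thesis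
    proof cases
      case 1
      then have "y z = 0" if "z \<in> ?T" for z using that by (subst (asm) sum_nonneg_eq_0_iff) auto
      then have "quad K A y = 0" by (simp add: quad_def)
      then show ?thesis using 1 by simp
    next
      case 2
      have "quad K A x \<le> quad K A (\<lambda>z. if z \<in> ?T then y z / sqrt ?r else undefined)"
        by (intro min inS 2)
      also have "\<dots> = (\<Sum>z\<in>?T. \<Sum>z'\<in>?T. (y z / sqrt ?r) * A z z' * (y z' / sqrt ?r))"
        unfolding quad_def by (intro sum.cong refl) simp
      also have "\<dots> = quad K A y / ?r"
        using 2 unfolding quad_def sum_divide_distrib by (intro sum.cong refl) (simp add: field_simps)
      finally show ?thesis using 2 by (simp add: pos_le_divide_eq)
    qed
  qed
  then show ?thesis using x by (auto simp: S_def)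
qed

text \<open>A minimiser on the unit sphere is an eigenvector, by first variation along each
  coordinate. Applied to A and to -A it supplies both ends of the spectrum in terms of
  \<open>is_eigenvalue\<close> alone.\<close>

lemma rayleigh_min_eigenvalue:
  assumes sym: "\<And>z z'. A z z' = A z' z"
  shows "\<exists>\<mu>. is_eigenvalue K A \<mu> \<and> (\<forall>y. \<mu> * (\<Sum>z\<in>treatments K. (y z)\<^sup>2) \<le> quad K A y)"
proof -
  let ?T = "treatments K"
  obtain x where x1: "(\<Sum>z\<in>?T. (x z)\<^sup>2) = 1"
    and le: "\<And>y. quad K A x * (\<Sum>z\<in>?T. (y z)\<^sup>2) \<le> quad K A y"
    using quad_attains_min by metis
  define \<mu> where "\<mu> = quad K A x"
  have "(\<Sum>z'\<in>?T. A w z' * x z') = \<mu> * x w" if w: "w \<in> ?T" for w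
  proof -
    define b where "b = (\<Sum>z'\<in>?T. A w z' * x z') - \<mu> * x w"
    define e where "e z = (if z = w then 1 else 0 :: real)" for z
    have q: "quad K A (\<lambda>z. x z + t * e z) = \<mu> + 2 * t * (\<Sum>z'\<in>?T. A w z' * x z') + t\<^sup>2 * A w w" for t
    proof -
      have s1: "(\<Sum>z\<in>?T. G z * e z) = G w" for G :: "nat set \<Rightarrow> real"
        using w by (simp add: e_def if_distrib[of "\<lambda>x. _ * x"] sum.delta' cong: if_cong)
      have "quad K A (\<lambda>z. x z + t * e z) = (\<Sum>z\<in>?T. \<Sum>z'\<in>?T. x z * A z z' * x z' +
          t * (x z * A z z' * e z') + t * ((A z z' * x z') * e z) + t\<^sup>2 * (A z z' * e z' * e z))"
        unfolding quad_def by (intro sum.cong refl) (simp add: algebra_simps power2_eq_square)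
      also have "\<dots> = \<mu> + t * (\<Sum>z\<in>?T. x z * A z w) + t * (\<Sum>z'\<in>?T. A w z' * x z') + t\<^sup>2 * A w w"
      proof -
        have "(\<Sum>z\<in>?T. \<Sum>z'\<in>?T. x z * A z z' * e z') = (\<Sum>z\<in>?T. x z * A z w)"
          by (simp add: s1)
        moreover have "(\<Sum>z\<in>?T. \<Sum>z'\<in>?T. (A z z' * x z') * e z) = (\<Sum>z'\<in>?T. A w z' * x z')"
          by (simp add: sum_distrib_right[symmetric] s1)
        moreover have "(\<Sum>z\<in>?T. \<Sum>z'\<in>?T. A z z' * e z' * e z) = A w w"
          by (simp add: sum_distrib_right[symmetric] s1)
        ultimately show ?thesis
          by (simp only: sum.distrib sum_distrib_left[symmetric] \<mu>_def quad_def)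
      qed
      also have "(\<Sum>z\<in>?T. x z * A z w) = (\<Sum>z'\<in>?T. A w z' * x z')"
        by (intro sum.cong refl) (simp add: sym[of w] mult.commute)
      finally show ?thesis by simp
    qed
    have n: "(\<Sum>z\<in>?T. (x z + t * e z)\<^sup>2) = 1 + 2 * t * x w + t\<^sup>2" for t
    proof -
      have s1: "(\<Sum>z\<in>?T. G z * e z) = G w" for G :: "nat set \<Rightarrow> real"
        using w by (simp add: e_def if_distrib[of "\<lambda>x. _ * x"] sum.delta' cong: if_cong)
      have "(\<Sum>z\<in>?T. (x z + t * e z)\<^sup>2) = (\<Sum>z\<in>?T. (x z)\<^sup>2 + (2 * t * x z + t\<^sup>2 * e z) * e z)"
        by (intro sum.cong refl) (simp add: power2_eq_square algebra_simps)
      also have "\<dots> = 1 + (2 * t * x w + t\<^sup>2 * e w)"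
        unfolding sum.distrib x1 s1 ..
      finally show ?thesis by (simp add: e_def)
    qed
    have pos: "0 \<le> 2 * t * b + t\<^sup>2 * (A w w - \<mu>)" for t
      using le[of "\<lambda>z. x z + t * e z"] unfolding q n \<mu>_def[symmetric] by (simp add: b_def algebra_simps)
    \<comment> \<open>the Rayleigh quotient is minimal at \<open>x\<close>, so the linear term in \<open>t\<close> vanishes\<close>
    have "b = 0"
    proof (rule ccontr)
      assume "b \<noteq> 0"
      \<comment> \<open>Strictly larger than the coefficient of t^2, so the choice t = - b / D makes
        the quadratic negative.\<close>
      define D where "D = \<bar>A w w - \<mu>\<bar> + 1"
      have D: "D > 0" "A w w - \<mu> \<le> D" "\<bar>A w w - \<mu>\<bar> < D" by (auto simp: D_def)
      have "0 \<le> 2 * (- b / D) * b + (- b / D)\<^sup>2 * (A w w - \<mu>)" by (rule pos)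
      also have "\<dots> \<le> 2 * (- b / D) * b + (- b / D)\<^sup>2 * D"
        using D by (intro add_left_mono mult_left_mono) auto
      also have "\<dots> = - (b\<^sup>2 / D)" using D by (simp add: field_simps power2_eq_square)
      finally show False using D \<open>b \<noteq> 0\<close> by (simp add: divide_le_0_iff)
    qed
    then show ?thesis by (simp add: b_def)
  qed
  moreover have "\<exists>z\<in>?T. x z \<noteq> 0"
  proof (rule ccontr)
    assume "\<not> ?thesis"
    then have "(\<Sum>z\<in>?T. (x z)\<^sup>2) = 0" by simp
    then show False using x1 by simp
  qed
  ultimately have "is_eigenvalue K A \<mu>" unfolding is_eigenvalue_def by blast
  then show ?thesis using le unfolding \<mu>_def by blast
qed

text \<open>The largest eigenvalue - \<nu> is at least the diagonal entry 1, by testing with a unit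
  vector; the condition number bound then gives 1 \<le> c \<mu> for the smallest eigenvalue
  \<mu>.\<close>

lemma cond_number_le_quad:
  assumes sym: "\<And>z z'. A z z' = A z' z" and c: "cond_number_le K A c"
    and w: "w \<in> treatments K" "A w w = 1"
  shows "(\<Sum>z\<in>treatments K. (y z)\<^sup>2) \<le> c * quad K A y"
proof -
  let ?T = "treatments K"
  obtain \<mu> where mu: "is_eigenvalue K A \<mu>" "\<And>y. \<mu> * (\<Sum>z\<in>?T. (y z)\<^sup>2) \<le> quad K A y"
    using rayleigh_min_eigenvalue[of A K, OF sym] by blast
  have "\<exists>\<nu>. is_eigenvalue K (\<lambda>z z'. - A z z') \<nu> \<and>
      (\<forall>y. \<nu> * (\<Sum>z\<in>?T. (y z)\<^sup>2) \<le> quad K (\<lambda>z z'. - A z z') y)"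
    by (rule rayleigh_min_eigenvalue) (simp add: sym)
  then obtain \<nu> where nu: "is_eigenvalue K (\<lambda>z z'. - A z z') \<nu>"
      "\<And>y. \<nu> * (\<Sum>z\<in>?T. (y z)\<^sup>2) \<le> quad K (\<lambda>z z'. - A z z') y" by blast
  have ev: "is_eigenvalue K A (- \<nu>)"
  proof -
    obtain x where x: "\<exists>z\<in>?T. x z \<noteq> 0" "\<And>z. z \<in> ?T \<Longrightarrow> (\<Sum>z'\<in>?T. - A z z' * x z') = \<nu> * x z"
      using nu(1) unfolding is_eigenvalue_def by blast
    have "(\<Sum>z'\<in>?T. A z z' * x z') = - \<nu> * x z" if "z \<in> ?T" for z
      using x(2)[OF that] by (simp add: sum_negf)
    then show ?thesis using x(1) unfolding is_eigenvalue_def by blast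
  qed
  define e where "e z = (if z = w then 1 else 0 :: real)" for z
  have s1: "(\<Sum>z\<in>?T. G z * e z) = G w" for G :: "nat set \<Rightarrow> real"
    using w by (simp add: e_def if_distrib[of "\<lambda>x. _ * x"] sum.delta' cong: if_cong)
  have "quad K (\<lambda>z z'. - A z z') e = (\<Sum>z\<in>?T. (\<Sum>z'\<in>?T. - A z z' * e z') * e z)"
    unfolding quad_def sum_distrib_right by (intro sum.cong refl) simp
  also have "\<dots> = - 1" unfolding s1 using w by simp
  finally have "quad K (\<lambda>z z'. - A z z') e = -1" .
  moreover have "(\<Sum>z\<in>?T. (e z)\<^sup>2) = 1"
    using w by (simp add: e_def if_distrib[of "\<lambda>x. x\<^sup>2"] sum.delta cong: if_cong)
  ultimately have "1 \<le> - \<nu>" using nu(2)[of e] by simp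
  also have "- \<nu> \<le> c * \<mu>" using c ev mu(1) unfolding cond_number_le_def by blast
  finally have c\<mu>: "1 \<le> c * \<mu>" .
  show ?thesis
  proof (cases "c > 0")
    case True
    have "1 * (\<Sum>z\<in>?T. (y z)\<^sup>2) \<le> (c * \<mu>) * (\<Sum>z\<in>?T. (y z)\<^sup>2)"
      by (intro mult_right_mono c\<mu> sum_nonneg) auto
    also have "\<dots> \<le> c * quad K A y" using True mu(2)[of y] by (simp add: mult.assoc)
    finally show ?thesis by simp
  next
    case False
    \<comment> \<open>Comparing the positive eigenvalue - \<nu> with itself in the condition number
      bound rules out c \<le> 0.\<close>
    have "0 < - \<nu>" using \<open>1 \<le> - \<nu>\<close> by simp
    have "- \<nu> \<le> c * (- \<nu>)" using c ev unfolding cond_number_le_def by blast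
    moreover have "c * (- \<nu>) \<le> 0" using False \<open>0 < - \<nu>\<close> by (intro mult_nonpos_nonneg) auto
    ultimately show ?thesis using \<open>0 < - \<nu>\<close> by linarith
  qed
qed

section \<open>Moments of the sample variances and of contrasts\<close>

text \<open>The variance as a sum over pairs (a U-statistic): there is no sample mean to recentre,
  so replacing one member changes only the terms that contain it.\<close>

definition pairsum :: "('i \<Rightarrow> real) \<Rightarrow> 'i set \<Rightarrow> real" where
  "pairsum y A = (\<Sum>i\<in>A. \<Sum>j\<in>A. (y i - y j)\<^sup>2)"

lemma pairsum_eq:
  assumes "finite A" "A \<noteq> {}"
  shows "pairsum y A = 2 * real (card A) * (\<Sum>i\<in>A. (y i - (\<Sum>j\<in>A. y j) / real (card A))\<^sup>2)"
proof -
  define n where "n = real (card A)"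
  define m where "m = (\<Sum>j\<in>A. y j) / n"
  have n: "n > 0" using assms by (simp add: n_def card_gt_0_iff)
  have s: "(\<Sum>i\<in>A. y i - m) = 0"
    using n by (simp add: sum_subtractf m_def n_def[symmetric])
  have "pairsum y A = (\<Sum>i\<in>A. \<Sum>j\<in>A. (y i - m)\<^sup>2 + (y j - m)\<^sup>2 - 2 * ((y i - m) * (y j - m)))"
    unfolding pairsum_def by (intro sum.cong refl) (simp add: power2_eq_square algebra_simps)
  also have "\<dots> = n * (\<Sum>i\<in>A. (y i - m)\<^sup>2) + n * (\<Sum>i\<in>A. (y i - m)\<^sup>2) - 2 * ((\<Sum>i\<in>A. y i - m) * (\<Sum>j\<in>A. y j - m))"
    unfolding sum_product n_def by (simp add: sum.distrib sum_subtractf sum_distrib_left)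
  finally show ?thesis unfolding s by (simp add: m_def n_def)
qed

lemma pairsum_insert:
  assumes "finite A" "k \<notin> A"
  shows "pairsum y (insert k A) = pairsum y A + 2 * (\<Sum>j\<in>A. (y k - y j)\<^sup>2)"
  using assms by (simp add: pairsum_def sum.distrib power2_commute)

section \<open>The factorial experiment as a random assignment\<close>

locale factorial_experiment =
  fixes K N :: nat and Nz :: "nat set \<Rightarrow> nat" and Y :: "nat \<Rightarrow> nat set \<Rightarrow> real"
  assumes Nz_ge2: "z \<in> treatments K \<Longrightarrow> Nz z \<ge> 2"
    and Nz_sum: "(\<Sum>z\<in>treatments K. Nz z) = N"
begin

abbreviation "TT \<equiv> treatments K"
abbreviation "Yb \<equiv> Ybar N Y"
abbreviation "S \<equiv> Spop N Y"

lemma Nz_pos: "z \<in> TT \<Longrightarrow> Nz z > 0" using Nz_ge2 by fastforce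

text \<open>Two units per arm bound the number of treatments, and with it the number of candidate
  effects, linearly in \<open>N\<close>; K is then at most logarithmic.\<close>

lemma N_ge: "2 * Qnum K \<le> real N"
proof -
  have "(\<Sum>z\<in>TT. 2) \<le> (\<Sum>z\<in>TT. real (Nz z))"
    by (intro sum_mono) (use Nz_ge2 in fastforce)
  then show ?thesis using card_treatments[of K] Nz_sum by (simp flip: of_nat_sum)
qed

lemma N_ge2: "real N \<ge> 2"
proof -
  have "(1::real) \<le> 2 ^ K" by simp
  then show ?thesis using N_ge unfolding Qnum_def by linarith
qed

sublocale randomization "{..<N}" TT Nz
  by unfold_locales (use Nz_sum N_ge2 in \<open>auto simp: lessThan_empty_iff\<close>)

lemma assignments_eq: "assignments K N Nz = Om"
  by (simp add: assignments_def assigns_def)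

lemma Om_D: "Z \<in> Om \<Longrightarrow> i < N \<Longrightarrow> Z i \<in> TT"
  by (auto simp: assigns_def PiE_iff)

lemma card_arm: "Z \<in> Om \<Longrightarrow> z \<in> TT \<Longrightarrow> card {i\<in>{..<N}. Z i = z} = Nz z"
  by (auto simp: assigns_def)

lemma sum_dev: "(\<Sum>i<N. Y i z - Yb z) = 0"
  using N_ge2 by (simp add: sum_subtractf Ybar_def)

lemma linear_contrast_eq:
  assumes Z: "Z \<in> Om"
  shows "(\<Sum>z\<in>TT. f z * (Yhat N Nz Y Z z - Yb z)) =
    (\<Sum>i<N. f (Z i) * (Y i (Z i) - Yb (Z i)) / real (Nz (Z i)))"
proof -
  have im: "Z ` {..<N} \<subseteq> TT" using Om_D[OF Z] by auto
  have "(\<Sum>i<N. f (Z i) * (Y i (Z i) - Yb (Z i)) / real (Nz (Z i))) =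
    (\<Sum>z\<in>TT. \<Sum>i\<in>{i\<in>{..<N}. Z i = z}. f (Z i) * (Y i (Z i) - Yb (Z i)) / real (Nz (Z i)))"
    by (rule sum.group[symmetric]) (use im in auto)
  also have "\<dots> = (\<Sum>z\<in>TT. f z * (Yhat N Nz Y Z z - Yb z))"
  proof (intro sum.cong refl)
    fix z assume z: "z \<in> TT"
    have "(\<Sum>i\<in>{i\<in>{..<N}. Z i = z}. f (Z i) * (Y i (Z i) - Yb (Z i)) / real (Nz (Z i))) =
        (\<Sum>i\<in>{i\<in>{..<N}. Z i = z}. (f z / real (Nz z)) * (Y i (Z i) - Yb z))"
      by (intro sum.cong) auto
    also have "\<dots> = (f z / real (Nz z)) * ((\<Sum>i\<in>{i\<in>{..<N}. Z i = z}. Y i (Z i)) - real (Nz z) * Yb z)"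
      unfolding sum_distrib_left[symmetric] sum_subtractf using card_arm[OF Z z] by simp
    also have "\<dots> = f z * (Yhat N Nz Y Z z - Yb z)"
      using Nz_pos[OF z] by (simp add: Yhat_def field_simps)
    finally show "(\<Sum>i\<in>{i\<in>{..<N}. Z i = z}. f (Z i) * (Y i (Z i) - Yb (Z i)) / real (Nz (Z i))) =
        f z * (Yhat N Nz Y Z z - Yb z)" .
  qed
  finally show ?thesis by simp
qed

lemma quad_DY: "quad K (DY N Nz Y) f = (\<Sum>z\<in>TT. (f z)\<^sup>2 * S z z / real (Nz z))"
proof -
  have "quad K (DY N Nz Y) f = (\<Sum>z\<in>TT. \<Sum>z'\<in>TT. if z = z' then f z * (S z z / real (Nz z)) * f z else 0)"
    unfolding quad_def DY_def by (intro sum.cong refl) auto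
  also have "\<dots> = (\<Sum>z\<in>TT. (f z)\<^sup>2 * S z z / real (Nz z))"
    by (simp add: power2_eq_square mult_ac)
  finally show ?thesis .
qed

lemma quad_Vhat: "quad K (Vhat N Nz Y Z) f = (\<Sum>z\<in>TT. ((f z)\<^sup>2 / real (Nz z)) * Shat N Nz Y Z z)"
proof -
  have "quad K (Vhat N Nz Y Z) f = (\<Sum>z\<in>TT. \<Sum>z'\<in>TT. if z = z' then f z * (Shat N Nz Y Z z / real (Nz z)) * f z else 0)"
    unfolding quad_def Vhat_def by (intro sum.cong refl) auto
  also have "\<dots> = (\<Sum>z\<in>TT. ((f z)\<^sup>2 / real (Nz z)) * Shat N Nz Y Z z)"
    by (simp add: power2_eq_square mult_ac)
  finally show ?thesis .
qed

lemma quad_S: "quad K S f = (\<Sum>i<N. (\<Sum>z\<in>TT. f z * (Y i z - Yb z))\<^sup>2) / (real N - 1)"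
proof -
  have "quad K S f = (\<Sum>z\<in>TT. \<Sum>z'\<in>TT. \<Sum>i<N. (f z * (Y i z - Yb z)) * (f z' * (Y i z' - Yb z'))) / (real N - 1)"
    unfolding quad_def Spop_def sum_divide_distrib
    by (intro sum.cong refl) (simp add: sum_distrib_left sum_distrib_right sum_divide_distrib mult_ac)
  also have "(\<Sum>z\<in>TT. \<Sum>z'\<in>TT. \<Sum>i<N. (f z * (Y i z - Yb z)) * (f z' * (Y i z' - Yb z'))) =
      (\<Sum>z\<in>TT. \<Sum>i<N. \<Sum>z'\<in>TT. (f z * (Y i z - Yb z)) * (f z' * (Y i z' - Yb z')))"
    by (intro sum.cong refl sum.swap)
  also have "\<dots> = (\<Sum>i<N. (\<Sum>z\<in>TT. f z * (Y i z - Yb z))\<^sup>2)"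
    by (subst sum.swap) (simp add: power2_eq_square sum_product)
  finally show ?thesis .
qed

lemma quad_VY: "quad K (VY N Nz Y) f = quad K (DY N Nz Y) f - quad K S f / real N"
  unfolding quad_def VY_def
  by (simp add: algebra_simps sum_subtractf sum_divide_distrib)

lemma quad_S_nonneg: "0 \<le> quad K S f"
  unfolding quad_S using N_ge2 by (intro divide_nonneg_nonneg sum_nonneg) auto

lemma quad_VY_le_DY: "quad K (VY N Nz Y) f \<le> quad K (DY N Nz Y) f"
  unfolding quad_VY using quad_S_nonneg N_ge2 by simp

lemma S_eq_pairsum: "S z z = pairsum (\<lambda>i. Y i z) {..<N} / (2 * real N * (real N - 1))"
  using N_ge2 by (subst pairsum_eq) (auto simp: Spop_def Ybar_def power2_eq_square lessThan_empty_iff)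

lemma Shat_eq_pairsum:
  assumes Z: "Z \<in> Om" and z: "z \<in> TT"
  shows "Shat N Nz Y Z z = pairsum (\<lambda>i. Y i z) {i\<in>{..<N}. Z i = z} / (2 * real (Nz z) * (real (Nz z) - 1))"
proof -
  let ?A = "{i\<in>{..<N}. Z i = z}"
  have c: "card ?A = Nz z" by (rule card_arm[OF Z z])
  then have "?A \<noteq> {}" using Nz_pos[OF z] by (metis card.empty less_irrefl)
  then have p: "pairsum (\<lambda>i. Y i z) ?A = 2 * real (Nz z) * (\<Sum>i\<in>?A. (Y i z - (\<Sum>j\<in>?A. Y j z) / real (Nz z))\<^sup>2)"
    using pairsum_eq[of ?A "\<lambda>i. Y i z"] c by simp
  have "(\<Sum>i\<in>?A. Y i (Z i)) = (\<Sum>j\<in>?A. Y j z)" by (intro sum.cong) auto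
  then have "Yhat N Nz Y Z z = (\<Sum>j\<in>?A. Y j z) / real (Nz z)" by (simp add: Yhat_def)
  then have "Shat N Nz Y Z z = (\<Sum>i\<in>?A. (Y i z - (\<Sum>j\<in>?A. Y j z) / real (Nz z))\<^sup>2) / (real (Nz z) - 1)"
    unfolding Shat_def by (intro arg_cong2[where f = "(/)"] sum.cong) auto
  then show ?thesis unfolding p using Nz_pos[OF z] by simp
qed

text \<open>Two distinct units share arm z with probability n(n - 1) / (N(N - 1)), which exchanges
  the normalisation of the sample pair sum for that of the population pair sum.\<close>

lemma avg_Shat:
  assumes z: "z \<in> TT"
  shows "avg Om (\<lambda>Z. Shat N Nz Y Z z) = S z z"
proof -
  define n where "n = real (Nz z)"
  have n2: "n \<ge> 2" using Nz_ge2[OF z] by (simp add: n_def)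
  let ?I = "{..<N}"
  define b where "b i j = (Y i z - Y j z)\<^sup>2" for i j
  have ps: "pairsum (\<lambda>i. Y i z) {i\<in>?I. Z i = z} = (\<Sum>i\<in>?I. \<Sum>j\<in>?I. b i j * of_bool (Z i = z \<and> Z j = z))" for Z
  proof -
    have "(\<Sum>j\<in>{i\<in>?I. Z i = z}. b i j) = (\<Sum>j\<in>?I. if Z j = z then b i j else 0)" for i
      by (rule sum.inter_filter) simp
    then have "pairsum (\<lambda>i. Y i z) {i\<in>?I. Z i = z} = (\<Sum>i\<in>?I. if Z i = z then (\<Sum>j\<in>?I. if Z j = z then b i j else 0) else 0)"
      unfolding pairsum_def b_def[symmetric] by (simp only: sum.inter_filter finite_lessThan)
    also have "\<dots> = (\<Sum>i\<in>?I. \<Sum>j\<in>?I. b i j * of_bool (Z i = z \<and> Z j = z))"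
    proof (intro sum.cong refl)
      fix i
      show "(if Z i = z then (\<Sum>j\<in>?I. if Z j = z then b i j else 0) else 0) =
          (\<Sum>j\<in>?I. b i j * of_bool (Z i = z \<and> Z j = z))"
        by (cases "Z i = z") (simp_all add: of_bool_def if_distrib[of "\<lambda>x. _ * x"] cong: if_cong)
    qed
    finally show ?thesis .
  qed
  have pr: "avg Om (\<lambda>Z. b i j * of_bool (Z i = z \<and> Z j = z)) = b i j * ((n * n - n) / (NN * (NN - 1)))"
    if "i \<in> ?I" "j \<in> ?I" for i j
  proof (cases "i = j")
    case True
    then show ?thesis by (simp add: b_def)
  next
    case False
    have "(\<Sum>u\<in>TT. \<Sum>w\<in>TT. real (Nz u) * real (Nz w) * of_bool (u = z \<and> w = z)) = n * n"
    proof -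
      have "(\<Sum>u\<in>TT. \<Sum>w\<in>TT. real (Nz u) * real (Nz w) * of_bool (u = z \<and> w = z)) =
          (\<Sum>u\<in>TT. if u = z then (\<Sum>w\<in>TT. if w = z then n * n else 0) else (0::real))"
        by (intro sum.cong refl) (auto simp: n_def intro!: sum.cong)
      then show ?thesis using z by simp
    qed
    moreover have "(\<Sum>u\<in>TT. real (Nz u) * of_bool (u = z \<and> u = z)) = n"
    proof -
      have "(\<Sum>u\<in>TT. real (Nz u) * of_bool (u = z \<and> u = z)) = (\<Sum>u\<in>TT. if u = z then n else (0::real))"
        by (intro sum.cong) (auto simp: n_def)
      then show ?thesis using z by simp
    qed
    ultimately show ?thesis
      unfolding avg_cmult using avg_pair[OF that False, of "\<lambda>u w. of_bool (u = z \<and> w = z)"] by simp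
  qed
  have "avg Om (\<lambda>Z. Shat N Nz Y Z z) = avg Om (\<lambda>Z. (\<Sum>i\<in>?I. \<Sum>j\<in>?I. b i j * of_bool (Z i = z \<and> Z j = z)) / (2 * n * (n - 1)))"
    by (intro avg_cong) (simp only: Shat_eq_pairsum[OF _ z] ps n_def)
  also have "\<dots> = (\<Sum>i\<in>?I. \<Sum>j\<in>?I. b i j * ((n * n - n) / (NN * (NN - 1)))) / (2 * n * (n - 1))"
    unfolding avg_divide avg_sum by (intro arg_cong2[where f = "(/)"] sum.cong refl pr)
  also have "\<dots> = (\<Sum>i\<in>?I. \<Sum>j\<in>?I. b i j) * ((n * n - n) / (2 * n * (n - 1))) / (NN * (NN - 1))"
    unfolding sum_distrib_right[symmetric] by simp
  also have "(n * n - n) / (2 * n * (n - 1)) = 1 / 2"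
    using n2 by (simp add: field_simps)
  finally show ?thesis
    unfolding S_eq_pairsum pairsum_def b_def by (simp add: mult_ac)
qed

text \<open>If exactly one of k and l lies in arm z, the swap replaces one member. Each of the n - 1
  others contributes at most (2R)^2 against either unit, in both orders, so the pair sum moves by at
  most 8 R^2 (n - 1). If both or neither lie in z, nothing changes.\<close>

lemma Shat_swp:
  assumes Z: "Z \<in> Om" and z: "z \<in> TT" and k: "k < N" and l: "l < N"
    and R: "\<And>i. i < N \<Longrightarrow> \<bar>Y i z - Yb z\<bar> \<le> R"
  shows "\<bar>Shat N Nz Y Z z - Shat N Nz Y (swp k l Z) z\<bar> \<le>
    4 * R\<^sup>2 / real (Nz z) * (of_bool (Z k = z) + of_bool (Z l = z))"
proof -
  let ?A = "\<lambda>Z. {i\<in>{..<N}. Z i = z}"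
  define y where "y i = Y i z" for i
  define n where "n = real (Nz z)"
  have n2: "n \<ge> 2" using Nz_ge2[OF z] by (simp add: n_def)
  have Z': "swp k l Z \<in> Om" using swp_assigns[OF Z] k l by auto
  have R0: "0 \<le> R" using R[OF k] by linarith
  have *: "\<bar>pairsum y (?A Z) - pairsum y (?A (swp k l Z))\<bar> \<le> 8 * R\<^sup>2 * (n - 1)"
    if Z: "Z \<in> Om" and k: "k < N" and l: "l < N" and kl: "Z k = z" "Z l \<noteq> z" for Z k l
  proof -
    define A0 where "A0 = ?A Z - {k}"
    have fin: "finite A0" "k \<notin> A0" "l \<notin> A0" using kl by (auto simp: A0_def)
    have c: "real (card A0) = n - 1"
      using card_arm[OF Z z] kl k n2 by (simp add: A0_def n_def card_Diff_singleton of_nat_diff)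
    have A: "?A Z = insert k A0" using kl k by (auto simp: A0_def)
    have A': "?A (swp k l Z) = insert l A0" using kl k l by (auto simp: A0_def swp_def)
    have d: "(\<Sum>j\<in>A0. (y i - y j)\<^sup>2) \<le> (n - 1) * (4 * R\<^sup>2)" if "i < N" for i
    proof -
      have "(y i - y j)\<^sup>2 \<le> 4 * R\<^sup>2" if "j \<in> A0" for j
      proof -
        have "\<bar>y i - y j\<bar> \<le> 2 * R"
          using R[OF \<open>i < N\<close>] R[of j] that by (auto simp: A0_def y_def)
        from power_mono[OF this, of 2] show ?thesis by (simp add: power_mult_distrib)
      qed
      then have "(\<Sum>j\<in>A0. (y i - y j)\<^sup>2) \<le> real (card A0) * (4 * R\<^sup>2)" by (rule sum_bounded_above)
      then show ?thesis by (simp add: c)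
    qed
    have nn: "0 \<le> (\<Sum>j\<in>A0. (y i - y j)\<^sup>2)" for i by (intro sum_nonneg) auto
    show ?thesis
      unfolding A A' pairsum_insert[OF fin(1,2)] pairsum_insert[OF fin(1,3)]
      using d[OF k] d[OF l] nn[of k] nn[of l] by (simp add: abs_le_iff algebra_simps)
  qed
  have bd: "\<bar>Shat N Nz Y Z z - Shat N Nz Y (swp k l Z) z\<bar> \<le> 4 * R\<^sup>2 / n"
    if "\<bar>pairsum y (?A Z) - pairsum y (?A (swp k l Z))\<bar> \<le> 8 * R\<^sup>2 * (n - 1)"
  proof -
    have "\<bar>Shat N Nz Y Z z - Shat N Nz Y (swp k l Z) z\<bar> =
        \<bar>pairsum y (?A Z) - pairsum y (?A (swp k l Z))\<bar> / (2 * n * (n - 1))"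
      unfolding Shat_eq_pairsum[OF Z z] Shat_eq_pairsum[OF Z' z] n_def[symmetric] y_def[symmetric]
        diff_divide_distrib[symmetric] abs_divide using n2 by simp
    also have "\<dots> \<le> 8 * R\<^sup>2 * (n - 1) / (2 * n * (n - 1))"
      using that n2 by (intro divide_right_mono) auto
    also have "\<dots> = 4 * R\<^sup>2 / n" using n2 by (simp add: field_simps)
    finally show ?thesis .
  qed
  consider "Z k = z" "Z l \<noteq> z" | "Z k \<noteq> z" "Z l = z" | "Z k = z" "Z l = z" | "Z k \<noteq> z" "Z l \<noteq> z" by blast
  then show ?thesis
  proof cases
    case 1
    then show ?thesis using bd[OF *[OF Z k l 1]] by (simp add: n_def)
  next
    case 2
    have "swp l k Z = swp k l Z" by (auto simp: swp_def fun_eq_iff)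
    then show ?thesis using bd *[OF Z l k 2(2,1)] 2 by (simp add: n_def)
  next
    case 3
    then have "swp k l Z = Z" by (auto simp: swp_def fun_eq_iff)
    then show ?thesis using R0 by simp
  next
    case 4
    then have "?A (swp k l Z) = ?A Z" by (auto simp: swp_def)
    then show ?thesis using 4 unfolding Shat_eq_pairsum[OF Z z] Shat_eq_pairsum[OF Z' z] by simp
  qed
qed

text \<open>A swap touches only the arms of k and l, so the bound does not grow with the number of
  arms.\<close>

lemma weighted_Shat_swp:
  assumes Z: "Z \<in> Om" and k: "k \<in> {..<N}" and l: "l \<in> {..<N}"
    and R: "\<And>i z. i < N \<Longrightarrow> z \<in> TT \<Longrightarrow> \<bar>Y i z - Yb z\<bar> \<le> R"
    and w: "\<And>z. z \<in> TT \<Longrightarrow> \<bar>w z\<bar> * (4 * R\<^sup>2 / real (Nz z)) \<le> W"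
  shows "\<bar>(\<Sum>z\<in>TT. w z * Shat N Nz Y Z z) - (\<Sum>z\<in>TT. w z * Shat N Nz Y (swp k l Z) z)\<bar> \<le> 2 * W"
proof -
  have "\<bar>(\<Sum>z\<in>TT. w z * Shat N Nz Y Z z) - (\<Sum>z\<in>TT. w z * Shat N Nz Y (swp k l Z) z)\<bar> =
      \<bar>\<Sum>z\<in>TT. w z * (Shat N Nz Y Z z - Shat N Nz Y (swp k l Z) z)\<bar>"
    by (simp add: sum_subtractf right_diff_distrib)
  also have "\<dots> \<le> (\<Sum>z\<in>TT. W * (of_bool (Z k = z) + of_bool (Z l = z)))"
  proof (intro order_trans[OF sum_abs] sum_mono)
    fix z assume z: "z \<in> TT"
    have "\<bar>w z * (Shat N Nz Y Z z - Shat N Nz Y (swp k l Z) z)\<bar> \<le>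
        \<bar>w z\<bar> * (4 * R\<^sup>2 / real (Nz z) * (of_bool (Z k = z) + of_bool (Z l = z)))"
      unfolding abs_mult by (intro mult_left_mono Shat_swp Z z R) (use k l z in auto)
    also have "\<dots> = (\<bar>w z\<bar> * (4 * R\<^sup>2 / real (Nz z))) * (of_bool (Z k = z) + of_bool (Z l = z))"
      by simp
    also have "\<dots> \<le> W * (of_bool (Z k = z) + of_bool (Z l = z))"
      by (intro mult_right_mono w z) auto
    finally show "\<bar>w z * (Shat N Nz Y Z z - Shat N Nz Y (swp k l Z) z)\<bar> \<le> W * (of_bool (Z k = z) + of_bool (Z l = z))" .
  qed
  also have "\<dots> = 2 * W"
    using Om_D[OF Z, of k] Om_D[OF Z, of l] k l
    by (simp add: sum_distrib_left[symmetric] sum.distrib of_bool_def)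
  finally show ?thesis .
qed

lemma avg_weighted_Shat: "avg Om (\<lambda>Z. \<Sum>z\<in>TT. w z * Shat N Nz Y Z z) = (\<Sum>z\<in>TT. w z * S z z)"
  unfolding avg_sum avg_cmult by (intro sum.cong refl) (simp add: avg_Shat)

text \<open>The scale s is left free: it is 1 for raw estimation errors, sqrt v for null effects and
  the standard deviation of the target contrast in the central limit theorem.\<close>

lemma linear_statistic_contrast:
  assumes "s > 0" "B > 0"
    and "\<And>i z. i < N \<Longrightarrow> z \<in> TT \<Longrightarrow> \<bar>f z * (Y i z - Yb z)\<bar> / (real (Nz z) * s) \<le> B"
  shows "linear_statistic {..<N} TT Nz (\<lambda>i z. f z * (Y i z - Yb z) / (real (Nz z) * s)) B"
proof unfold_locales
  fix z assume "z \<in> TT"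
  have "(\<Sum>i<N. f z * (Y i z - Yb z) / (real (Nz z) * s)) = f z / (real (Nz z) * s) * (\<Sum>i<N. Y i z - Yb z)"
    by (simp add: sum_distrib_left)
  then show "(\<Sum>i<N. f z * (Y i z - Yb z) / (real (Nz z) * s)) = 0" by (simp only: sum_dev mult_zero_right)
next
  fix i z assume "i \<in> {..<N}" "z \<in> TT"
  then show "\<bar>f z * (Y i z - Yb z) / (real (Nz z) * s)\<bar> \<le> B"
    using assms(3)[of i z] assms(1) by (simp add: abs_divide abs_mult)
qed (rule assms)

lemma X_contrast:
  assumes lin: "linear_statistic {..<N} TT Nz (\<lambda>i z. f z * (Y i z - Yb z) / (real (Nz z) * s)) B"
    and Z: "Z \<in> Om"
  shows "linear_statistic.X {..<N} (\<lambda>i z. f z * (Y i z - Yb z) / (real (Nz z) * s)) Z =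
    (\<Sum>z\<in>TT. f z * (Yhat N Nz Y Z z - Yb z)) / s"
  unfolding linear_statistic.X_def[OF lin] linear_contrast_eq[OF Z] sum_divide_distrib
  by (intro sum.cong refl) simp

text \<open>In \<open>avg_X_squared\<close> the squares of the scores assemble to \<open>DY\<close>,
  and the squared row sums to \<open>Spop\<close>, divided by N; the difference is
  \<open>VY\<close>.\<close>

lemma variance_contrast:
  assumes lin: "linear_statistic {..<N} TT Nz (\<lambda>i z. f z * (Y i z - Yb z) / (real (Nz z) * s)) B"
    and s: "s > 0"
  shows "avg Om (\<lambda>Z. (linear_statistic.X {..<N} (\<lambda>i z. f z * (Y i z - Yb z) / (real (Nz z) * s)) Z)\<^sup>2) =
    quad K (VY N Nz Y) f / s\<^sup>2"
proof -
  let ?D = "\<lambda>i z. Y i z - Yb z"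
  have N1: "1 < real (card {..<N})" using N_ge2 by simp
  have 1: "(\<Sum>i<N. \<Sum>z\<in>TT. real (Nz z) * (f z * ?D i z / (real (Nz z) * s))\<^sup>2) / (real N - 1) = quad K (DY N Nz Y) f / s\<^sup>2"
  proof -
    have "(\<Sum>i<N. \<Sum>z\<in>TT. real (Nz z) * (f z * ?D i z / (real (Nz z) * s))\<^sup>2) / (real N - 1) =
        (\<Sum>z\<in>TT. \<Sum>i<N. ((f z)\<^sup>2 / real (Nz z) / s\<^sup>2) * (?D i z * ?D i z)) / (real N - 1)"
      by (subst sum.swap, intro arg_cong2[where f = "(/)"] sum.cong refl)
        (use s Nz_pos in \<open>auto simp: power2_eq_square field_simps\<close>)
    also have "\<dots> = quad K (DY N Nz Y) f / s\<^sup>2"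
      unfolding quad_DY Spop_def sum_distrib_left[symmetric] sum_divide_distrib[where A = TT]
      by (intro sum.cong refl) simp
    finally show ?thesis .
  qed
  have 2: "(\<Sum>i<N. (\<Sum>z\<in>TT. real (Nz z) * (f z * ?D i z / (real (Nz z) * s)))\<^sup>2 / real N) / (real N - 1) = quad K S f / real N / s\<^sup>2"
  proof -
    have r: "(\<Sum>z\<in>TT. real (Nz z) * (f z * ?D i z / (real (Nz z) * s))) = (\<Sum>z\<in>TT. f z * ?D i z) / s" for i
      unfolding sum_divide_distrib
    proof (intro sum.cong refl)
      fix z assume "z \<in> TT"
      then show "real (Nz z) * (f z * ?D i z / (real (Nz z) * s)) = f z * ?D i z / s"
        using Nz_pos[of z] s by simp
    qed
    show ?thesis unfolding quad_S r power_divide sum_divide_distrib[symmetric] by (simp add: mult_ac)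
  qed
  show ?thesis
    unfolding linear_statistic.avg_X_squared[OF lin N1] quad_VY diff_divide_distrib
    using 1 2 by (simp add: sum_subtractf diff_divide_distrib)
qed

end

section \<open>Quantiles of the standard normal distribution\<close>

lemma std_normal_greaterThan:
  "measure std_normal_distribution {t<..} = 1 - std_normal_cdf t"
proof -
  interpret prob_space std_normal_distribution by (rule prob_space_normal_density) simp
  have "{t<..} = space std_normal_distribution - {..t}" by auto
  then show ?thesis using prob_compl[of "{..t}"] by (simp add: std_normal_cdf_def)
qed

text \<open>For x > t one has x^2 \<ge> t^2 + (x - t)^2, so the density is at most exp(-t^2/2) times
  the normal density centred at t.\<close>

lemma std_normal_tail_le:
  assumes t: "0 \<le> t"
  shows "1 - std_normal_cdf t \<le> exp (- (t\<^sup>2 / 2))"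
proof -
  have "emeasure std_normal_distribution {t<..} =
      (\<integral>\<^sup>+ x. ennreal (std_normal_density x) * indicator {t<..} x \<partial>lborel)"
    by (subst emeasure_density) auto
  also have "\<dots> \<le> (\<integral>\<^sup>+ x. ennreal (exp (- (t\<^sup>2 / 2))) * ennreal (normal_density t 1 x) \<partial>lborel)"
  proof (intro nn_integral_mono)
    fix x
    show "ennreal (std_normal_density x) * indicator {t<..} x \<le>
        ennreal (exp (- (t\<^sup>2 / 2))) * ennreal (normal_density t 1 x)"
    proof (cases "x > t")
      case True
      have "0 \<le> t * (x - t)" using t True by simp
      then have "t\<^sup>2 + (x - t)\<^sup>2 \<le> x\<^sup>2"
        by (simp add: power2_eq_square algebra_simps)
      then have "- (x\<^sup>2 / 2) \<le> - (t\<^sup>2 / 2) + (- ((x - t)\<^sup>2 / 2))"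
        by linarith
      then have "exp (- (x\<^sup>2 / 2)) \<le> exp (- (t\<^sup>2 / 2)) * exp (- ((x - t)\<^sup>2 / 2))"
        by (simp add: exp_add[symmetric])
      then have "std_normal_density x \<le> exp (- (t\<^sup>2 / 2)) * normal_density t 1 x"
        by (simp add: normal_density_def field_simps)
      then have "ennreal (std_normal_density x) \<le> ennreal (exp (- (t\<^sup>2 / 2)) * normal_density t 1 x)"
        by (rule ennreal_leI)
      then show ?thesis using True by (simp add: ennreal_mult)
    qed simp
  qed
  also have "\<dots> = ennreal (exp (- (t\<^sup>2 / 2))) * emeasure (density lborel (normal_density t 1)) UNIV"
    by (subst nn_integral_cmult) (auto simp: emeasure_density)
  also have "emeasure (density lborel (normal_density t 1)) UNIV = 1"
    using prob_space.emeasure_space_1[OF prob_space_normal_density[of 1 t]] by simp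
  finally have "emeasure std_normal_distribution {t<..} \<le> ennreal (exp (- (t\<^sup>2 / 2)))" by simp
  then show ?thesis
    unfolding std_normal_greaterThan[symmetric] measure_def by (intro enn2real_leI) auto
qed

lemma std_normal_interval_ge:
  assumes xy: "x \<le> y" and c: "0 \<le> c" "\<And>u. x < u \<Longrightarrow> u \<le> y \<Longrightarrow> c \<le> std_normal_density u"
  shows "(y - x) * c \<le> std_normal_cdf y - std_normal_cdf x"
proof -
  interpret prob_space std_normal_distribution by (rule prob_space_normal_density) simp
  have "ennreal ((y - x) * c) = (\<integral>\<^sup>+ u. ennreal c * indicator {x<..y} u \<partial>lborel)"
    using xy c(1) by (subst nn_integral_cmult_indicator) (auto simp: ennreal_mult mult.commute)
  also have "\<dots> \<le> (\<integral>\<^sup>+ u. ennreal (std_normal_density u) * indicator {x<..y} u \<partial>lborel)"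
    by (intro nn_integral_mono) (auto simp: indicator_def intro!: ennreal_leI c)
  also have "\<dots> = emeasure std_normal_distribution {x<..y}"
    by (subst emeasure_density) auto
  also have "\<dots> = ennreal (measure std_normal_distribution {x<..y})"
    by (rule emeasure_eq_measure)
  finally have "(y - x) * c \<le> measure std_normal_distribution {x<..y}"
    by (simp add: ennreal_le_iff)
  moreover have "{..y} - {..x} = {x<..y}" by auto
  then have "measure std_normal_distribution {x<..y} = std_normal_cdf y - std_normal_cdf x"
    using finite_measure_Diff[of "{..y}" "{..x}"] xy by (simp add: std_normal_cdf_def)
  ultimately show ?thesis by simp
qed

lemma std_normal_cdf_strict_mono: "x < y \<Longrightarrow> std_normal_cdf x < std_normal_cdf y"
proof -
  assume xy: "x < y"
  define r where "r = max \<bar>x\<bar> \<bar>y\<bar>"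
  have "(y - x) * std_normal_density r \<le> std_normal_cdf y - std_normal_cdf x"
  proof (rule std_normal_interval_ge)
    fix u assume "x < u" "u \<le> y"
    then have "\<bar>u\<bar> \<le> \<bar>r\<bar>" by (auto simp: r_def)
    then have "u\<^sup>2 \<le> r\<^sup>2" by (simp only: abs_le_square_iff)
    then show "std_normal_density r \<le> std_normal_density u"
      by (simp add: std_normal_density_def divide_right_mono)
  qed (use xy in auto)
  moreover have "0 < (y - x) * std_normal_density r"
    using xy by (intro mult_pos_pos normal_density_pos) auto
  ultimately show ?thesis by linarith
qed

text \<open>The mass of the interval from t to t + 1 alone, with the density bounded below by its
  value at the right end.\<close>

lemma std_normal_tail_ge:
  assumes t: "0 \<le> t"
  shows "exp (- ((t + 1)\<^sup>2 / 2)) / sqrt (2 * pi) \<le> 1 - std_normal_cdf t"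
proof -
  interpret prob_space std_normal_distribution by (rule prob_space_normal_density) simp
  have "(t + 1 - t) * (exp (- ((t + 1)\<^sup>2 / 2)) / sqrt (2 * pi)) \<le> std_normal_cdf (t + 1) - std_normal_cdf t"
  proof (rule std_normal_interval_ge)
    fix u assume "t < u" "u \<le> t + 1"
    then have "u\<^sup>2 \<le> (t + 1)\<^sup>2" using t by (intro power_mono) auto
    then show "exp (- ((t + 1)\<^sup>2 / 2)) / sqrt (2 * pi) \<le> std_normal_density u"
      by (simp add: std_normal_density_def divide_right_mono)
  qed auto
  moreover have "std_normal_cdf (t + 1) \<le> 1" by (simp add: std_normal_cdf_def)
  ultimately show ?thesis by simp
qed

lemma std_normal_cdf_quantile:
  assumes "0 < u" "u < 1"
  shows "std_normal_cdf (std_normal_quantile u) = u"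
proof -
  interpret real_distribution std_normal_distribution by (rule real_dist_normal_dist)
  have cdf: "cdf std_normal_distribution = std_normal_cdf"
    by (simp add: fun_eq_iff cdf_def std_normal_cdf_def)
  have "measure std_normal_distribution {x} = 0" for x
  proof -
    have "emeasure std_normal_distribution {x} = 0"
      by (subst emeasure_density) (auto intro!: nn_integral_null_set simp: null_sets_def)
    then show ?thesis by (simp add: measure_def)
  qed
  then have cont: "isCont std_normal_cdf x" for x
    using isCont_cdf[of x] by (simp add: cdf)
  have "\<forall>\<^sub>F x in at_bot. std_normal_cdf x < u"
    using cdf_lim_at_bot assms(1) unfolding cdf by (rule order_tendstoD)
  then obtain a where a: "std_normal_cdf a < u" using eventually_happens by fastforce
  have "\<forall>\<^sub>F x in at_top. u < std_normal_cdf x"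
    using cdf_lim_at_top_prob assms(2) unfolding cdf by (rule order_tendstoD)
  then obtain b where b: "u < std_normal_cdf b" using eventually_happens by fastforce
  have "a \<le> b"
  proof (rule ccontr)
    assume "\<not> a \<le> b"
    then have "std_normal_cdf b < std_normal_cdf a" by (intro std_normal_cdf_strict_mono) simp
    then show False using a b by simp
  qed
  then obtain x where x: "std_normal_cdf x = u"
    using IVT[of std_normal_cdf a u b] a b cont by auto
  have "std_normal_quantile u = x"
    unfolding std_normal_quantile_def
  proof (rule the_equality)
    show "std_normal_cdf x = u" by (rule x)
  next
    fix y assume "std_normal_cdf y = u"
    then show "y = x" using x std_normal_cdf_strict_mono by (metis less_irrefl linorder_less_linear)
  qed
  then show ?thesis using x by simp
qed

text \<open>The cutoff for p / 2 is the lower tail bound at 0; below it the quantile must be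
  positive, so both tail bounds apply at t.\<close>

lemma std_normal_upper_quantile:
  assumes p: "0 < p" "p / 2 < exp (- (1 / 2)) / sqrt (2 * pi)"
  defines "t \<equiv> std_normal_quantile (1 - p / 2)"
  shows "0 < t" "p / 2 \<le> exp (- (t\<^sup>2 / 2))" "exp (- ((t + 1)\<^sup>2 / 2)) / sqrt (2 * pi) \<le> p / 2"
proof -
  have c0: "exp (- (1 / 2)) / sqrt (2 * pi) \<le> 1 - std_normal_cdf 0"
    using std_normal_tail_ge[of 0] by simp
  have "0 \<le> std_normal_cdf 0" by (simp add: std_normal_cdf_def)
  then have "p / 2 < 1" using c0 p by linarith
  then have q: "std_normal_cdf t = 1 - p / 2"
    unfolding t_def using p by (intro std_normal_cdf_quantile) auto
  show t: "0 < t"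
  proof (rule ccontr)
    assume "\<not> 0 < t"
    then have "std_normal_cdf t \<le> std_normal_cdf 0"
      using std_normal_cdf_strict_mono[of t 0] by (cases "t = 0") auto
    then show False using q c0 p by linarith
  qed
  show "p / 2 \<le> exp (- (t\<^sup>2 / 2))" using std_normal_tail_le[of t] t q by simp
  show "exp (- ((t + 1)\<^sup>2 / 2)) / sqrt (2 * pi) \<le> p / 2" using std_normal_tail_ge[of t] t q by simp
qed

text \<open>The left side is the sharp tail of a null effect at its threshold. The lower tail bound
  involves t + 1; 2t \<le> \<eta> t^2 + 1/\<eta> absorbs the shift at the price of exp((1 +
  1/\<eta>)/2), and (1 - 5\<eta>)(1 + \<eta>) \<le> 1 - 4\<eta> fixes the power of p.\<close>

lemma exp_quantile_le:
  assumes p: "0 < p" "p / 2 < exp (- (1 / 2)) / sqrt (2 * pi)" and e: "0 < \<eta>" "\<eta> \<le> 1 / 10"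
  defines "t \<equiv> std_normal_quantile (1 - p / 2)"
  shows "exp (- ((1 - 4 * \<eta>) * t\<^sup>2 / 2)) \<le> 2 * exp ((1 + 1 / \<eta>) / 2) * p powr (1 - 5 * \<eta>)"
proof -
  define \<beta> where "\<beta> = 1 - 5 * \<eta>"
  have \<beta>: "0 \<le> \<beta>" "\<beta> \<le> 1" using e by (auto simp: \<beta>_def)
  have t: "0 < t" "exp (- ((t + 1)\<^sup>2 / 2)) / sqrt (2 * pi) \<le> p / 2"
    unfolding t_def using std_normal_upper_quantile[OF p] by auto
  have "sqrt (2 * pi) \<le> sqrt 16" using pi_less_4 by (intro real_sqrt_le_mono) simp
  moreover have "sqrt 16 = (4::real)" by (rule real_sqrt_unique) auto
  ultimately have s4: "sqrt (2 * pi) \<le> 4" by simp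
  have "exp (- ((t + 1)\<^sup>2 / 2)) \<le> p / 2 * sqrt (2 * pi)" using t(2) by (simp add: pos_divide_le_eq)
  also have "\<dots> \<le> p / 2 * 4" using s4 p by (intro mult_left_mono) auto
  finally have e1: "exp (- ((t + 1)\<^sup>2 / 2)) \<le> 2 * p" by simp
  have "0 \<le> (sqrt \<eta> * t - 1 / sqrt \<eta>)\<^sup>2" by simp
  also have "\<dots> = \<eta> * t\<^sup>2 - 2 * t + 1 / \<eta>" using e by (simp add: power2_diff power_mult_distrib power_divide)
  finally have am: "(t + 1)\<^sup>2 \<le> (1 + \<eta>) * t\<^sup>2 + (1 + 1 / \<eta>)" by (simp add: power2_eq_square algebra_simps)
  have f1: "\<beta> * (t + 1)\<^sup>2 \<le> \<beta> * ((1 + \<eta>) * t\<^sup>2) + \<beta> * (1 + 1 / \<eta>)"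
    using mult_left_mono[OF am \<beta>(1)] by (simp add: distrib_left)
  have f2: "\<beta> * (1 + 1 / \<eta>) \<le> 1 + 1 / \<eta>"
    using mult_right_mono[of \<beta> 1 "1 + 1 / \<eta>"] \<beta> e by simp
  have f3: "\<beta> * ((1 + \<eta>) * t\<^sup>2) \<le> (1 - 4 * \<eta>) * t\<^sup>2"
  proof -
    have "\<beta> * (1 + \<eta>) \<le> 1 - 4 * \<eta>" using e by (simp add: \<beta>_def algebra_simps)
    then have "\<beta> * (1 + \<eta>) * t\<^sup>2 \<le> (1 - 4 * \<eta>) * t\<^sup>2" by (intro mult_right_mono) auto
    then show ?thesis by (simp add: mult.assoc)
  qed
  have "\<beta> * (t + 1)\<^sup>2 \<le> (1 - 4 * \<eta>) * t\<^sup>2 + (1 + 1 / \<eta>)"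
    by (rule order_trans[OF f1 add_mono[OF f3 f2]])
  moreover have "- (a / 2) \<le> c / 2 + - (b / 2)" if "b \<le> a + c" for a b c :: real
    using that by linarith
  ultimately have "- ((1 - 4 * \<eta>) * t\<^sup>2 / 2) \<le> (1 + 1 / \<eta>) / 2 + (- (\<beta> * (t + 1)\<^sup>2 / 2))"
    by blast
  then have "- ((1 - 4 * \<eta>) * t\<^sup>2 / 2) \<le> (1 + 1 / \<eta>) / 2 + \<beta> * (- ((t + 1)\<^sup>2 / 2))"
    by simp
  then have "exp (- ((1 - 4 * \<eta>) * t\<^sup>2 / 2)) \<le> exp ((1 + 1 / \<eta>) / 2) * exp (\<beta> * (- ((t + 1)\<^sup>2 / 2)))"
    by (simp add: exp_add[symmetric])
  also have "exp (\<beta> * (- ((t + 1)\<^sup>2 / 2))) = exp (- ((t + 1)\<^sup>2 / 2)) powr \<beta>"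
    by (simp add: powr_def)
  also have "\<dots> \<le> (2 * p) powr \<beta>" using e1 \<beta> by (intro powr_mono2) auto
  also have "\<dots> = 2 powr \<beta> * p powr \<beta>" using p by (simp add: powr_mult)
  also have "2 powr \<beta> \<le> 2 powr (1::real)" using \<beta> by (intro powr_mono) auto
  finally show ?thesis using p by (simp add: \<beta>_def mult_ac mult_left_mono mult_right_mono)
qed

section \<open>Consistency of the screening procedure\<close>

lemma (in linear_statistic) abs_X_tail:
  assumes "0 < \<epsilon>"
  shows "prob (\<lambda>Z. \<bar>X Z\<bar> \<ge> \<epsilon>) \<le> 2 * exp (- (\<epsilon>\<^sup>2 / (64 * NN * B\<^sup>2)))"
proof -
  have "prob (\<lambda>Z. \<bar>X Z - avg Om X\<bar> \<ge> \<epsilon>) \<le> 2 * exp (- (\<epsilon>\<^sup>2 / (4 * NN * (4 * B)\<^sup>2)))"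
    by (rule bounded_differences_tail) (use abs_d_le B_pos assms in \<open>auto simp: X_swp\<close>)
  then show ?thesis by (simp add: avg_X power_mult_distrib mult_ac)
qed

lemma Mstar_subset: "Mstar K N Y \<subseteq> Pow {..<K}"
  by (auto simp: Mstar_def Mstar_upto_def Mstar_d_def)

lemma Mstar_upto_iff:
  "KK \<in> Mstar_upto K N Y D \<longleftrightarrow> KK \<subseteq> {..<K} \<and> 1 \<le> card KK \<and> card KK \<le> D \<and> tau K N Y KK \<noteq> 0"
  by (auto simp: Mstar_upto_def Mstar_d_def)

lemma tau_nonzero_imp_Mstar:
  assumes "KK \<subseteq> {..<K}" "tau K N Y KK \<noteq> 0"
  shows "KK \<in> Mstar K N Y"
proof (cases "KK = {}")
  case False
  have "finite KK" using assms(1) finite_subset by blast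
  then have "1 \<le> card KK" using False by (simp add: Suc_le_eq card_gt_0_iff)
  moreover have "card KK \<le> K" using card_mono[OF _ assms(1)] by simp
  ultimately show ?thesis using assms by (simp add: Mstar_def Mstar_upto_iff)
qed (simp add: Mstar_def)

definition prefix_model :: "nat \<Rightarrow> nat \<Rightarrow> (nat \<Rightarrow> nat set \<Rightarrow> real) \<Rightarrow> nat \<Rightarrow> nat set set" where
  "prefix_model K N Y d = insert {} (Mstar_upto K N Y d)"

text \<open>The candidates of level \<open>d\<close> when all earlier levels were screened without error; unlike the
  candidates of the procedure they are deterministic, which permits a union bound.\<close>

definition oracle_candidates :: "bool \<Rightarrow> nat \<Rightarrow> nat \<Rightarrow> (nat \<Rightarrow> nat set \<Rightarrow> real) \<Rightarrow> nat \<Rightarrow> nat set set" where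
  "oracle_candidates strong K N Y d = candidates strong K (prefix_model K N Y (d - 1)) d"

text \<open>If \<open>c = 0\<close> the quantile is taken at 1, where it is unspecified; no effect is then tested.\<close>

definition threshold :: "real \<Rightarrow> nat \<Rightarrow> real" where
  "threshold al c = std_normal_quantile (1 - min (al / real c) 1 / 2)"

lemma oracle_candidates_subset: "oracle_candidates strong K N Y d \<subseteq> {KK \<in> Pow {..<K}. card KK = d}"
  by (auto simp: oracle_candidates_def candidates_def)

lemma finite_oracle_candidates: "finite (oracle_candidates strong K N Y d)"
  by (rule finite_subset[OF oracle_candidates_subset]) simp

lemma card_oracle_candidates: "real (card (oracle_candidates strong K N Y d)) \<le> Qnum K"
proof -
  have "card (oracle_candidates strong K N Y d) \<le> card (Pow {..<K})"
    using oracle_candidates_subset[of strong K N Y d] by (intro card_mono) auto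
  then show ?thesis unfolding Qnum_def by (simp add: card_Pow flip: of_nat_le_iff)
qed

text \<open>Heredity speaks of the full true model, but a parent of an effect of size d + 1 has size
  d and so already belongs to the prefix of level d; the empty parent is there by
  definition.\<close>

lemma heredity_oracle_candidates:
  assumes her: "heredity strong K N Y" and KK: "KK \<subseteq> {..<K}" "card KK = Suc d" "tau K N Y KK \<noteq> 0"
  shows "KK \<in> oracle_candidates strong K N Y (Suc d)"
proof -
  have fin: "finite KK" using KK(1) finite_subset by blast
  have ne: "KK \<noteq> {}" using KK(2) by auto
  have parent: "KK - {k} \<in> prefix_model K N Y d" if "k \<in> KK" "KK - {k} \<in> Mstar K N Y" for k
  proof (cases "KK - {k} = {}")
    case False
    then have "KK - {k} \<in> Mstar_upto K N Y K" using that by (simp add: Mstar_def)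
    moreover have "card (KK - {k}) = d" using KK(2) that fin by simp
    ultimately show ?thesis by (simp add: prefix_model_def Mstar_upto_iff)
  qed (simp add: prefix_model_def)
  have "if strong then (\<forall>k\<in>KK. KK - {k} \<in> Mstar K N Y) else (\<exists>k\<in>KK. KK - {k} \<in> Mstar K N Y)"
    using her KK(1,3) ne unfolding heredity_def by blast
  then show ?thesis
    using KK(1,2) parent unfolding oracle_candidates_def candidates_def by (auto split: if_splits)
qed

text \<open>Up to the first wrong decision the candidates of the procedure are the oracle
  candidates, so correct decisions on the latter determine the whole run.\<close>

lemma screen_eq:
  assumes her: "heredity strong K N Y"
    and sel: "\<And>d KK. d \<in> {1..K} \<Longrightarrow> KK \<in> oracle_candidates strong K N Y d \<Longrightarrow>
      \<bar>th KK / sh KK\<bar> \<ge> threshold (alpha d) (card (oracle_candidates strong K N Y d)) \<longleftrightarrow> tau K N Y KK \<noteq> 0"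
  shows "d \<le> K \<Longrightarrow> screen strong K alpha th sh d = prefix_model K N Y d"
proof (induction d)
  case 0
  then show ?case by (auto simp: prefix_model_def Mstar_upto_def)
next
  case (Suc d)
  then have IH: "screen strong K alpha th sh d = prefix_model K N Y d" by simp
  let ?C = "oracle_candidates strong K N Y (Suc d)"
  have C: "candidates strong K (prefix_model K N Y d) (Suc d) = ?C" by (simp add: oracle_candidates_def)
  have "screen strong K alpha th sh (Suc d) =
      prefix_model K N Y d \<union> {KK \<in> ?C. \<bar>th KK / sh KK\<bar> \<ge> threshold (alpha (Suc d)) (card ?C)}"
    by (simp only: screen.simps IH C Let_def threshold_def)
  also have "{KK \<in> ?C. \<bar>th KK / sh KK\<bar> \<ge> threshold (alpha (Suc d)) (card ?C)} = {KK \<in> ?C. tau K N Y KK \<noteq> 0}"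
    using sel[of "Suc d"] Suc.prems by auto
  also have "\<dots> = {KK. KK \<subseteq> {..<K} \<and> card KK = Suc d \<and> tau K N Y KK \<noteq> 0}"
    using heredity_oracle_candidates[OF her, of _ d] oracle_candidates_subset[of strong K N Y "Suc d"] by auto
  also have "prefix_model K N Y d \<union> \<dots> = prefix_model K N Y (Suc d)"
    by (auto simp: prefix_model_def Mstar_upto_iff)
  finally show ?case .
qed

context factorial_experiment
begin

lemma tauhat_diff:
  "tauhat K N Nz Y Z KK - tau K N Y KK = (\<Sum>z\<in>TT. (geff KK z / Qnum K) * (Yhat N Nz Y Z z - Yb z))"
  by (simp add: tauhat_def tau_def sum_distrib_left right_diff_distrib sum_subtractf)

lemma sum_fstar_Ybar: "(\<Sum>z\<in>TT. fstar K N Y f z * Yb z) = gamma K N Y f"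
  unfolding fstar_def gamma_def
proof (rule proj_preserves_inner[OF Mstar_subset])
  fix KK assume "KK \<in> Pow {..<K} - Mstar K N Y"
  then have "tau K N Y KK = 0" using tau_nonzero_imp_Mstar by blast
  then show "(\<Sum>z\<in>TT. geff KK z * Yb z) = 0" using Qnum_pos[of K] by (simp add: tau_def)
qed

lemma gammaR_hat_diff:
  assumes "Mhat strong K N Nz Y alpha Z = Mstar K N Y"
  shows "gammaR_hat strong K N Nz Y alpha f Z - gamma K N Y f =
    (\<Sum>z\<in>TT. fstar K N Y f z * (Yhat N Nz Y Z z - Yb z))"
  unfolding gammaR_hat_def assms fstar_def[symmetric] sum_fstar_Ybar[symmetric]
  by (simp add: right_diff_distrib sum_subtractf)

end

section \<open>Bounds for one experiment, with constants depending only on (C1) and (C3)\<close>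

locale regular_experiment = factorial_experiment K N Nz Y
  for K N Nz Y +
  fixes n0 cl cu \<sigma> \<Delta> M :: real
  assumes cl_pos: "0 < cl" and n0_pos: "0 < n0" and K_ge2: "2 \<le> K"
    and Nz_bounds: "z \<in> TT \<Longrightarrow> cl * n0 \<le> real (Nz z) \<and> real (Nz z) \<le> cu * n0"
    and S_pos: "z \<in> TT \<Longrightarrow> S z z > 0"
    and cond: "cond_number_le K (corrY N Nz Y) (\<sigma>\<^sup>2)"
    and fourth: "z \<in> TT \<Longrightarrow> (\<Sum>i<N. (Y i z - Yb z) ^ 4) / real N \<le> \<Delta> ^ 4"
    and dev: "i < N \<Longrightarrow> z \<in> TT \<Longrightarrow> \<bar>Y i z - Yb z\<bar> / sqrt (Min ((\<lambda>z'. S z' z') ` TT)) \<le> M"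
begin

abbreviation "Q \<equiv> Qnum K"

definition s0 :: real where "s0 = Min ((\<lambda>z'. S z' z') ` TT)"

text \<open>Mean of the squared \<open>sigmahat\<close>, formed with \<open>DY\<close> in place of
  \<open>VY\<close>. It dominates the true variance of every estimated effect, the direction needed
  for false positives.\<close>

definition v :: real where "v = (\<Sum>z\<in>TT. S z z / real (Nz z)) / Q\<^sup>2"

text \<open>Divided by N, the constants bound: \<open>\<kappa>\<^sub>1\<close> the change per arm of
  the relative variance estimator, \<open>\<kappa>\<^sub>3\<close> the scores of a raw effect,
  \<open>\<kappa>\<^sub>4\<close> the variance \<open>v\<close>, and \<open>\<kappa>\<^sub>5\<close>
  times the model size the squared standardised scores of \<open>fstar\<close>. Divided by sqrt N,
  \<open>\<kappa>\<^sub>2\<close> bounds the scores of an effect standardised by sqrt v. The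
  summands 1 make positivity immediate.\<close>

definition \<kappa>\<^sub>1 :: real where "\<kappa>\<^sub>1 = 8 * (M\<^sup>2 + 1) * cu\<^sup>2 / cl\<^sup>2"
definition \<kappa>\<^sub>2 :: real where "\<kappa>\<^sub>2 = (\<bar>M\<bar> + 1) * cu / cl"
definition \<kappa>\<^sub>3 :: real where "\<kappa>\<^sub>3 = 2 * (\<bar>M\<bar> + 1) * (\<bar>\<Delta>\<bar> + 1) * cu / cl"
definition \<kappa>\<^sub>4 :: real where "\<kappa>\<^sub>4 = 2 * \<Delta>\<^sup>2 * cu / cl"
definition \<kappa>\<^sub>5 :: real where "\<kappa>\<^sub>5 = 2 * (M\<^sup>2 + 1) * \<sigma>\<^sup>2 * cu ^ 3 / cl ^ 3"

lemma cl_le_cu: "cl \<le> cu"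
proof -
  obtain z where "z \<in> TT" using treatments_nonempty[of K] by blast
  then have "cl * n0 \<le> cu * n0" using Nz_bounds by fastforce
  then show ?thesis using n0_pos by simp
qed

lemma cu_pos: "0 < cu" using cl_le_cu cl_pos by linarith

lemma N_upper: "real N \<le> cu * n0 * Q"
proof -
  have "real N = (\<Sum>z\<in>TT. real (Nz z))" using Nz_sum by (simp flip: of_nat_sum)
  also have "\<dots> \<le> (\<Sum>z\<in>TT. cu * n0)" by (intro sum_mono) (use Nz_bounds in auto)
  finally show ?thesis by (simp add: card_treatments mult_ac)
qed

lemma N_pos: "0 < real N" using N_ge2 by linarith

text \<open>Comparable arm sizes make Q * n0 of order N; the rates in N below enter through this
  inequality.\<close>

lemma inverse_Qn0: "1 / (Q * n0) \<le> cu / real N"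
  using N_upper N_pos n0_pos Qnum_pos[of K] by (simp add: field_simps)

lemma s0_pos: "0 < s0"
  unfolding s0_def using S_pos treatments_nonempty[of K] by (subst Min_gr_iff) auto

lemma s0_le: "z \<in> TT \<Longrightarrow> s0 \<le> S z z"
  unfolding s0_def by (intro Min_le) auto

lemma M_nonneg: "0 \<le> M"
proof -
  obtain z where "z \<in> TT" using treatments_nonempty[of K] by blast
  moreover have "0 < N" using N_ge2 by simp
  ultimately have "\<bar>Y 0 z - Yb z\<bar> / sqrt s0 \<le> M" using dev[of 0 z] by (simp add: s0_def)
  moreover have "0 \<le> \<bar>Y 0 z - Yb z\<bar> / sqrt s0" using s0_pos by simp
  ultimately show ?thesis by linarith
qed

lemma dev_le: "i < N \<Longrightarrow> z \<in> TT \<Longrightarrow> \<bar>Y i z - Yb z\<bar> \<le> M * sqrt s0"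
  using dev[of i z] s0_pos unfolding s0_def[symmetric] by (simp add: pos_divide_le_eq)

lemma S_le: assumes z: "z \<in> TT" shows "S z z \<le> 2 * \<Delta>\<^sup>2"
proof -
  define T where "T = (\<Sum>i<N. (Y i z - Yb z)\<^sup>2)"
  have T0: "0 \<le> T" unfolding T_def by (intro sum_nonneg) auto
  have "T\<^sup>2 = (\<Sum>i<N. 1 * (Y i z - Yb z)\<^sup>2)\<^sup>2" by (simp add: T_def)
  also have "\<dots> \<le> (\<Sum>i<N. 1\<^sup>2) * (\<Sum>i<N. ((Y i z - Yb z)\<^sup>2)\<^sup>2)" by (rule Cauchy_Schwarz_ineq_sum)
  also have "\<dots> = real N * (\<Sum>i<N. (Y i z - Yb z) ^ 4)" by simp
  also have "\<dots> \<le> real N * (real N * \<Delta> ^ 4)"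
    using fourth[OF z] N_pos by (intro mult_left_mono) (auto simp: pos_divide_le_eq mult.commute)
  also have "\<dots> = (real N * \<Delta>\<^sup>2)\<^sup>2" by (simp add: power_mult_distrib power2_eq_square power4_eq_xxxx)
  finally have "T \<le> real N * \<Delta>\<^sup>2" using N_pos by (rule_tac power2_le_imp_le) auto
  also have "\<dots> \<le> (2 * \<Delta>\<^sup>2) * (real N - 1)"
  proof -
    have "real N \<le> 2 * (real N - 1)" using N_ge2 by (simp add: right_diff_distrib)
    then have "\<Delta>\<^sup>2 * real N \<le> \<Delta>\<^sup>2 * (2 * (real N - 1))" by (intro mult_left_mono) auto
    then show ?thesis by (simp only: mult_ac)
  qed
  finally show ?thesis
    unfolding Spop_def using N_ge2 by (simp add: T_def power2_eq_square pos_divide_le_eq)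
qed

lemma s0_le_Delta: "s0 \<le> 2 * \<Delta>\<^sup>2"
  using s0_le S_le treatments_nonempty[of K] by fastforce

lemma v_lower: "s0 / (cu * n0 * Q) \<le> v"
proof -
  have "(\<Sum>z\<in>TT. s0 / (cu * n0)) \<le> (\<Sum>z\<in>TT. S z z / real (Nz z))"
    by (intro sum_mono frac_le) (use s0_le s0_pos Nz_bounds Nz_pos S_pos in \<open>auto intro: less_imp_le\<close>)
  then have "Q * (s0 / (cu * n0)) / Q\<^sup>2 \<le> v"
    unfolding v_def by (intro divide_right_mono) (auto simp: card_treatments)
  then show ?thesis using Qnum_pos[of K] by (simp add: power2_eq_square field_simps)
qed

lemma v_pos: "0 < v"
  by (rule less_le_trans[OF _ v_lower]) (use s0_pos cu_pos n0_pos Qnum_pos[of K] in simp)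

lemma v_upper: "v \<le> \<kappa>\<^sub>4 / real N"
proof -
  have "(\<Sum>z\<in>TT. S z z / real (Nz z)) \<le> (\<Sum>z\<in>TT. 2 * \<Delta>\<^sup>2 / (cl * n0))"
    by (intro sum_mono frac_le) (use S_le Nz_bounds cl_pos n0_pos in auto)
  also have "\<dots> = Q * (2 * \<Delta>\<^sup>2 / (cl * n0))" by (simp add: card_treatments)
  finally have "v \<le> Q * (2 * \<Delta>\<^sup>2 / (cl * n0)) / Q\<^sup>2"
    unfolding v_def by (intro divide_right_mono) auto
  also have "\<dots> = 2 * \<Delta>\<^sup>2 / cl * (1 / (Q * n0))" using Qnum_pos[of K] by (simp add: power2_eq_square)
  also have "\<dots> \<le> 2 * \<Delta>\<^sup>2 / cl * (cu / real N)"
    using cl_pos by (intro mult_left_mono inverse_Qn0) auto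
  finally show ?thesis by (simp add: \<kappa>\<^sub>4_def)
qed

lemma sigmahat_eq:
  "sigmahat K N Nz Y Z KK = sqrt (\<Sum>z\<in>TT. (1 / (Q\<^sup>2 * real (Nz z))) * Shat N Nz Y Z z)"
  unfolding sigmahat_def quad_Vhat
  by (simp add: power2_eq_square sum_distrib_left)

lemma weighted_Shat_tail:
  assumes W: "W > 0" "\<And>z. z \<in> TT \<Longrightarrow> \<bar>w z\<bar> * (4 * (M * sqrt s0)\<^sup>2 / real (Nz z)) \<le> W / real N"
    and \<epsilon>: "\<epsilon> > 0"
  shows "prob (\<lambda>Z. \<bar>(\<Sum>z\<in>TT. w z * Shat N Nz Y Z z) - (\<Sum>z\<in>TT. w z * S z z)\<bar> \<ge> \<epsilon>)
    \<le> 2 * exp (- (\<epsilon>\<^sup>2 * real N / (16 * W\<^sup>2)))"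
proof -
  have "prob (\<lambda>Z. \<bar>(\<Sum>z\<in>TT. w z * Shat N Nz Y Z z) - avg Om (\<lambda>Z. \<Sum>z\<in>TT. w z * Shat N Nz Y Z z)\<bar> \<ge> \<epsilon>)
    \<le> 2 * exp (- (\<epsilon>\<^sup>2 / (4 * NN * (2 * (W / real N))\<^sup>2)))"
  proof (rule bounded_differences_tail)
    fix Z k l assume "Z \<in> Om" "k \<in> {..<N}" "l \<in> {..<N}"
    then show "\<bar>(\<Sum>z\<in>TT. w z * Shat N Nz Y Z z) - (\<Sum>z\<in>TT. w z * Shat N Nz Y (swp k l Z) z)\<bar> \<le> 2 * (W / real N)"
      by (intro weighted_Shat_swp[where R = "M * sqrt s0"] dev_le W) auto
  qed (use W \<epsilon> N_pos in auto)
  moreover have "\<epsilon>\<^sup>2 / (4 * NN * (2 * (W / real N))\<^sup>2) = \<epsilon>\<^sup>2 * real N / (16 * W\<^sup>2)"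
    using N_pos by (simp add: power2_eq_square field_simps)
  ultimately show ?thesis by (simp only: avg_weighted_Shat)
qed

lemma \<kappa>_pos: "0 < \<kappa>\<^sub>1" "0 < \<kappa>\<^sub>2" "0 < \<kappa>\<^sub>3"
  using cl_pos cu_pos by (auto simp: \<kappa>\<^sub>1_def \<kappa>\<^sub>2_def \<kappa>\<^sub>3_def intro!: divide_pos_pos mult_pos_pos add_nonneg_pos)

text \<open>The relative error is a weighted sum of arm variances with weights normalised to mean 1.
  Pooling makes it concentrate although a single arm may hold two units, and s0 cancels between the
  deviation bound and \<open>v_lower\<close>.\<close>

lemma sigmahat_tail:
  assumes \<eta>: "\<eta> > 0"
  shows "prob (\<lambda>Z. \<bar>(sigmahat K N Nz Y Z KK)\<^sup>2 - v\<bar> \<ge> \<eta> * v) \<le> 2 * exp (- (\<eta>\<^sup>2 * real N / (16 * \<kappa>\<^sub>1\<^sup>2)))"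
proof -
  define w where "w z = 1 / (Q\<^sup>2 * real (Nz z) * v)" for z
  have Sh0: "0 \<le> Shat N Nz Y Z z" if "z \<in> TT" for Z z
    unfolding Shat_def using Nz_ge2[OF that] by (intro divide_nonneg_nonneg sum_nonneg) auto
  have s2: "(sigmahat K N Nz Y Z KK)\<^sup>2 = v * (\<Sum>z\<in>TT. w z * Shat N Nz Y Z z)" for Z
  proof -
    have "(sigmahat K N Nz Y Z KK)\<^sup>2 = (\<Sum>z\<in>TT. (1 / (Q\<^sup>2 * real (Nz z))) * Shat N Nz Y Z z)"
      unfolding sigmahat_eq by (intro real_sqrt_pow2 sum_nonneg mult_nonneg_nonneg Sh0) auto
    also have "\<dots> = v * (\<Sum>z\<in>TT. w z * Shat N Nz Y Z z)"
      unfolding sum_distrib_left w_def using v_pos by (intro sum.cong) auto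
    finally show ?thesis .
  qed
  have one: "(\<Sum>z\<in>TT. w z * S z z) = 1"
  proof -
    have "(\<Sum>z\<in>TT. w z * S z z) = (\<Sum>z\<in>TT. (S z z / real (Nz z)) / Q\<^sup>2) / v"
      unfolding sum_divide_distrib w_def by (intro sum.cong) auto
    also have "\<dots> = v / v" by (simp add: v_def sum_divide_distrib)
    finally show ?thesis using v_pos by simp
  qed
  have "prob (\<lambda>Z. \<bar>(\<Sum>z\<in>TT. w z * Shat N Nz Y Z z) - (\<Sum>z\<in>TT. w z * S z z)\<bar> \<ge> \<eta>)
    \<le> 2 * exp (- (\<eta>\<^sup>2 * real N / (16 * \<kappa>\<^sub>1\<^sup>2)))"
  proof (rule weighted_Shat_tail[OF \<kappa>_pos(1) _ \<eta>])
    fix z assume z: "z \<in> TT"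
    have nz: "cl * n0 \<le> real (Nz z)" "0 < real (Nz z)" using Nz_bounds Nz_pos z by auto
    have c0: "0 < cl * n0" using cl_pos n0_pos by simp
    have "\<bar>w z\<bar> * (4 * (M * sqrt s0)\<^sup>2 / real (Nz z)) = 4 * M\<^sup>2 * s0 / (Q\<^sup>2 * real (Nz z) * v * real (Nz z))"
      using s0_pos v_pos by (simp add: w_def power_mult_distrib)
    also have "\<dots> \<le> 4 * M\<^sup>2 * s0 / (Q\<^sup>2 * (cl * n0) * (s0 / (cu * n0 * Q)) * (cl * n0))"
    proof (rule frac_le)
      show "0 < Q\<^sup>2 * (cl * n0) * (s0 / (cu * n0 * Q)) * (cl * n0)"
        using s0_pos cl_pos cu_pos n0_pos Qnum_pos[of K] by simp
      show "Q\<^sup>2 * (cl * n0) * (s0 / (cu * n0 * Q)) * (cl * n0) \<le> Q\<^sup>2 * real (Nz z) * v * real (Nz z)"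
        using nz(1) v_lower s0_pos cl_pos cu_pos n0_pos v_pos Qnum_pos[of K] by (intro mult_mono) auto
    qed (use s0_pos in auto)
    also have "\<dots> = 4 * M\<^sup>2 * cu / cl\<^sup>2 * (1 / (Q * n0))"
      using s0_pos c0 cu_pos n0_pos Qnum_pos[of K] by (simp add: field_simps power2_eq_square)
    also have "\<dots> \<le> 4 * M\<^sup>2 * cu / cl\<^sup>2 * (cu / real N)"
      using cu_pos by (intro mult_left_mono inverse_Qn0) auto
    also have "\<dots> = (4 * M\<^sup>2) * (cu\<^sup>2 / cl\<^sup>2) / real N" by (simp add: power2_eq_square)
    also have "\<dots> \<le> (8 * (M\<^sup>2 + 1)) * (cu\<^sup>2 / cl\<^sup>2) / real N"
      by (intro divide_right_mono mult_right_mono) auto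
    also have "\<dots> = \<kappa>\<^sub>1 / real N" by (simp add: \<kappa>\<^sub>1_def)
    finally show "\<bar>w z\<bar> * (4 * (M * sqrt s0)\<^sup>2 / real (Nz z)) \<le> \<kappa>\<^sub>1 / real N" .
  qed
  moreover have "\<bar>(sigmahat K N Nz Y Z KK)\<^sup>2 - v\<bar> \<ge> \<eta> * v \<longleftrightarrow>
      \<bar>(\<Sum>z\<in>TT. w z * Shat N Nz Y Z z) - (\<Sum>z\<in>TT. w z * S z z)\<bar> \<ge> \<eta>" for Z
  proof -
    have "(sigmahat K N Nz Y Z KK)\<^sup>2 - v = v * ((\<Sum>z\<in>TT. w z * Shat N Nz Y Z z) - 1)"
      by (simp add: s2 right_diff_distrib)
    then have "\<bar>(sigmahat K N Nz Y Z KK)\<^sup>2 - v\<bar> = \<bar>(\<Sum>z\<in>TT. w z * Shat N Nz Y Z z) - 1\<bar> * v"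
      using v_pos by (simp add: abs_mult)
    then show ?thesis unfolding one using v_pos by simp
  qed
  ultimately show ?thesis by simp
qed

text \<open>The constant is not sharp, which suffices for detection because signals exceed the noise
  by a power of N.\<close>

lemma tauhat_tail:
  assumes \<epsilon>: "\<epsilon> > 0"
  shows "prob (\<lambda>Z. \<bar>tauhat K N Nz Y Z KK - tau K N Y KK\<bar> \<ge> \<epsilon>) \<le> 2 * exp (- (\<epsilon>\<^sup>2 * real N / (64 * \<kappa>\<^sub>3\<^sup>2)))"
proof -
  let ?f = "\<lambda>z. geff KK z / Q"
  let ?a = "\<lambda>i z. ?f z * (Y i z - Yb z) / (real (Nz z) * 1)"
  have lin: "linear_statistic {..<N} TT Nz ?a (\<kappa>\<^sub>3 / real N)"
  proof (rule linear_statistic_contrast)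
    fix i z assume iz: "i < N" "z \<in> TT"
    have nz: "cl * n0 \<le> real (Nz z)" using Nz_bounds iz by auto
    have c0: "0 < cl * n0" using cl_pos n0_pos by simp
    have "sqrt s0 \<le> sqrt (2\<^sup>2 * (\<bar>\<Delta>\<bar> + 1)\<^sup>2)"
    proof (intro real_sqrt_le_mono)
      have "\<bar>\<Delta>\<bar>\<^sup>2 \<le> (\<bar>\<Delta>\<bar> + 1)\<^sup>2" by (intro power_mono) auto
      then have "s0 \<le> 4 * (\<bar>\<Delta>\<bar> + 1)\<^sup>2"
        using s0_le_Delta zero_le_power2[of "\<bar>\<Delta>\<bar> + 1"] unfolding power2_abs by linarith
      then show "s0 \<le> 2\<^sup>2 * (\<bar>\<Delta>\<bar> + 1)\<^sup>2" by simp
    qed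
    then have sq: "sqrt s0 \<le> 2 * (\<bar>\<Delta>\<bar> + 1)" by (simp add: real_sqrt_mult)
    have "\<bar>?f z * (Y i z - Yb z)\<bar> / (real (Nz z) * 1) = \<bar>Y i z - Yb z\<bar> / (Q * real (Nz z))"
      using Qnum_pos[of K] by (simp add: abs_mult)
    also have "\<dots> \<le> (M * sqrt s0) / (Q * (cl * n0))"
      using dev_le[OF iz] nz c0 cl_pos n0_pos Qnum_pos[of K] by (intro frac_le mult_left_mono mult_pos_pos) auto
    also have "\<dots> \<le> ((\<bar>M\<bar> + 1) * (2 * (\<bar>\<Delta>\<bar> + 1))) / (Q * (cl * n0))"
      using sq c0 s0_pos M_nonneg Qnum_pos[of K] by (intro divide_right_mono mult_mono) auto
    also have "\<dots> = ((\<bar>M\<bar> + 1) * (2 * (\<bar>\<Delta>\<bar> + 1))) / cl * (1 / (Q * n0))" by simp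
    also have "\<dots> \<le> ((\<bar>M\<bar> + 1) * (2 * (\<bar>\<Delta>\<bar> + 1))) / cl * (cu / real N)"
      using cl_pos by (intro mult_left_mono inverse_Qn0) auto
    also have "\<dots> = \<kappa>\<^sub>3 / real N"
    proof -
      have "a * (2 * b) / cl * (cu / real N) = 2 * a * b * cu / cl / real N" for a b :: real by simp
      then show ?thesis unfolding \<kappa>\<^sub>3_def .
    qed
    finally show "\<bar>?f z * (Y i z - Yb z)\<bar> / (real (Nz z) * 1) \<le> \<kappa>\<^sub>3 / real N" .
  qed (use \<kappa>_pos N_pos in auto)
  interpret L: linear_statistic "{..<N}" TT Nz ?a "\<kappa>\<^sub>3 / real N" by (rule lin)
  have "prob (\<lambda>Z. \<bar>tauhat K N Nz Y Z KK - tau K N Y KK\<bar> \<ge> \<epsilon>) \<le> prob (\<lambda>Z. \<bar>L.X Z\<bar> \<ge> \<epsilon>)"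
    by (rule prob_mono) (simp only: X_contrast[OF lin] tauhat_diff div_by_1)
  also have "\<dots> \<le> 2 * exp (- (\<epsilon>\<^sup>2 / (64 * NN * (\<kappa>\<^sub>3 / real N)\<^sup>2)))"
    by (rule L.abs_X_tail[OF \<epsilon>])
  also have "\<epsilon>\<^sup>2 / (64 * NN * (\<kappa>\<^sub>3 / real N)\<^sup>2) = \<epsilon>\<^sup>2 * real N / (64 * \<kappa>\<^sub>3\<^sup>2)"
    using N_pos by (simp add: power2_eq_square field_simps)
  finally show ?thesis .
qed

lemma standardized_contrast_le:
  assumes "\<bar>e\<bar> = 1" "i < N" "z \<in> TT"
  shows "\<bar>(e * geff KK z / Q) * (Y i z - Yb z)\<bar> / (real (Nz z) * sqrt v) \<le> \<kappa>\<^sub>2 / sqrt (real N)"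
proof -
  have nz: "cl * n0 \<le> real (Nz z)" using Nz_bounds assms by auto
  have c0: "0 < cl * n0" using cl_pos n0_pos by simp
  have Qp: "0 < Q" by (rule Qnum_pos)
  have sv: "sqrt s0 / sqrt (cu * n0 * Q) \<le> sqrt v"
    using real_sqrt_le_mono[OF v_lower] by (simp add: real_sqrt_divide)
  have "\<bar>(e * geff KK z / Q) * (Y i z - Yb z)\<bar> / (real (Nz z) * sqrt v) = \<bar>Y i z - Yb z\<bar> / (Q * real (Nz z) * sqrt v)"
    using Qp assms(1) by (simp add: abs_mult)
  also have "\<dots> \<le> (M * sqrt s0) / (Q * (cl * n0) * (sqrt s0 / sqrt (cu * n0 * Q)))"
    using dev_le[OF assms(2,3)] nz sv c0 Qp s0_pos cu_pos n0_pos cl_pos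
    by (intro frac_le mult_mono mult_pos_pos divide_pos_pos) auto
  also have "\<dots> = M / cl * (sqrt (cu * n0 * Q) / (n0 * Q))"
    using s0_pos by simp
  also have "\<dots> \<le> M / cl * (cu / sqrt (real N))"
  proof (intro mult_left_mono)
    have "sqrt (cu * n0 * Q) * sqrt (cu * n0 * Q) = cu * n0 * Q"
      using cu_pos n0_pos Qp by simp
    moreover have "sqrt (real N) \<le> sqrt (cu * n0 * Q)" using N_upper by (rule real_sqrt_le_mono)
    then have "sqrt (cu * n0 * Q) * sqrt (real N) \<le> sqrt (cu * n0 * Q) * sqrt (cu * n0 * Q)"
      using cu_pos n0_pos Qp by (intro mult_left_mono) auto
    ultimately have "sqrt (cu * n0 * Q) * sqrt (real N) \<le> cu * (n0 * Q)" by simp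
    then show "sqrt (cu * n0 * Q) / (n0 * Q) \<le> cu / sqrt (real N)"
      using n0_pos Qp N_pos by (simp add: divide_le_eq pos_le_divide_eq)
  qed (use cl_pos M_nonneg in auto)
  also have "\<dots> = (M * (cu / cl)) / sqrt (real N)" by simp
  also have "\<dots> \<le> ((\<bar>M\<bar> + 1) * (cu / cl)) / sqrt (real N)"
    using cu_pos cl_pos N_pos by (intro divide_right_mono mult_right_mono) auto
  also have "\<dots> = \<kappa>\<^sub>2 / sqrt (real N)" by (simp add: \<kappa>\<^sub>2_def)
  finally show ?thesis .
qed

lemma quad_DY_geff:
  assumes "\<bar>e\<bar> = 1"
  shows "quad K (DY N Nz Y) (\<lambda>z. e * geff KK z / Q) = v"
proof -
  have "(e * geff KK z / Q)\<^sup>2 = 1 / Q\<^sup>2" for z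
    using power2_abs[of "e * geff KK z / Q"] assms by (simp add: abs_mult power_divide)
  then show ?thesis by (simp add: quad_DY v_def sum_divide_distrib mult.commute)
qed

text \<open>Standardised by sqrt v the variance is at most 1, as \<open>VY\<close> is dominated by
  \<open>DY\<close>. The sharp tail is used with \<theta> = t at level (1 - \<eta>) t, where 1 -
  \<eta> leaves room for the error of \<open>sigmahat\<close>; the exponents combine to - (1 -
  4\<eta>) t^2 / 2. The sign e gives both tails.\<close>

lemma null_effect_tail:
  assumes tau0: "tau K N Y KK = 0" and \<eta>: "0 < \<eta>" and t: "0 \<le> t"
    and small: "4 * \<kappa>\<^sub>2\<^sup>2 * exp (t * (\<kappa>\<^sub>2 * sqrt (real N)) - \<eta>\<^sup>2 * real N / (1024 * \<kappa>\<^sub>2 ^ 4)) \<le> \<eta>"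
  shows "prob (\<lambda>Z. \<bar>tauhat K N Nz Y Z KK\<bar> \<ge> (1 - \<eta>) * t * sqrt v) \<le> 2 * exp (- ((1 - 4 * \<eta>) * t\<^sup>2 / 2))"
proof -
  have one: "prob (\<lambda>Z. e * tauhat K N Nz Y Z KK \<ge> (1 - \<eta>) * t * sqrt v) \<le> exp (- ((1 - 4 * \<eta>) * t\<^sup>2 / 2))"
    if e: "\<bar>e\<bar> = 1" for e
  proof -
    let ?f = "\<lambda>z. e * geff KK z / Q"
    let ?a = "\<lambda>i z. ?f z * (Y i z - Yb z) / (real (Nz z) * sqrt v)"
    let ?B = "\<kappa>\<^sub>2 / sqrt (real N)"
    have sv: "sqrt v > 0" using v_pos by simp
    have lin: "linear_statistic {..<N} TT Nz ?a ?B"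
      by (rule linear_statistic_contrast[OF sv]) (use \<kappa>_pos N_pos standardized_contrast_le[OF e] in auto)
    interpret L: linear_statistic "{..<N}" TT Nz ?a ?B by (rule lin)
    have X: "L.X Z = e * tauhat K N Nz Y Z KK / sqrt v" if "Z \<in> Om" for Z
    proof -
      have "L.X Z = (\<Sum>z\<in>TT. ?f z * (Yhat N Nz Y Z z - Yb z)) / sqrt v" by (rule X_contrast[OF lin that])
      also have "(\<Sum>z\<in>TT. ?f z * (Yhat N Nz Y Z z - Yb z)) = e * (tauhat K N Nz Y Z KK - tau K N Y KK)"
        unfolding tauhat_diff sum_distrib_left by (intro sum.cong) auto
      finally show ?thesis using tau0 by simp
    qed
    have var: "avg Om (\<lambda>Z. (L.X Z)\<^sup>2) \<le> 1"
    proof -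
      have "avg Om (\<lambda>Z. (L.X Z)\<^sup>2) = quad K (VY N Nz Y) ?f / (sqrt v)\<^sup>2"
        by (rule variance_contrast[OF lin sv])
      also have "\<dots> \<le> v / v"
        using quad_VY_le_DY[of ?f] v_pos unfolding quad_DY_geff[OF e] by (simp add: divide_right_mono)
      finally show ?thesis using v_pos by simp
    qed
    have "prob (\<lambda>Z. e * tauhat K N Nz Y Z KK \<ge> (1 - \<eta>) * t * sqrt v) \<le> prob (\<lambda>Z. L.X Z \<ge> (1 - \<eta>) * t)"
    proof (rule prob_mono)
      fix Z assume Z: "Z \<in> Om" and "e * tauhat K N Nz Y Z KK \<ge> (1 - \<eta>) * t * sqrt v"
      then show "L.X Z \<ge> (1 - \<eta>) * t" unfolding X[OF Z] by (simp only: pos_le_divide_eq[OF sv])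
    qed
    also have "\<dots> \<le> exp ((1 + 2 * \<eta>) * t\<^sup>2 / 2 - t * ((1 - \<eta>) * t))"
    proof (rule L.tail_le[OF var \<eta> t])
      have e1: "4 * NN * ?B\<^sup>2 = 4 * \<kappa>\<^sub>2\<^sup>2" using N_pos by (simp add: power_divide)
      have e2: "NN * ?B = \<kappa>\<^sub>2 * sqrt (real N)" using N_pos by (simp add: real_div_sqrt field_simps)
      have e3: "4 * NN * (16 * ?B\<^sup>2)\<^sup>2 = 1024 * \<kappa>\<^sub>2 ^ 4 / real N"
        using N_pos by (simp add: power_divide power_mult_distrib power2_eq_square power4_eq_xxxx)
      have e4: "\<eta>\<^sup>2 / (1024 * \<kappa>\<^sub>2 ^ 4 / real N) = \<eta>\<^sup>2 * real N / (1024 * \<kappa>\<^sub>2 ^ 4)" by simp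
      show "4 * NN * ?B\<^sup>2 * exp (t * (NN * ?B) - \<eta>\<^sup>2 / (4 * NN * (16 * ?B\<^sup>2)\<^sup>2)) \<le> \<eta>"
        unfolding e1 e2 e3 e4 by (rule small)
    qed
    also have "(1 + 2 * \<eta>) * t\<^sup>2 / 2 - t * ((1 - \<eta>) * t) = - ((1 - 4 * \<eta>) * t\<^sup>2 / 2)"
      by (simp add: power2_eq_square field_simps)
    finally show ?thesis .
  qed
  have "prob (\<lambda>Z. \<bar>tauhat K N Nz Y Z KK\<bar> \<ge> (1 - \<eta>) * t * sqrt v) \<le>
      prob (\<lambda>Z. 1 * tauhat K N Nz Y Z KK \<ge> (1 - \<eta>) * t * sqrt v \<or> -1 * tauhat K N Nz Y Z KK \<ge> (1 - \<eta>) * t * sqrt v)"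
    by (rule prob_mono) linarith
  also have "\<dots> \<le> exp (- ((1 - 4 * \<eta>) * t\<^sup>2 / 2)) + exp (- ((1 - 4 * \<eta>) * t\<^sup>2 / 2))"
    by (rule order_trans[OF prob_disj_le add_mono[OF one one]]) auto
  finally show ?thesis by simp
qed

text \<open>A wrong selection needs one of three events: the pooled variance estimate is off (E1),
  some true effect is misestimated by half the signal (E2), or some null oracle candidate passes its
  reduced threshold (E3). \<open>detect\<close> places every threshold below half the
  signal.\<close>

lemma Mhat_ne_Mstar_prob:
  fixes strong :: bool and alpha :: "nat \<Rightarrow> real"
  defines "C \<equiv> oracle_candidates strong K N Y"
  defines "thr \<equiv> \<lambda>d. threshold (alpha d) (card (C d))"
  assumes her: "heredity strong K N Y" and \<eta>: "0 < \<eta>" "\<eta> < 1"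
    and thr: "\<And>d. d \<in> {1..K} \<Longrightarrow> C d \<noteq> {} \<Longrightarrow> 0 < thr d \<and> thr d \<le> tmax" and tmax: "0 \<le> tmax"
    and signal: "\<And>KK. KK \<in> Mstar_upto K N Y K \<Longrightarrow> L \<le> \<bar>tau K N Y KK\<bar>" and L: "0 < L"
    and detect: "tmax * sqrt (2 * (\<kappa>\<^sub>4 / real N)) \<le> L / 2"
    and small: "4 * \<kappa>\<^sub>2\<^sup>2 * exp (tmax * (\<kappa>\<^sub>2 * sqrt (real N)) - \<eta>\<^sup>2 * real N / (1024 * \<kappa>\<^sub>2 ^ 4)) \<le> \<eta>"
  shows "prob (\<lambda>Z. Mhat strong K N Nz Y alpha Z \<noteq> Mstar K N Y) \<le>
    2 * exp (- (\<eta>\<^sup>2 * real N / (16 * \<kappa>\<^sub>1\<^sup>2)))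
    + 2 * real N * exp (- (L\<^sup>2 * real N / (256 * \<kappa>\<^sub>3\<^sup>2)))
    + (\<Sum>d\<in>{1..K}. real (card (C d)) * (2 * exp (- ((1 - 4 * \<eta>) * (thr d)\<^sup>2 / 2))))"
proof -
  define C0 where "C0 d = {KK \<in> C d. tau K N Y KK = 0}" for d
  let ?sh = "\<lambda>Z KK. sigmahat K N Nz Y Z KK" and ?th = "\<lambda>Z KK. tauhat K N Nz Y Z KK"
  let ?M = "Mstar_upto K N Y K"
  define E1 where "E1 Z \<longleftrightarrow> \<bar>(?sh Z {})\<^sup>2 - v\<bar> \<ge> \<eta> * v" for Z
  define E2 where "E2 Z \<longleftrightarrow> (\<exists>KK\<in>?M. \<bar>?th Z KK - tau K N Y KK\<bar> \<ge> L / 2)" for Z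
  define E3 where "E3 Z \<longleftrightarrow> (\<exists>d\<in>{1..K}. \<exists>KK\<in>C0 d. \<bar>?th Z KK\<bar> \<ge> (1 - \<eta>) * thr d * sqrt v)" for Z
  have finC: "finite (C d)" for d unfolding C_def by (rule finite_oracle_candidates)
  have finM: "finite ?M" and cardM: "real (card ?M) \<le> real N"
  proof -
    have sub: "?M \<subseteq> Pow {..<K}" by (auto simp: Mstar_upto_iff)
    then show "finite ?M" using finite_subset by blast
    have "real (card ?M) \<le> real (card (Pow {..<K}))" using sub by (simp add: card_mono)
    then have "real (card ?M) \<le> Q" by (simp add: card_Pow Qnum_def)
    then show "real (card ?M) \<le> real N" using N_ge Qnum_pos[of K] by linarith
  qed
  have shKK: "?sh Z KK = ?sh Z {}" for Z KK by (simp add: sigmahat_eq)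
  have good: "Mhat strong K N Nz Y alpha Z = Mstar K N Y" if g: "\<not> E1 Z" "\<not> E2 Z" "\<not> E3 Z" for Z
  proof -
    have "\<bar>(?sh Z {})\<^sup>2 - v\<bar> < \<eta> * v" using g(1) by (simp add: E1_def)
    then have lo: "(1 - \<eta>) * v \<le> (?sh Z {})\<^sup>2" and hi: "(?sh Z {})\<^sup>2 \<le> (1 + \<eta>) * v"
      by (auto simp: abs_less_iff algebra_simps)
    have sh0: "0 \<le> ?sh Z {}"
      unfolding sigmahat_eq using Nz_ge2
      by (intro real_sqrt_ge_zero sum_nonneg mult_nonneg_nonneg) (fastforce simp: Shat_def intro!: divide_nonneg_nonneg sum_nonneg)+
    have lo2: "((1 - \<eta>) * sqrt v)\<^sup>2 \<le> (1 - \<eta>) * v"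
    proof -
      have "(1 - \<eta>) * (1 - \<eta>) * v \<le> (1 - \<eta>) * 1 * v" using \<eta> v_pos by (intro mult_right_mono mult_left_mono) auto
      moreover have "((1 - \<eta>) * sqrt v)\<^sup>2 = (1 - \<eta>) * (1 - \<eta>) * v"
        using v_pos by (simp add: power_mult_distrib power2_eq_square[of "1 - \<eta>"])
      ultimately show ?thesis by simp
    qed
    have lo': "(1 - \<eta>) * sqrt v \<le> ?sh Z {}"
      by (rule power2_le_imp_le[OF order_trans[OF lo2 lo] sh0])
    have shp: "0 < ?sh Z {}" by (rule less_le_trans[OF _ lo']) (use \<eta> v_pos in simp)
    \<comment> \<open>Since \<eta> < 1, the squared \<open>sigmahat\<close> is at most twice the
      upper bound for \<open>v\<close>; this is the factor 2 in \<open>detect\<close>.\<close>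
    have "(1 + \<eta>) * v \<le> 2 * (\<kappa>\<^sub>4 / real N)"
    proof (rule mult_mono)
      show "v \<le> \<kappa>\<^sub>4 / real N" by (rule v_upper)
    qed (use \<eta> v_pos in simp_all)
    then have "sqrt ((?sh Z {})\<^sup>2) \<le> sqrt (2 * (\<kappa>\<^sub>4 / real N))" using hi by (intro real_sqrt_le_mono) linarith
    then have hi': "?sh Z {} \<le> sqrt (2 * (\<kappa>\<^sub>4 / real N))" using sh0 by simp
    have "screen strong K alpha (?th Z) (?sh Z) K = prefix_model K N Y K"
    proof (rule screen_eq[OF her _ order_refl])
      fix d KK assume d: "d \<in> {1..K}" and KK: "KK \<in> oracle_candidates strong K N Y d"
      then have KC: "KK \<in> C d" by (simp add: C_def)
      then have t: "0 < thr d" "thr d \<le> tmax" using thr[OF d] by auto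
      have KKd: "KK \<subseteq> {..<K}" "card KK = d" using KK oracle_candidates_subset[of strong K N Y d] by auto
      have "\<bar>?th Z KK / ?sh Z KK\<bar> = \<bar>?th Z KK\<bar> / ?sh Z {}" using shp by (simp add: shKK[of Z KK] abs_divide)
      then have eq: "\<bar>?th Z KK / ?sh Z KK\<bar> \<ge> thr d \<longleftrightarrow> \<bar>?th Z KK\<bar> \<ge> thr d * ?sh Z {}"
        by (simp only: pos_le_divide_eq[OF shp])
      have "\<bar>?th Z KK\<bar> \<ge> thr d * ?sh Z {} \<longleftrightarrow> tau K N Y KK \<noteq> 0"
      proof (cases "tau K N Y KK = 0")
        case True
        then have "KK \<in> C0 d" using KC by (simp add: C0_def)
        then have "\<bar>?th Z KK\<bar> < (1 - \<eta>) * thr d * sqrt v" using g(3) d unfolding E3_def by force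
        also have "\<dots> = thr d * ((1 - \<eta>) * sqrt v)" by simp
        also have "\<dots> \<le> thr d * ?sh Z {}" using lo' t by (intro mult_left_mono) auto
        finally show ?thesis using True by simp
      next
        case False
        then have KM: "KK \<in> ?M" using KKd d by (simp add: Mstar_upto_iff)
        have "\<bar>?th Z KK - tau K N Y KK\<bar> < L / 2" using g(2) KM unfolding E2_def by force
        then have "L / 2 \<le> \<bar>?th Z KK\<bar>" using signal[OF KM] by linarith
        moreover have "thr d * ?sh Z {} \<le> tmax * sqrt (2 * (\<kappa>\<^sub>4 / real N))"
          using t hi' sh0 tmax by (intro mult_mono) auto
        ultimately show ?thesis using False detect by linarith
      qed
      then show "threshold (alpha d) (card (oracle_candidates strong K N Y d)) \<le> \<bar>?th Z KK / ?sh Z KK\<bar> \<longleftrightarrow>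
          tau K N Y KK \<noteq> 0"
        using eq unfolding thr_def C_def by blast
    qed
    then show ?thesis by (simp add: Mhat_def prefix_model_def Mstar_def)
  qed
  have p1: "prob E1 \<le> 2 * exp (- (\<eta>\<^sup>2 * real N / (16 * \<kappa>\<^sub>1\<^sup>2)))"
    unfolding E1_def by (rule sigmahat_tail[OF \<eta>(1)])
  have p2: "prob E2 \<le> 2 * real N * exp (- (L\<^sup>2 * real N / (256 * \<kappa>\<^sub>3\<^sup>2)))"
  proof -
    have "prob E2 \<le> (\<Sum>KK\<in>?M. prob (\<lambda>Z. \<bar>?th Z KK - tau K N Y KK\<bar> \<ge> L / 2))"
      unfolding E2_def by (rule prob_Bex_le[OF finM])
    also have "\<dots> \<le> (\<Sum>KK\<in>?M. 2 * exp (- ((L / 2)\<^sup>2 * real N / (64 * \<kappa>\<^sub>3\<^sup>2))))"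
      using L by (intro sum_mono tauhat_tail) auto
    also have "\<dots> = real (card ?M) * (2 * exp (- (L\<^sup>2 * real N / (256 * \<kappa>\<^sub>3\<^sup>2))))"
      by (simp add: power_divide)
    also have "\<dots> \<le> real N * (2 * exp (- (L\<^sup>2 * real N / (256 * \<kappa>\<^sub>3\<^sup>2))))"
      using cardM by (intro mult_right_mono) auto
    finally show ?thesis by simp
  qed
  have p3: "prob E3 \<le> (\<Sum>d\<in>{1..K}. real (card (C d)) * (2 * exp (- ((1 - 4 * \<eta>) * (thr d)\<^sup>2 / 2))))"
  proof -
    have "prob E3 \<le> (\<Sum>d\<in>{1..K}. prob (\<lambda>Z. \<exists>KK\<in>C0 d. \<bar>?th Z KK\<bar> \<ge> (1 - \<eta>) * thr d * sqrt v))"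
      unfolding E3_def by (rule prob_Bex_le) simp
    also have "\<dots> \<le> (\<Sum>d\<in>{1..K}. real (card (C d)) * (2 * exp (- ((1 - 4 * \<eta>) * (thr d)\<^sup>2 / 2))))"
    proof (intro sum_mono)
      fix d assume d: "d \<in> {1..K}"
      have finC0: "finite (C0 d)" using finC by (simp add: C0_def)
      have "prob (\<lambda>Z. \<exists>KK\<in>C0 d. \<bar>?th Z KK\<bar> \<ge> (1 - \<eta>) * thr d * sqrt v) \<le>
          (\<Sum>KK\<in>C0 d. prob (\<lambda>Z. \<bar>?th Z KK\<bar> \<ge> (1 - \<eta>) * thr d * sqrt v))"
        by (rule prob_Bex_le[OF finC0])
      also have "\<dots> \<le> (\<Sum>KK\<in>C0 d. 2 * exp (- ((1 - 4 * \<eta>) * (thr d)\<^sup>2 / 2)))"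
      proof (intro sum_mono null_effect_tail)
        fix KK assume "KK \<in> C0 d"
        then have KC: "KK \<in> C d" and "tau K N Y KK = 0" by (auto simp: C0_def)
        then show "tau K N Y KK = 0" by simp
        have t: "0 < thr d" "thr d \<le> tmax" using thr[OF d] KC by auto
        then show "0 \<le> thr d" by simp
        have "thr d * (\<kappa>\<^sub>2 * sqrt (real N)) \<le> tmax * (\<kappa>\<^sub>2 * sqrt (real N))"
          using t \<kappa>_pos by (intro mult_right_mono) auto
        then have "4 * \<kappa>\<^sub>2\<^sup>2 * exp (thr d * (\<kappa>\<^sub>2 * sqrt (real N)) - \<eta>\<^sup>2 * real N / (1024 * \<kappa>\<^sub>2 ^ 4)) \<le>
            4 * \<kappa>\<^sub>2\<^sup>2 * exp (tmax * (\<kappa>\<^sub>2 * sqrt (real N)) - \<eta>\<^sup>2 * real N / (1024 * \<kappa>\<^sub>2 ^ 4))"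
          by (intro mult_left_mono) auto
        then show "4 * \<kappa>\<^sub>2\<^sup>2 * exp (thr d * (\<kappa>\<^sub>2 * sqrt (real N)) - \<eta>\<^sup>2 * real N / (1024 * \<kappa>\<^sub>2 ^ 4)) \<le> \<eta>"
          using small by linarith
      qed (use \<eta> in auto)
      also have "\<dots> = real (card (C0 d)) * (2 * exp (- ((1 - 4 * \<eta>) * (thr d)\<^sup>2 / 2)))" by simp
      also have "\<dots> \<le> real (card (C d)) * (2 * exp (- ((1 - 4 * \<eta>) * (thr d)\<^sup>2 / 2)))"
        using card_mono[OF finC, of "C0 d" d] by (intro mult_right_mono) (auto simp: C0_def)
      finally show "prob (\<lambda>Z. \<exists>KK\<in>C0 d. \<bar>?th Z KK\<bar> \<ge> (1 - \<eta>) * thr d * sqrt v) \<le>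
          real (card (C d)) * (2 * exp (- ((1 - 4 * \<eta>) * (thr d)\<^sup>2 / 2)))" .
    qed
    finally show ?thesis .
  qed
  have "prob (\<lambda>Z. Mhat strong K N Nz Y alpha Z \<noteq> Mstar K N Y) \<le> prob (\<lambda>Z. (E1 Z \<or> E2 Z) \<or> E3 Z)"
    by (rule prob_mono) (use good in blast)
  also have "\<dots> \<le> (prob E1 + prob E2) + prob E3"
    by (rule order_trans[OF prob_disj_le add_right_mono[OF prob_disj_le]])
  finally show ?thesis using p1 p2 p3 by linarith
qed

text \<open>The diagonal entry is S z z (1 / N(z) - 1 / N). With at least two treatments the other
  arms number at least Q / 2, which keeps N(z) / N away from 1.\<close>

lemma VY_diag_lower:
  assumes z: "z \<in> TT"
  shows "s0 * cl / (2 * cu\<^sup>2 * n0) \<le> VY N Nz Y z z"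
proof -
  obtain z' where z': "z' \<in> TT" "z' \<noteq> z"
  proof -
    have "card TT \<noteq> 1" using K_ge2 by (simp add: treatments_def card_Pow)
    then have "TT \<noteq> {z}" by auto
    then show ?thesis using z that by blast
  qed
  have "real (card (TT - {z})) = Q - 1"
    using z card_treatments[of K] Qnum_pos[of K] by (simp add: card_Diff_singleton of_nat_diff Suc_leI card_gt_0_iff treatments_nonempty)
  moreover have "(2::real) \<le> Q"
    using K_ge2 power_increasing[of 1 K "2::real"] by (simp add: Qnum_def)
  ultimately have "Q / 2 * (cl * n0) \<le> real (card (TT - {z})) * (cl * n0)"
    using cl_pos n0_pos by (intro mult_right_mono) auto
  also have "\<dots> \<le> (\<Sum>w\<in>TT - {z}. real (Nz w))"
    using Nz_bounds by (intro sum_bounded_below) auto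
  also have "\<dots> = real N - real (Nz z)"
    using Nz_sum z by (simp add: sum.remove flip: of_nat_sum)
  finally have a: "Q / 2 * (cl * n0) \<le> real N - real (Nz z)" .
  have "0 \<le> Q / 2 * (cl * n0)" using cl_pos n0_pos Qnum_pos[of K] by simp
  then have le: "real (Nz z) \<le> real N" using a by linarith
  have nz: "0 < real (Nz z)" "real (Nz z) \<le> cu * n0" using Nz_bounds Nz_pos z by auto
  have "VY N Nz Y z z = S z z * ((real N - real (Nz z)) / (real (Nz z) * real N))"
    using nz N_pos by (simp add: VY_def DY_def field_simps)
  moreover have "s0 * ((Q / 2 * (cl * n0)) / ((cu * n0) * (cu * n0 * Q))) \<le> S z z * ((real N - real (Nz z)) / (real (Nz z) * real N))"
    using s0_le[OF z] a le nz N_upper N_pos s0_pos cl_pos cu_pos n0_pos Qnum_pos[of K]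
    by (intro mult_mono frac_le mult_pos_pos) auto
  moreover have "s0 * ((Q / 2 * (cl * n0)) / ((cu * n0) * (cu * n0 * Q))) = s0 * cl / (2 * cu\<^sup>2 * n0)"
    using cu_pos n0_pos Qnum_pos[of K] by (simp add: field_simps power2_eq_square)
  ultimately show ?thesis by simp
qed

text \<open>Multiplying f by the standard deviations turns the covariance form into the correlation
  form, whose unit diagonal allows \<open>cond_number_le_quad\<close>; the deviations return through
  \<open>VY_diag_lower\<close>.\<close>

lemma quad_VY_lower: "(s0 * cl / (2 * cu\<^sup>2 * n0)) * (\<Sum>z\<in>TT. (f z)\<^sup>2) \<le> \<sigma>\<^sup>2 * quad K (VY N Nz Y) f"
proof -
  let ?V = "VY N Nz Y"
  have Vpos: "0 < ?V z z" if "z \<in> TT" for z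
    by (rule less_le_trans[OF _ VY_diag_lower[OF that]]) (use s0_pos cl_pos cu_pos n0_pos in simp)
  have symV: "?V z z' = ?V z' z" for z z'
    by (simp add: VY_def DY_def Spop_def mult.commute)
  define y where "y z = f z * sqrt (?V z z)" for z
  have "(s0 * cl / (2 * cu\<^sup>2 * n0)) * (\<Sum>z\<in>TT. (f z)\<^sup>2) \<le> (\<Sum>z\<in>TT. (y z)\<^sup>2)"
    unfolding sum_distrib_left
  proof (intro sum_mono)
    fix z assume z: "z \<in> TT"
    have "(y z)\<^sup>2 = ?V z z * (f z)\<^sup>2" using Vpos[OF z] by (simp add: y_def power_mult_distrib)
    then show "(s0 * cl / (2 * cu\<^sup>2 * n0)) * (f z)\<^sup>2 \<le> (y z)\<^sup>2"
      using VY_diag_lower[OF z] by (simp only: mult_right_mono zero_le_power2)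
  qed
  also have "\<dots> \<le> \<sigma>\<^sup>2 * quad K (corrY N Nz Y) y"
  proof (rule cond_number_le_quad[OF _ cond])
    show "corrY N Nz Y z z' = corrY N Nz Y z' z" for z z'
      by (simp add: corrY_def symV[of z z'] mult.commute)
    show "{} \<in> TT" by (simp add: treatments_def)
    then show "corrY N Nz Y {} {} = 1" using Vpos[of "{}"] by (simp add: corrY_def)
  qed
  also have "quad K (corrY N Nz Y) y = quad K ?V f"
    unfolding quad_def
  proof (intro sum.cong refl)
    fix z z' assume "z \<in> TT" "z' \<in> TT"
    then have "0 < sqrt (?V z z)" "0 < sqrt (?V z' z')" using Vpos by auto
    then show "y z * corrY N Nz Y z z' * y z' = f z * ?V z z' * f z'"
      by (simp add: y_def corrY_def real_sqrt_mult)
  qed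
  finally show ?thesis .
qed

text \<open>In the squared score the norm of \<open>fstar\<close> times s0 is traded for
  \<open>vR2\<close>, which then cancels; what remains is the model size over Q * n0.\<close>

lemma fstar_contrast_le:
  assumes vR: "0 < vR2 K N Nz Y f" and iz: "i < N" "z \<in> TT"
  shows "\<bar>fstar K N Y f z * (Y i z - Yb z)\<bar> / (real (Nz z) * sqrt (vR2 K N Nz Y f)) \<le>
    sqrt (\<kappa>\<^sub>5 * real (card (Mstar K N Y)) / real N)"
proof -
  let ?fs = "fstar K N Y f" and ?m = "real (card (Mstar K N Y))" and ?v = "vR2 K N Nz Y f"
  have Qp: "0 < Q" by (rule Qnum_pos)
  have nz: "cl * n0 \<le> real (Nz z)" using Nz_bounds iz by auto
  have c0: "0 < cl * n0" using cl_pos n0_pos by simp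
  have low: "(\<Sum>w\<in>TT. (?fs w)\<^sup>2) * s0 \<le> \<sigma>\<^sup>2 * ?v * (2 * cu\<^sup>2 * n0 / cl)"
  proof -
    have "(s0 * cl / (2 * cu\<^sup>2 * n0)) * (\<Sum>w\<in>TT. (?fs w)\<^sup>2) * (2 * cu\<^sup>2 * n0 / cl) \<le> \<sigma>\<^sup>2 * ?v * (2 * cu\<^sup>2 * n0 / cl)"
      using quad_VY_lower[of ?fs] cl_pos n0_pos unfolding vR2_def by (intro mult_right_mono) auto
    then show ?thesis using cl_pos n0_pos cu_pos by (simp add: mult_ac)
  qed
  have "(\<bar>?fs z * (Y i z - Yb z)\<bar> / (real (Nz z) * sqrt ?v))\<^sup>2 = (?fs z)\<^sup>2 * \<bar>Y i z - Yb z\<bar>\<^sup>2 / ((real (Nz z))\<^sup>2 * ?v)"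
    using vR by (simp add: power_divide power_mult_distrib)
  also have "\<dots> \<le> ((?m / Q * (\<Sum>w\<in>TT. (?fs w)\<^sup>2)) * (M * sqrt s0)\<^sup>2) / ((cl * n0)\<^sup>2 * ?v)"
    using proj_sup_le[OF Mstar_subset, of K N Y f z] dev_le[OF iz] nz c0 vR cl_pos n0_pos
    unfolding fstar_def[symmetric]
    by (intro frac_le mult_mono power_mono mult_nonneg_nonneg sum_nonneg mult_pos_pos divide_nonneg_nonneg) (auto intro: less_imp_le Qp)
  also have "\<dots> = ((\<Sum>w\<in>TT. (?fs w)\<^sup>2) * s0) * (?m * M\<^sup>2 / (Q * (cl * n0)\<^sup>2 * ?v))"
    using s0_pos by (simp add: power_mult_distrib mult_ac)
  also have "\<dots> \<le> (\<sigma>\<^sup>2 * ?v * (2 * cu\<^sup>2 * n0 / cl)) * (?m * M\<^sup>2 / (Q * (cl * n0)\<^sup>2 * ?v))"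
    using low vR Qp by (intro mult_right_mono) auto
  also have "\<dots> = (2 * M\<^sup>2 * \<sigma>\<^sup>2 * cu\<^sup>2 / cl ^ 3 * ?m) * (1 / (Q * n0))"
    using vR cl_pos n0_pos by (simp add: field_simps power2_eq_square power3_eq_cube)
  also have "\<dots> \<le> (2 * M\<^sup>2 * \<sigma>\<^sup>2 * cu\<^sup>2 / cl ^ 3 * ?m) * (cu / real N)"
    using cl_pos by (intro mult_left_mono inverse_Qn0) auto
  also have "\<dots> = M\<^sup>2 * (2 * \<sigma>\<^sup>2 * cu ^ 3 / cl ^ 3 * ?m / real N)"
    by (simp add: power2_eq_square power3_eq_cube)
  also have "\<dots> \<le> (M\<^sup>2 + 1) * (2 * \<sigma>\<^sup>2 * cu ^ 3 / cl ^ 3 * ?m / real N)"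
    using cl_pos cu_pos by (intro mult_right_mono) auto
  also have "\<dots> = \<kappa>\<^sub>5 * ?m / real N" by (simp add: \<kappa>\<^sub>5_def)
  finally show ?thesis by (rule real_le_rsqrt)
qed

text \<open>\<open>quad_VY_lower\<close> at the constant vector has a positive left side. This makes
  \<open>\<kappa>\<^sub>5\<close> positive, as the score bound of a linear statistic must
  be.\<close>

lemma sigma_nonzero: "\<sigma>\<^sup>2 > 0"
proof -
  have "0 < (s0 * cl / (2 * cu\<^sup>2 * n0)) * (\<Sum>z\<in>TT. ((\<lambda>_. 1) z)\<^sup>2)"
    using s0_pos cl_pos cu_pos n0_pos card_treatments[of K] Qnum_pos[of K] by simp
  then have "0 < \<sigma>\<^sup>2 * quad K (VY N Nz Y) (\<lambda>_. 1)" using quad_VY_lower[of "\<lambda>_. 1"] by linarith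
  then show ?thesis by (simp add: zero_less_mult_iff)
qed

lemma Mstar_card_pos: "card (Mstar K N Y) > 0"
  using finite_subset[OF Mstar_subset[of K N Y]] by (auto simp: card_gt_0_iff Mstar_def)

lemma characteristic_function_contrast:
  assumes vR: "0 < vR2 K N Nz Y f"
  shows "norm (avg Om (\<lambda>Z. iexp (t * ((\<Sum>z\<in>TT. fstar K N Y f z * (Yhat N Nz Y Z z - Yb z)) / sqrt (vR2 K N Nz Y f))))
      - of_real (exp (- (t\<^sup>2 / 2)))) \<le>
    \<bar>t\<bar> * (\<bar>t\<bar> * (96 * (\<kappa>\<^sub>5 * real (card (Mstar K N Y)) / sqrt (real N)))
      + 2 * sqrt (\<kappa>\<^sub>5 * real (card (Mstar K N Y)) / real N) * t\<^sup>2)"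
proof -
  let ?B = "sqrt (\<kappa>\<^sub>5 * real (card (Mstar K N Y)) / real N)" and ?s = "sqrt (vR2 K N Nz Y f)"
  let ?a = "\<lambda>i z. fstar K N Y f z * (Y i z - Yb z) / (real (Nz z) * ?s)"
  have \<kappa>\<^sub>5: "0 < \<kappa>\<^sub>5"
    using sigma_nonzero cl_pos cu_pos by (auto simp: \<kappa>\<^sub>5_def intro!: divide_pos_pos mult_pos_pos add_nonneg_pos)
  have B: "0 < ?B" using \<kappa>\<^sub>5 Mstar_card_pos N_pos by simp
  have s: "0 < ?s" using vR by simp
  have lin: "linear_statistic {..<N} TT Nz ?a ?B"
    by (rule linear_statistic_contrast[OF s B]) (rule fstar_contrast_le[OF vR])
  interpret L: linear_statistic "{..<N}" TT Nz ?a ?B by (rule lin)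
  have "avg Om (\<lambda>Z. (L.X Z)\<^sup>2) = quad K (VY N Nz Y) (fstar K N Y f) / ?s\<^sup>2"
    by (rule variance_contrast[OF lin s])
  also have "\<dots> = 1" using vR by (simp add: vR2_def)
  finally have "norm (avg Om (\<lambda>Z. iexp (t * L.X Z)) - of_real (exp (- (t\<^sup>2 / 2)))) \<le>
    \<bar>t\<bar> * (\<bar>t\<bar> * (96 * sqrt NN * ?B\<^sup>2) + 2 * ?B * t\<^sup>2)"
    by (rule L.characteristic_function_bound)
  moreover have "96 * sqrt NN * ?B\<^sup>2 = 96 * (\<kappa>\<^sub>5 * real (card (Mstar K N Y)) / sqrt (real N))"
  proof -
    have "?B\<^sup>2 = \<kappa>\<^sub>5 * real (card (Mstar K N Y)) / real N" using \<kappa>\<^sub>5 by simp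
    moreover have "real N = sqrt (real N) * sqrt (real N)" by simp
    ultimately show ?thesis using N_pos by (simp add: field_simps)
  qed
  moreover have "avg Om (\<lambda>Z. iexp (t * L.X Z)) =
      avg Om (\<lambda>Z. iexp (t * ((\<Sum>z\<in>TT. fstar K N Y f z * (Yhat N Nz Y Z z - Yb z)) / ?s)))"
    by (rule avg_cong) (simp only: X_contrast[OF lin])
  ultimately show ?thesis by simp
qed

text \<open>With \<open>fstar\<close> of order 1 / Q the weights N fstar(z)^2 / N(z) keep the effect
  of one swap at order 1 / N, the scale at which McDiarmid gives a bound exponential in N.\<close>

lemma variance_estimator_tail:
  assumes f: "\<And>z. z \<in> TT \<Longrightarrow> \<bar>fstar K N Y f z\<bar> \<le> C / Q" and \<epsilon>: "\<epsilon> > 0"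
  shows "prob (\<lambda>Z. \<bar>real N * (quad K (Vhat N Nz Y Z) (fstar K N Y f) - vRlim2 K N Nz Y f)\<bar> \<ge> \<epsilon>) \<le>
    2 * exp (- (\<epsilon>\<^sup>2 * real N / (16 * (8 * C\<^sup>2 * M\<^sup>2 * \<Delta>\<^sup>2 * cu\<^sup>2 / cl\<^sup>2 + 1)\<^sup>2)))"
proof -
  let ?fs = "fstar K N Y f"
  define w where "w z = real N * ((?fs z)\<^sup>2 / real (Nz z))" for z
  have e1: "real N * (quad K (Vhat N Nz Y Z) ?fs - vRlim2 K N Nz Y f) =
      (\<Sum>z\<in>TT. w z * Shat N Nz Y Z z) - (\<Sum>z\<in>TT. w z * S z z)" for Z
    unfolding vRlim2_def quad_Vhat quad_DY w_def
    by (simp add: right_diff_distrib sum_distrib_left mult_ac)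
  show ?thesis
    unfolding e1
  proof (rule weighted_Shat_tail[OF _ _ \<epsilon>])
    show "0 < 8 * C\<^sup>2 * M\<^sup>2 * \<Delta>\<^sup>2 * cu\<^sup>2 / cl\<^sup>2 + 1" by (intro add_nonneg_pos) auto
    fix z assume z: "z \<in> TT"
    have Qp: "0 < Q" by (rule Qnum_pos)
    have nz: "cl * n0 \<le> real (Nz z)" using Nz_bounds z by auto
    have c0: "0 < cl * n0" using cl_pos n0_pos by simp
    have f2: "(?fs z)\<^sup>2 \<le> (C / Q)\<^sup>2" using power_mono[OF f[OF z], of 2] by simp
    have "\<bar>w z\<bar> * (4 * (M * sqrt s0)\<^sup>2 / real (Nz z)) = real N * ((?fs z)\<^sup>2 * (4 * M\<^sup>2 * s0)) / (real (Nz z) * real (Nz z))"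
      using s0_pos by (simp add: w_def power_mult_distrib)
    also have "\<dots> \<le> real N * ((C / Q)\<^sup>2 * (4 * M\<^sup>2 * (2 * \<Delta>\<^sup>2))) / ((cl * n0) * (cl * n0))"
      using f2 s0_le_Delta s0_pos nz c0 cl_pos n0_pos
      by (intro frac_le mult_left_mono mult_mono mult_pos_pos mult_nonneg_nonneg) auto
    also have "\<dots> = real N * (8 * C\<^sup>2 * M\<^sup>2 * \<Delta>\<^sup>2 / cl\<^sup>2) * (1 / (Q * n0))\<^sup>2"
      by (simp add: power_divide power_mult_distrib power2_eq_square mult_ac)
    also have "\<dots> \<le> real N * (8 * C\<^sup>2 * M\<^sup>2 * \<Delta>\<^sup>2 / cl\<^sup>2) * (cu / real N)\<^sup>2"
      using inverse_Qn0 Qp n0_pos by (intro mult_left_mono power_mono) auto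
    also have "\<dots> = (8 * C\<^sup>2 * M\<^sup>2 * \<Delta>\<^sup>2 * cu\<^sup>2 / cl\<^sup>2) / real N"
      using N_pos by (simp add: power_divide power2_eq_square)
    also have "\<dots> \<le> (8 * C\<^sup>2 * M\<^sup>2 * \<Delta>\<^sup>2 * cu\<^sup>2 / cl\<^sup>2 + 1) / real N"
      by (intro divide_right_mono) auto
    finally show "\<bar>w z\<bar> * (4 * (M * sqrt s0)\<^sup>2 / real (Nz z)) \<le> (8 * C\<^sup>2 * M\<^sup>2 * \<Delta>\<^sup>2 * cu\<^sup>2 / cl\<^sup>2 + 1) / real N" .
  qed
qed

end

section \<open>Transfer to the law of the design and collection of rates\<close>

lemma (in factorial_experiment) design_prob:
  "measure_pmf.prob (design K N Nz) {Z. P Z} = prob P"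
proof -
  have "measure_pmf.prob (design K N Nz) {Z. P Z} = real (card (Om \<inter> {Z. P Z})) / real (card Om)"
    unfolding design_def assignments_eq by (rule measure_pmf_of_set[OF Om_nonempty finite_Om])
  also have "\<dots> = prob P"
    using finite_Om by (simp add: prob_def avg_def sum_of_bool_eq)
  finally show ?thesis .
qed

lemma (in factorial_experiment) design_char:
  "char (distr (measure_pmf (design K N Nz)) borel g) t = avg Om (\<lambda>Z. iexp (t * g Z))"
proof -
  have "char (distr (measure_pmf (design K N Nz)) borel g) t = (\<integral>Z. iexp (t * g Z) \<partial>measure_pmf (design K N Nz))"
    unfolding char_def by (subst integral_distr) auto
  also have "\<dots> = (\<Sum>Z\<in>Om. pmf (design K N Nz) Z *\<^sub>R iexp (t * g Z))"
    by (rule integral_measure_pmf[OF finite_Om])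
      (simp add: design_def assignments_eq set_pmf_of_set[OF Om_nonempty finite_Om])
  also have "\<dots> = (\<Sum>Z\<in>Om. iexp (t * g Z) / of_nat (card Om))"
    by (intro sum.cong refl)
      (simp add: design_def assignments_eq pmf_of_set[OF Om_nonempty finite_Om] scaleR_conv_of_real divide_inverse mult.commute)
  finally show ?thesis by (simp add: avg_def sum_divide_distrib)
qed

context regular_experiment
begin

lemma level_bounds:
  fixes strong :: bool
  defines "C \<equiv> oracle_candidates strong K N Y"
  assumes ne: "C d \<noteq> {}"
  shows "1 \<le> real (card (C d))" "real (card (C d)) \<le> real N"
proof -
  have "finite (C d)" unfolding C_def by (rule finite_oracle_candidates)
  then have "0 < card (C d)" using ne by (simp add: card_gt_0_iff)
  then show "1 \<le> real (card (C d))" by simp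
  show "real (card (C d)) \<le> real N"
    using card_oracle_candidates[of strong K N Y d] N_ge Qnum_pos[of K] unfolding C_def by linarith
qed

text \<open>The quantile level is \<alpha>_d / |C_d| with 1 \<le> |C_d| \<le> N. From below this
  makes the threshold O(sqrt(log N)). From above, dividing by |C_d| cancels the number of tests up
  to a power: |C_d| p^(1 - 5\<eta>) = |C_d|^(5\<eta>) \<alpha>_d^(1 - 5\<eta>).\<close>

lemma threshold_le:
  fixes strong :: bool and alpha :: "nat \<Rightarrow> real"
  defines "C \<equiv> oracle_candidates strong K N Y"
  defines "thr \<equiv> \<lambda>d. threshold (alpha d) (card (C d))"
  assumes ne: "C d \<noteq> {}" and al: "0 < a" "a \<le> alpha d" "alpha d \<le> b"
    and b: "b \<le> 1" "b / 2 < exp (- (1 / 2)) / sqrt (2 * pi)"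
  shows "0 < thr d" "(thr d)\<^sup>2 \<le> 2 * ln (2 * real N / a)"
    "0 < \<eta> \<Longrightarrow> \<eta> \<le> 1 / 10 \<Longrightarrow> real (card (C d)) * (2 * exp (- ((1 - 4 * \<eta>) * (thr d)\<^sup>2 / 2))) \<le>
       4 * exp ((1 + 1 / \<eta>) / 2) * real N powr (5 * \<eta>) * b powr (1 - 5 * \<eta>)"
proof -
  define c where "c = real (card (C d))"
  define p where "p = alpha d / c"
  have c: "1 \<le> c" "c \<le> real N" using level_bounds[of strong d] ne by (auto simp: c_def C_def)
  have p0: "0 < p" using c al by (simp add: p_def)
  have "p \<le> alpha d / 1" unfolding p_def using c al by (intro divide_left_mono) auto
  then have p1: "p \<le> b" using al by simp
  have pc: "p / 2 < exp (- (1 / 2)) / sqrt (2 * pi)" using p1 b by linarith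
  have t: "thr d = std_normal_quantile (1 - p / 2)"
    unfolding thr_def threshold_def using p1 b by (simp add: p_def c_def)
  note q = std_normal_upper_quantile[OF p0 pc, folded t]
  show "0 < thr d" by (rule q(1))
  have "a / real N \<le> p" unfolding p_def using c al N_pos by (intro frac_le) auto
  then have "a / real N / 2 \<le> p / 2" by (rule divide_right_mono) simp
  then have "a / real N / 2 \<le> exp (- ((thr d)\<^sup>2 / 2))" using q(2) by (rule order_trans)
  then have "ln (a / real N / 2) \<le> ln (exp (- ((thr d)\<^sup>2 / 2)))"
    using al N_pos by (subst ln_le_cancel_iff) auto
  moreover have "ln (a / real N / 2) = - ln (2 * real N / a)"
    using al N_pos by (simp add: ln_div ln_mult)
  ultimately show "(thr d)\<^sup>2 \<le> 2 * ln (2 * real N / a)" by simp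
  assume \<eta>: "0 < \<eta>" "\<eta> \<le> 1 / 10"
  define E where "E = exp ((1 + 1 / \<eta>) / 2)"
  have E: "0 < E" by (simp add: E_def)
  have "c * (2 * exp (- ((1 - 4 * \<eta>) * (thr d)\<^sup>2 / 2))) \<le> c * (2 * (2 * E * p powr (1 - 5 * \<eta>)))"
    using exp_quantile_le[OF p0 pc \<eta>] c unfolding t E_def by (intro mult_left_mono) auto
  also have "\<dots> = 4 * E * (c powr (5 * \<eta>) * alpha d powr (1 - 5 * \<eta>))"
  proof -
    have "c * p powr (1 - 5 * \<eta>) = c powr 1 * (alpha d powr (1 - 5 * \<eta>) / c powr (1 - 5 * \<eta>))"
      unfolding p_def using c al by (simp add: powr_divide)
    also have "\<dots> = c powr (1 - (1 - 5 * \<eta>)) * alpha d powr (1 - 5 * \<eta>)"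
      unfolding powr_diff[of c 1] by simp
    finally show ?thesis by simp
  qed
  also have "\<dots> \<le> 4 * E * (real N powr (5 * \<eta>) * b powr (1 - 5 * \<eta>))"
    using c al E \<eta> by (intro mult_left_mono mult_mono powr_mono2) auto
  finally show "real (card (C d)) * (2 * exp (- ((1 - 4 * \<eta>) * (thr d)\<^sup>2 / 2))) \<le>
       4 * exp ((1 + 1 / \<eta>) / 2) * real N powr (5 * \<eta>) * b powr (1 - 5 * \<eta>)"
    by (simp add: c_def E_def mult.assoc)
qed

lemma K_le: "real K \<le> ln (real N) / ln 2"
proof -
  have "2 ^ K \<le> real N" using N_ge Qnum_pos[of K] unfolding Qnum_def by linarith
  then have "ln (2 ^ K) \<le> ln (real N)" using N_pos by (subst ln_le_cancel_iff) auto
  then show ?thesis by (simp add: ln_realpow pos_le_divide_eq)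
qed

text \<open>On correct selection the estimator is the linear contrast of \<open>fstar\<close>;
  otherwise two numbers of modulus 1 differ by at most 2.\<close>

lemma char_gammaR_hat:
  assumes vR: "0 < vR2 K N Nz Y f"
  shows "norm (char (distr (measure_pmf (design K N Nz)) borel
        (\<lambda>Z. (gammaR_hat strong K N Nz Y alpha f Z - gamma K N Y f) / sqrt (vR2 K N Nz Y f))) t
      - of_real (exp (- (t\<^sup>2 / 2)))) \<le>
    2 * prob (\<lambda>Z. Mhat strong K N Nz Y alpha Z \<noteq> Mstar K N Y)
    + \<bar>t\<bar> * (\<bar>t\<bar> * (96 * (\<kappa>\<^sub>5 * real (card (Mstar K N Y)) / sqrt (real N)))
      + 2 * sqrt (\<kappa>\<^sub>5 * real (card (Mstar K N Y)) / real N) * t\<^sup>2)"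
proof -
  let ?g = "\<lambda>Z. (gammaR_hat strong K N Nz Y alpha f Z - gamma K N Y f) / sqrt (vR2 K N Nz Y f)"
  let ?h = "\<lambda>Z. (\<Sum>z\<in>TT. fstar K N Y f z * (Yhat N Nz Y Z z - Yb z)) / sqrt (vR2 K N Nz Y f)"
  have "norm (avg Om (\<lambda>Z. iexp (t * ?g Z) - iexp (t * ?h Z))) \<le> avg Om (\<lambda>Z. 2 * of_bool (Mhat strong K N Nz Y alpha Z \<noteq> Mstar K N Y))"
  proof (intro order_trans[OF norm_avg_le] avg_mono)
    fix Z
    show "norm (iexp (t * ?g Z) - iexp (t * ?h Z)) \<le> 2 * of_bool (Mhat strong K N Nz Y alpha Z \<noteq> Mstar K N Y)"
    proof (cases "Mhat strong K N Nz Y alpha Z = Mstar K N Y")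
      case True
      then show ?thesis by (simp add: gammaR_hat_diff[OF True])
    next
      case False
      have "norm (iexp (t * ?g Z) - iexp (t * ?h Z)) \<le> norm (iexp (t * ?g Z)) + norm (iexp (t * ?h Z))"
        by (rule norm_triangle_ineq4)
      then show ?thesis using False by (simp only: norm_exp_i_times) simp
    qed
  qed
  then have 1: "norm (avg Om (\<lambda>Z. iexp (t * ?g Z)) - avg Om (\<lambda>Z. iexp (t * ?h Z))) \<le>
    2 * prob (\<lambda>Z. Mhat strong K N Nz Y alpha Z \<noteq> Mstar K N Y)"
    by (simp only: avg_diff avg_cmult prob_def)
  show ?thesis
    unfolding design_char
    using norm_triangle_mono[OF 1 characteristic_function_contrast[OF vR, of t]] by simp
qed

lemma vR2_hat_tail:
  assumes f: "\<And>z. z \<in> TT \<Longrightarrow> \<bar>fstar K N Y f z\<bar> \<le> C / Q" and \<epsilon>: "\<epsilon> > 0"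
  shows "prob (\<lambda>Z. \<bar>real N * (vR2_hat strong K N Nz Y alpha f Z - vRlim2 K N Nz Y f)\<bar> > \<epsilon>) \<le>
    prob (\<lambda>Z. Mhat strong K N Nz Y alpha Z \<noteq> Mstar K N Y) +
    2 * exp (- (\<epsilon>\<^sup>2 * real N / (16 * (8 * C\<^sup>2 * M\<^sup>2 * \<Delta>\<^sup>2 * cu\<^sup>2 / cl\<^sup>2 + 1)\<^sup>2)))"
proof -
  have "prob (\<lambda>Z. \<bar>real N * (vR2_hat strong K N Nz Y alpha f Z - vRlim2 K N Nz Y f)\<bar> > \<epsilon>) \<le>
    prob (\<lambda>Z. Mhat strong K N Nz Y alpha Z \<noteq> Mstar K N Y \<or>
      \<bar>real N * (quad K (Vhat N Nz Y Z) (fstar K N Y f) - vRlim2 K N Nz Y f)\<bar> \<ge> \<epsilon>)"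
    by (rule prob_mono) (auto simp: vR2_hat_def fstar_def)
  also note prob_disj_le
  finally show ?thesis using variance_estimator_tail[OF f \<epsilon>] by simp
qed

text \<open>The thresholds are bounded by x^e for a small e > 0 rather than by sqrt(log x), so that
  all requirements on them compare powers of x. The factor ln x / ln 2 counts the levels.\<close>

lemma Mhat_ne_Mstar_prob_le:
  fixes strong :: bool and alpha :: "nat \<Rightarrow> real"
  defines "x \<equiv> real N"
  assumes her: "heredity strong K N Y" and \<eta>: "0 < \<eta>" "\<eta> \<le> 1 / 10" and e: "0 < e"
    and al: "0 < a" "\<And>d. d \<in> {1..K} \<Longrightarrow> a * x powr - \<delta>' \<le> alpha d \<and> alpha d \<le> b * x powr - \<delta>'"
    and sig: "0 < L" "\<And>KK. KK \<in> Mstar_upto K N Y K \<Longrightarrow> L * x powr \<delta> \<le> \<bar>tau K N Y KK\<bar>"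
    and b: "0 < b" "b * x powr - \<delta>' \<le> 1" "b * x powr - \<delta>' / 2 < exp (- (1 / 2)) / sqrt (2 * pi)"
    and tm: "2 * (ln (2 / a) + (1 + \<delta>') * ln x) \<le> x powr (2 * e)"
    and detect: "x powr e * sqrt (2 * (\<kappa>\<^sub>4 / x)) \<le> L * x powr \<delta> / 2"
    and small: "4 * \<kappa>\<^sub>2\<^sup>2 * exp (x powr e * (\<kappa>\<^sub>2 * sqrt x) - \<eta>\<^sup>2 * x / (1024 * \<kappa>\<^sub>2 ^ 4)) \<le> \<eta>"
  shows "prob (\<lambda>Z. Mhat strong K N Nz Y alpha Z \<noteq> Mstar K N Y) \<le>
    2 * exp (- (\<eta>\<^sup>2 / (16 * \<kappa>\<^sub>1\<^sup>2) * x))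
    + 2 * x * exp (- (L\<^sup>2 / (256 * \<kappa>\<^sub>3\<^sup>2) * x powr (1 + 2 * \<delta>)))
    + 4 * exp ((1 + 1 / \<eta>) / 2) * b powr (1 - 5 * \<eta>) / ln 2 * ln x * x powr (5 * \<eta> - \<delta>' * (1 - 5 * \<eta>))"
proof -
  let ?C = "oracle_candidates strong K N Y"
  let ?thr = "\<lambda>d. threshold (alpha d) (card (?C d))"
  have x: "0 < x" using N_pos by (simp add: x_def)
  have T: "0 < ?thr d \<and> ?thr d \<le> x powr e \<and>
      real (card (?C d)) * (2 * exp (- ((1 - 4 * \<eta>) * (?thr d)\<^sup>2 / 2))) \<le>
       4 * exp ((1 + 1 / \<eta>) / 2) * x powr (5 * \<eta>) * (b * x powr - \<delta>') powr (1 - 5 * \<eta>)"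
    if d: "d \<in> {1..K}" and ne: "?C d \<noteq> {}" for d
  proof -
    have a': "0 < a * x powr - \<delta>'" using al(1) x by simp
    have ad: "a * x powr - \<delta>' \<le> alpha d" "alpha d \<le> b * x powr - \<delta>'" using al(2)[OF d] by auto
    note th = threshold_le[where d = d and alpha = alpha and strong = strong, OF ne a' ad b(2,3)]
    have "ln (2 * x / (a * x powr - \<delta>')) = ln (2 / a) + (1 + \<delta>') * ln x"
      using al(1) x by (simp add: ln_div ln_mult ln_powr algebra_simps)
    then have "(?thr d)\<^sup>2 \<le> x powr (2 * e)" using th(2) tm unfolding x_def by simp
    also have "\<dots> = (x powr e)\<^sup>2" by (simp add: power2_eq_square powr_add[symmetric])
    finally have "?thr d \<le> x powr e" by (rule power2_le_imp_le) simp
    then show ?thesis using th(1) th(3)[OF \<eta>] unfolding x_def by simp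
  qed
  have main: "prob (\<lambda>Z. Mhat strong K N Nz Y alpha Z \<noteq> Mstar K N Y) \<le>
    2 * exp (- (\<eta>\<^sup>2 * real N / (16 * \<kappa>\<^sub>1\<^sup>2)))
    + 2 * real N * exp (- ((L * x powr \<delta>)\<^sup>2 * real N / (256 * \<kappa>\<^sub>3\<^sup>2)))
    + (\<Sum>d\<in>{1..K}. real (card (?C d)) * (2 * exp (- ((1 - 4 * \<eta>) * (?thr d)\<^sup>2 / 2))))"
  proof (rule Mhat_ne_Mstar_prob[OF her])
    show "0 < ?thr d \<and> ?thr d \<le> x powr e" if "d \<in> {1..K}" "?C d \<noteq> {}" for d
      using T[OF that] by blast
    show "x powr e * sqrt (2 * (\<kappa>\<^sub>4 / real N)) \<le> L * x powr \<delta> / 2" using detect by (simp add: x_def)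
    show "4 * \<kappa>\<^sub>2\<^sup>2 * exp (x powr e * (\<kappa>\<^sub>2 * sqrt (real N)) - \<eta>\<^sup>2 * real N / (1024 * \<kappa>\<^sub>2 ^ 4)) \<le> \<eta>"
      using small by (simp add: x_def)
  qed (use \<eta> sig x in auto)
  have first: "2 * exp (- (\<eta>\<^sup>2 * real N / (16 * \<kappa>\<^sub>1\<^sup>2))) = 2 * exp (- (\<eta>\<^sup>2 / (16 * \<kappa>\<^sub>1\<^sup>2) * x))"
    by (simp add: x_def)
  have second: "2 * real N * exp (- ((L * x powr \<delta>)\<^sup>2 * real N / (256 * \<kappa>\<^sub>3\<^sup>2))) =
      2 * x * exp (- (L\<^sup>2 / (256 * \<kappa>\<^sub>3\<^sup>2) * x powr (1 + 2 * \<delta>)))"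
  proof -
    have "x powr (1 + 2 * \<delta>) = x powr 1 * (x powr \<delta> * x powr \<delta>)"
      unfolding powr_add[symmetric] by simp
    then have "(x powr \<delta>)\<^sup>2 * x = x powr (1 + 2 * \<delta>)"
      using x by (simp add: power2_eq_square)
    then have "(L * x powr \<delta>)\<^sup>2 * real N = L\<^sup>2 * x powr (1 + 2 * \<delta>)"
      by (simp add: power_mult_distrib x_def mult.assoc)
    then show ?thesis by (simp add: x_def)
  qed
  have "(\<Sum>d\<in>{1..K}. real (card (?C d)) * (2 * exp (- ((1 - 4 * \<eta>) * (?thr d)\<^sup>2 / 2)))) \<le>
      (\<Sum>d\<in>{1..K}. 4 * exp ((1 + 1 / \<eta>) / 2) * x powr (5 * \<eta>) * (b * x powr - \<delta>') powr (1 - 5 * \<eta>))"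
  proof (rule sum_mono)
    fix d assume d: "d \<in> {1..K}"
    show "real (card (?C d)) * (2 * exp (- ((1 - 4 * \<eta>) * (?thr d)\<^sup>2 / 2))) \<le>
       4 * exp ((1 + 1 / \<eta>) / 2) * x powr (5 * \<eta>) * (b * x powr - \<delta>') powr (1 - 5 * \<eta>)"
      \<comment> \<open>An empty level contributes 0, whatever its unspecified threshold.\<close>
      using T[OF d] by (cases "?C d = {}") auto
  qed
  also have "\<dots> = real K * (4 * exp ((1 + 1 / \<eta>) / 2) * x powr (5 * \<eta>) * (b * x powr - \<delta>') powr (1 - 5 * \<eta>))"
    by simp
  also have "\<dots> \<le> ln x / ln 2 * (4 * exp ((1 + 1 / \<eta>) / 2) * x powr (5 * \<eta>) * (b * x powr - \<delta>') powr (1 - 5 * \<eta>))"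
    using K_le unfolding x_def by (intro mult_right_mono) auto
  also have "(b * x powr - \<delta>') powr (1 - 5 * \<eta>) = b powr (1 - 5 * \<eta>) * x powr (- \<delta>' * (1 - 5 * \<eta>))"
    using b(1) x by (simp add: powr_mult powr_powr)
  also have "ln x / ln 2 * (4 * exp ((1 + 1 / \<eta>) / 2) * x powr (5 * \<eta>) * (b powr (1 - 5 * \<eta>) * x powr (- \<delta>' * (1 - 5 * \<eta>)))) =
     4 * exp ((1 + 1 / \<eta>) / 2) * b powr (1 - 5 * \<eta>) / ln 2 * ln x * x powr (5 * \<eta> - \<delta>' * (1 - 5 * \<eta>))"
  proof -
    have "x powr (5 * \<eta> - \<delta>' * (1 - 5 * \<eta>)) = x powr (5 * \<eta>) * x powr (- \<delta>' * (1 - 5 * \<eta>))"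
      by (simp add: powr_add[symmetric])
    then show ?thesis by simp
  qed
  finally have third: "(\<Sum>d\<in>{1..K}. real (card (?C d)) * (2 * exp (- ((1 - 4 * \<eta>) * (?thr d)\<^sup>2 / 2)))) \<le>
     4 * exp ((1 + 1 / \<eta>) / 2) * b powr (1 - 5 * \<eta>) / ln 2 * ln x * x powr (5 * \<eta> - \<delta>' * (1 - 5 * \<eta>))" .
  show ?thesis
    by (rule order_trans[OF main[unfolded first second] add_left_mono[OF third]])
qed

end

lemma card_Mstar_le: "real (card (Mstar K N Y)) \<le> 1 + real (\<Sum>d\<in>{1..K}. card (Mstar_d K N Y d))"
proof -
  have "card (Mstar K N Y) \<le> card {{} :: nat set} + card (Mstar_upto K N Y K)"
    unfolding Mstar_def by (rule card_Un_le)
  also have "card (Mstar_upto K N Y K) \<le> (\<Sum>d\<in>{1..K}. card (Mstar_d K N Y d))"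
    unfolding Mstar_upto_def by (rule card_UN_le) simp
  finally have "card (Mstar K N Y) \<le> 1 + (\<Sum>d\<in>{1..K}. card (Mstar_d K N Y d))" by simp
  then have "real (card (Mstar K N Y)) \<le> real (1 + (\<Sum>d\<in>{1..K}. card (Mstar_d K N Y d)))"
    by (rule of_nat_mono)
  then show ?thesis by (simp only: of_nat_add of_nat_1)
qed

section \<open>Asymptotic normality and variance estimation\<close>

text \<open>A threshold of size y^e times noise of order y^(-1/2) stays below the signal y^(2e -
  1/2): the second factor y^e is the margin.\<close>

lemma powr_sqrt_le:
  fixes k L \<delta> e y :: real
  assumes y: "0 < y" and \<delta>: "\<delta> = 2 * e - 1 / 2" and le: "sqrt (2 * k) \<le> L / 2 * y powr e"
  shows "y powr e * sqrt (2 * (k / y)) \<le> L * y powr \<delta> / 2"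
proof -
  have s: "sqrt (2 * (k / y)) = sqrt (2 * k) * y powr (- (1 / 2))"
  proof -
    have "sqrt (2 * (k / y)) = sqrt (2 * k / y)" by simp
    also have "\<dots> = sqrt (2 * k) / sqrt y" by (rule real_sqrt_divide)
    also have "\<dots> = sqrt (2 * k) * y powr (- (1 / 2))"
      using powr_minus[of y "1 / 2"] powr_half_sqrt[of y] y by (simp only: less_imp_le divide_inverse)
    finally show ?thesis .
  qed
  have "y powr e * sqrt (2 * (k / y)) \<le> y powr e * ((L / 2 * y powr e) * y powr (- (1 / 2)))"
    unfolding s using le by (intro mult_left_mono mult_right_mono) auto
  also have "\<dots> = L / 2 * (y powr e * y powr e * y powr (- (1 / 2)))" by simp
  also have "y powr e * y powr e * y powr (- (1 / 2)) = y powr \<delta>"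
    unfolding powr_add[symmetric] \<delta> by simp
  finally show ?thesis by simp
qed

theorem theorem2:
  fixes strong :: bool
    and K N N0 :: "nat \<Rightarrow> nat"
    and Nz :: "nat \<Rightarrow> nat set \<Rightarrow> nat"
    and c :: "nat \<Rightarrow> nat set \<Rightarrow> real"
    and Y :: "nat \<Rightarrow> nat \<Rightarrow> nat set \<Rightarrow> real"
    and f :: "nat \<Rightarrow> nat set \<Rightarrow> real"
    and alpha :: "nat \<Rightarrow> nat \<Rightarrow> real"
    and cl cu \<delta> \<delta>' \<delta>'' \<sigma> \<Delta> M :: real
  assumes K_ge2: "\<forall>m. K m \<ge> 2"
    and N_to_inf: "filterlim N at_top sequentially"
    (* (C1) *)
    and C1_pos: "0 < cl"
    and C1: "\<forall>m. \<forall>z\<in>treatments (K m).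
               real (Nz m z) = c m z * real (N0 m) \<and> cl \<le> c m z \<and> c m z \<le> cu \<and> Nz m z \<ge> 2"
    and C1_sum: "\<forall>m. (\<Sum>z\<in>treatments (K m). Nz m z) = N m"
    (* (C2) *)
    and C2_i: "-1/2 < \<delta> \<and> \<delta> \<le> 0"
    and C2_i': "\<exists>a b. 0 < a \<and> 0 < b \<and> (\<forall>\<^sub>F m in sequentially.
               \<forall>KK\<in>Mstar_upto (K m) (N m) (Y m) (K m).
                 a * real (N m) powr \<delta> \<le> \<bar>tau (K m) (N m) (Y m) KK\<bar> \<and>
                 \<bar>tau (K m) (N m) (Y m) KK\<bar> \<le> b * real (N m) powr \<delta>)"
    and C2_ii: "0 < \<delta>'"
    and C2_ii': "\<exists>a b. 0 < a \<and> 0 < b \<and> (\<forall>\<^sub>F m in sequentially.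
               \<forall>d\<in>{1..K m}. a * real (N m) powr (-\<delta>') \<le> alpha m d \<and>
                             alpha m d \<le> b * real (N m) powr (-\<delta>'))"
    and C2_iii: "0 \<le> \<delta>'' \<and> \<delta>'' < 1/3"
    and C2_iii': "\<exists>a b. 0 < a \<and> 0 < b \<and> (\<forall>\<^sub>F m in sequentially.
               a * real (N m) powr \<delta>'' \<le> real (\<Sum>d\<in>{1..K m}. card (Mstar_d (K m) (N m) (Y m) d)) \<and>
               real (\<Sum>d\<in>{1..K m}. card (Mstar_d (K m) (N m) (Y m) d)) \<le> b * real (N m) powr \<delta>'')"
    (* (C3); positivity of the variances S(z,z) is implicit in (C3) *)
    and S_pos: "\<forall>m. \<forall>z\<in>treatments (K m). Spop (N m) (Y m) z z > 0"
    and C3_i: "\<forall>m. cond_number_le (K m) (corrY (N m) (Nz m) (Y m)) (\<sigma>^2)"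
    and C3_ii: "\<forall>m. \<forall>z\<in>treatments (K m).
               (\<Sum>i<N m. (Y m i z - Ybar (N m) (Y m) z) ^ 4) / real (N m) \<le> \<Delta> ^ 4"
    and C3_iii: "\<forall>m. \<forall>i<N m. \<forall>z\<in>treatments (K m).
               \<bar>Y m i z - Ybar (N m) (Y m) z\<bar>
                 / sqrt (Min ((\<lambda>z'. Spop (N m) (Y m) z' z') ` treatments (K m))) \<le> M"
    (* (C4), same heredity type as the procedure *)
    and C4: "\<forall>m. heredity strong (K m) (N m) (Y m)"
    (* non-degeneracy: the normalising standard deviation v_R is positive *)
    and vR_pos: "\<forall>m. vR2 (K m) (N m) (Nz m) (Y m) (f m) > 0"
  shows "weak_conv_m
           (\<lambda>m. distr (measure_pmf (design (K m) (N m) (Nz m))) borel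
                 (\<lambda>Z. (gammaR_hat strong (K m) (N m) (Nz m) (Y m) (alpha m) (f m) Z
                        - gamma (K m) (N m) (Y m) (f m))
                       / sqrt (vR2 (K m) (N m) (Nz m) (Y m) (f m))))
           std_normal_distribution
       \<and> ((\<exists>C. \<forall>\<^sub>F m in sequentially. \<forall>z\<in>treatments (K m).
              \<bar>fstar (K m) (N m) (Y m) (f m) z\<bar> \<le> C / Qnum (K m))
           \<longrightarrow> (\<forall>\<epsilon>>0. (\<lambda>m. measure_pmf.prob (design (K m) (N m) (Nz m))
                   {Z. \<bar>real (N m) * (vR2_hat strong (K m) (N m) (Nz m) (Y m) (alpha m) (f m) Z
                                     - vRlim2 (K m) (N m) (Nz m) (Y m) (f m))\<bar> > \<epsilon>})
                 \<longlonglongrightarrow> 0))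
       \<and> (\<forall>m. vR2 (K m) (N m) (Nz m) (Y m) (f m) \<le> vRlim2 (K m) (N m) (Nz m) (Y m) (f m))"
proof -
  have reg: "regular_experiment (K m) (N m) (Nz m) (Y m) (real (N0 m)) cl cu \<sigma> \<Delta> M" for m
  proof
    show "2 \<le> Nz m z" if "z \<in> treatments (K m)" for z using C1 that by blast
    show "(\<Sum>z\<in>treatments (K m). Nz m z) = N m" using C1_sum by blast
    show "0 < cl" by (rule C1_pos)
    show "2 \<le> K m" using K_ge2 by blast
    show "0 < real (N0 m)"
    proof (rule ccontr)
      assume "\<not> 0 < real (N0 m)"
      then have "N0 m = 0" by simp
      moreover have "{} \<in> treatments (K m)" by (simp add: treatments_def)
      ultimately have "real (Nz m {}) = 0" "Nz m {} \<ge> 2" using C1 by fastforce+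
      then show False by simp
    qed
    show "cl * real (N0 m) \<le> real (Nz m z) \<and> real (Nz m z) \<le> cu * real (N0 m)"
      if "z \<in> treatments (K m)" for z
      using C1 that by (metis mult_right_mono of_nat_0_le_iff)
    show "Spop (N m) (Y m) z z > 0" if "z \<in> treatments (K m)" for z using S_pos that by blast
    show "cond_number_le (K m) (corrY (N m) (Nz m) (Y m)) (\<sigma>\<^sup>2)" using C3_i by blast
    show "(\<Sum>i<N m. (Y m i z - Ybar (N m) (Y m) z) ^ 4) / real (N m) \<le> \<Delta> ^ 4"
      if "z \<in> treatments (K m)" for z using C3_ii that by blast
    show "\<bar>Y m i z - Ybar (N m) (Y m) z\<bar> / sqrt (Min ((\<lambda>z'. Spop (N m) (Y m) z' z') ` treatments (K m))) \<le> M"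
      if "i < N m" "z \<in> treatments (K m)" for i z using C3_iii that by blast
  qed
  define x where "x m = real (N m)" for m
  have x_inf: "filterlim x at_top sequentially"
    unfolding x_def by (rule filterlim_compose[OF filterlim_real_sequentially N_to_inf])
  define p where "p m = measure_pmf.prob (design (K m) (N m) (Nz m))
    {Z. Mhat strong (K m) (N m) (Nz m) (Y m) (alpha m) Z \<noteq> Mstar (K m) (N m) (Y m)}" for m
  define k1 where "k1 = 8 * (M\<^sup>2 + 1) * cu\<^sup>2 / cl\<^sup>2"
  define k2 where "k2 = (\<bar>M\<bar> + 1) * cu / cl"
  define k3 where "k3 = 2 * (\<bar>M\<bar> + 1) * (\<bar>\<Delta>\<bar> + 1) * cu / cl"
  define k4 where "k4 = 2 * \<Delta>\<^sup>2 * cu / cl"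
  define k5 where "k5 = 2 * (M\<^sup>2 + 1) * \<sigma>\<^sup>2 * cu ^ 3 / cl ^ 3"
  have k_pos: "0 < k1" "0 < k2" "0 < k3"
  proof -
    interpret R: regular_experiment "K 0" "N 0" "Nz 0" "Y 0" "real (N0 0)" cl cu \<sigma> \<Delta> M by (rule reg)
    show "0 < k1" "0 < k2" "0 < k3"
      using R.\<kappa>_pos unfolding R.\<kappa>\<^sub>1_def R.\<kappa>\<^sub>2_def R.\<kappa>\<^sub>3_def k1_def k2_def k3_def by auto
  qed
  have p_tendsto: "p \<longlonglongrightarrow> 0"
  proof -
    obtain L where L: "0 < L" and sig: "\<forall>\<^sub>F m in sequentially. \<forall>KK\<in>Mstar_upto (K m) (N m) (Y m) (K m).
        L * x m powr \<delta> \<le> \<bar>tau (K m) (N m) (Y m) KK\<bar>"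
    proof -
      obtain a b where a: "0 < a" and ev: "\<forall>\<^sub>F m in sequentially.
               \<forall>KK\<in>Mstar_upto (K m) (N m) (Y m) (K m).
                 a * real (N m) powr \<delta> \<le> \<bar>tau (K m) (N m) (Y m) KK\<bar> \<and>
                 \<bar>tau (K m) (N m) (Y m) KK\<bar> \<le> b * real (N m) powr \<delta>"
        using C2_i' by blast
      show ?thesis by (rule that[OF a]) (use ev in \<open>auto simp: x_def elim: eventually_mono\<close>)
    qed
    obtain a b where a: "0 < a" and b: "0 < b" and al: "\<forall>\<^sub>F m in sequentially. \<forall>d\<in>{1..K m}.
        a * x m powr (-\<delta>') \<le> alpha m d \<and> alpha m d \<le> b * x m powr (-\<delta>')"
      using C2_ii' unfolding x_def by blast
    \<comment> \<open>Half the distance of \<delta> from -1/2: one half is spent on the threshold,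
      the other on constants.\<close>
    define e where "e = (\<delta> + 1 / 2) / 2"
    \<comment> \<open>Chosen so that the exponent of N in the false positive bound equals -
      \<delta>' / 2.\<close>
    define \<eta> where "\<eta> = \<delta>' / (10 * (1 + \<delta>'))"
    have e: "0 < e" "e \<le> 1 / 4" "\<delta> = 2 * e - 1 / 2" using C2_i by (auto simp: e_def field_simps)
    have \<eta>: "0 < \<eta>" "\<eta> \<le> 1 / 10" using C2_ii by (auto simp: \<eta>_def field_simps)
    have expo: "5 * \<eta> - \<delta>' * (1 - 5 * \<eta>) = - \<delta>' / 2"
    proof -
      have "\<eta> * (1 + \<delta>') = \<delta>' / 10" using C2_ii by (simp add: \<eta>_def field_simps)
      then show ?thesis by (simp add: algebra_simps)
    qed
    define D where "D = 4 * exp ((1 + 1 / \<eta>) / 2) * b powr (1 - 5 * \<eta>) / ln 2"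
    define g where "g y = 2 * exp (- (\<eta>\<^sup>2 / (16 * k1\<^sup>2) * y))
      + 2 * y * exp (- (L\<^sup>2 / (256 * k3\<^sup>2) * y powr (1 + 2 * \<delta>)))
      + D * ln y * y powr (- \<delta>' / 2)" for y
    have g0: "(g \<longlongrightarrow> 0) at_top"
    proof -
      have lim1: "((\<lambda>y. 2 * exp (- (c * y))) \<longlongrightarrow> 0) at_top" if "0 < c" for c :: real
        using that by real_asymp
      have lim2: "((\<lambda>y. 2 * y * exp (- (c * y powr u))) \<longlongrightarrow> 0) at_top" if "0 < c" "0 < u" for c u :: real
        using that by real_asymp
      have lim3: "((\<lambda>y. D * ln y * y powr (- u / 2)) \<longlongrightarrow> 0) at_top" if "0 < u" for u :: real
        using that by real_asymp
      have "(g \<longlongrightarrow> 0 + 0 + 0) at_top" unfolding g_def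
        by (intro tendsto_add lim1 lim2 lim3) (use \<eta> k_pos L C2_i C2_ii in auto)
      then show ?thesis by simp
    qed
    have "\<forall>\<^sub>F y in at_top. b * y powr - \<delta>' \<le> 1 \<and> b * y powr - \<delta>' / 2 < exp (- (1 / 2)) / sqrt (2 * pi)
      \<and> 2 * (ln (2 / a) + (1 + \<delta>') * ln y) \<le> y powr (2 * e)
      \<and> y powr e * sqrt (2 * (k4 / y)) \<le> L * y powr \<delta> / 2
      \<and> 4 * k2\<^sup>2 * exp (y powr e * (k2 * sqrt y) - \<eta>\<^sup>2 * y / (1024 * k2 ^ 4)) \<le> \<eta>"
    proof (intro eventually_conj)
      have lim: "((\<lambda>y. b * y powr - \<delta>') \<longlongrightarrow> 0) at_top"
        using C2_ii by real_asymp
      show "\<forall>\<^sub>F y in at_top. b * y powr - \<delta>' \<le> 1"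
        using order_tendstoD(2)[OF lim, of 1] by (auto elim: eventually_mono)
      have "((\<lambda>y. b * y powr - \<delta>' / 2) \<longlongrightarrow> 0 / 2) at_top" by (intro tendsto_divide lim) auto
      then show "\<forall>\<^sub>F y in at_top. b * y powr - \<delta>' / 2 < exp (- (1 / 2)) / sqrt (2 * pi)"
        by (rule order_tendstoD(2)) simp
      show "\<forall>\<^sub>F y in at_top. 2 * (ln (2 / a) + (1 + \<delta>') * ln y) \<le> y powr (2 * e)"
        using a C2_ii e(1) by real_asymp
      have "\<forall>\<^sub>F y in at_top. sqrt (2 * k4) \<le> L / 2 * y powr e"
        using L e(1) by real_asymp
      then show "\<forall>\<^sub>F y in at_top. y powr e * sqrt (2 * (k4 / y)) \<le> L * y powr \<delta> / 2"
        using eventually_gt_at_top[of 0] by eventually_elim (rule powr_sqrt_le[OF _ e(3)])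
      define c where "c = \<eta>\<^sup>2 / (1024 * k2 ^ 4)"
      have "0 < c" using \<eta> k_pos by (simp add: c_def)
      \<comment> \<open>As \<delta> \<le> 0 gives e \<le> 1/4, the growing exponent is at most of
        order y^(3/4) and loses against the linear term.\<close>
      then have "((\<lambda>y. 4 * k2\<^sup>2 * exp (y powr (1 / 4) * (k2 * sqrt y) - c * y)) \<longlongrightarrow> 0) at_top"
        using k_pos(2) by real_asymp
      from order_tendstoD(2)[OF this \<eta>(1)]
      show "\<forall>\<^sub>F y in at_top. 4 * k2\<^sup>2 * exp (y powr e * (k2 * sqrt y) - \<eta>\<^sup>2 * y / (1024 * k2 ^ 4)) \<le> \<eta>"
        using eventually_ge_at_top[of 1]
      proof eventually_elim
        case (elim y)
        have "y powr e * (k2 * sqrt y) \<le> y powr (1 / 4) * (k2 * sqrt y)"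
          using elim(2) e(2) k_pos(2) by (intro mult_right_mono powr_mono) auto
        then have "4 * k2\<^sup>2 * exp (y powr e * (k2 * sqrt y) - c * y) \<le> 4 * k2\<^sup>2 * exp (y powr (1 / 4) * (k2 * sqrt y) - c * y)"
          by (intro mult_left_mono) auto
        then show ?case using elim(1) by (simp add: c_def)
      qed
    qed
    then have cond: "\<forall>\<^sub>F m in sequentially. b * x m powr - \<delta>' \<le> 1 \<and> b * x m powr - \<delta>' / 2 < exp (- (1 / 2)) / sqrt (2 * pi)
      \<and> 2 * (ln (2 / a) + (1 + \<delta>') * ln (x m)) \<le> x m powr (2 * e)
      \<and> x m powr e * sqrt (2 * (k4 / x m)) \<le> L * x m powr \<delta> / 2
      \<and> 4 * k2\<^sup>2 * exp (x m powr e * (k2 * sqrt (x m)) - \<eta>\<^sup>2 * x m / (1024 * k2 ^ 4)) \<le> \<eta>"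
      by (rule eventually_compose_filterlim[OF _ x_inf])
    have "\<forall>\<^sub>F m in sequentially. p m \<le> g (x m)"
      using cond sig al
    proof eventually_elim
      case (elim m)
      interpret R: regular_experiment "K m" "N m" "Nz m" "Y m" "real (N0 m)" cl cu \<sigma> \<Delta> M by (rule reg)
      have k: "R.\<kappa>\<^sub>1 = k1" "R.\<kappa>\<^sub>2 = k2" "R.\<kappa>\<^sub>3 = k3" "R.\<kappa>\<^sub>4 = k4"
        by (simp_all add: R.\<kappa>\<^sub>1_def R.\<kappa>\<^sub>2_def R.\<kappa>\<^sub>3_def R.\<kappa>\<^sub>4_def k1_def k2_def k3_def k4_def)
      have her: "heredity strong (K m) (N m) (Y m)" using C4 by blast
      show ?case
        unfolding p_def R.design_prob g_def D_def expo[symmetric] k[symmetric] x_def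
        by (rule R.Mhat_ne_Mstar_prob_le[OF her \<eta> e(1) a _ L _ b])
          (use elim in \<open>auto simp: x_def k\<close>)
    qed
    moreover have "0 \<le> p m" for m by (simp add: p_def)
    ultimately show ?thesis
      by (intro tendsto_sandwich[OF _ _ tendsto_const filterlim_compose[OF g0 x_inf]]) auto
  qed
  \<comment> \<open>This ratio controls both errors of the normal approximation: the squared score
    bound is of order |M*| / N, and sqrt N times it is |M*| / sqrt N.\<close>
  have card_tendsto: "(\<lambda>m. real (card (Mstar (K m) (N m) (Y m))) / sqrt (x m)) \<longlonglongrightarrow> 0"
  proof -
    obtain a b where b: "0 < b" and ev: "\<forall>\<^sub>F m in sequentially.
        a * real (N m) powr \<delta>'' \<le> real (\<Sum>d\<in>{1..K m}. card (Mstar_d (K m) (N m) (Y m) d)) \<and>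
        real (\<Sum>d\<in>{1..K m}. card (Mstar_d (K m) (N m) (Y m) d)) \<le> b * real (N m) powr \<delta>''"
      using C2_iii' by blast
    have "((\<lambda>y. (1 + b * y powr \<delta>'') / sqrt y) \<longlongrightarrow> 0) at_top"
    proof -
      have "((\<lambda>y. y powr (- (1 / 2)) + b * y powr (\<delta>'' - 1 / 2)) \<longlongrightarrow> 0 + b * 0) at_top"
        using C2_iii by (intro tendsto_add tendsto_mult tendsto_const tendsto_neg_powr filterlim_ident) auto
      then have "((\<lambda>y. y powr (- (1 / 2)) + b * y powr (\<delta>'' - 1 / 2)) \<longlongrightarrow> 0) at_top" by simp
      moreover have "\<forall>\<^sub>F y in at_top. y powr (- (1 / 2)) + b * y powr (\<delta>'' - 1 / 2) = (1 + b * y powr \<delta>'') / sqrt y"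
        using eventually_gt_at_top[of 0]
        by eventually_elim (simp add: powr_diff powr_minus powr_half_sqrt add_divide_distrib inverse_eq_divide)
      ultimately show ?thesis by (rule Lim_transform_eventually)
    qed
    from filterlim_compose[OF this x_inf]
    have lim: "(\<lambda>m. (1 + b * x m powr \<delta>'') / sqrt (x m)) \<longlonglongrightarrow> 0" .
    have "\<forall>\<^sub>F m in sequentially. real (card (Mstar (K m) (N m) (Y m))) / sqrt (x m) \<le> (1 + b * x m powr \<delta>'') / sqrt (x m)"
      using ev
    proof eventually_elim
      case (elim m)
      then show ?case
        using card_Mstar_le[of "K m" "N m" "Y m"] by (intro divide_right_mono) (auto simp: x_def)
    qed
    moreover have "0 \<le> real (card (Mstar (K m) (N m) (Y m))) / sqrt (x m)" for m by (simp add: x_def)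
    ultimately show ?thesis
      by (intro tendsto_sandwich[OF _ _ tendsto_const lim]) auto
  qed
  have clt: "weak_conv_m
           (\<lambda>m. distr (measure_pmf (design (K m) (N m) (Nz m))) borel
                 (\<lambda>Z. (gammaR_hat strong (K m) (N m) (Nz m) (Y m) (alpha m) (f m) Z
                        - gamma (K m) (N m) (Y m) (f m))
                       / sqrt (vR2 (K m) (N m) (Nz m) (Y m) (f m))))
           std_normal_distribution"
  proof (rule levy_continuity)
    fix t
    let ?P = "\<lambda>m. distr (measure_pmf (design (K m) (N m) (Nz m))) borel
                 (\<lambda>Z. (gammaR_hat strong (K m) (N m) (Nz m) (Y m) (alpha m) (f m) Z
                        - gamma (K m) (N m) (Y m) (f m))
                       / sqrt (vR2 (K m) (N m) (Nz m) (Y m) (f m)))"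
    let ?c = "\<lambda>m. real (card (Mstar (K m) (N m) (Y m)))"
    have le: "norm (char (?P m) t - char std_normal_distribution t) \<le> 2 * p m
      + \<bar>t\<bar> * (\<bar>t\<bar> * (96 * (k5 * (?c m / sqrt (x m)))) + 2 * sqrt (k5 * (?c m / sqrt (x m) * (1 / sqrt (x m)))) * t\<^sup>2)" for m
    proof -
      interpret R: regular_experiment "K m" "N m" "Nz m" "Y m" "real (N0 m)" cl cu \<sigma> \<Delta> M by (rule reg)
      have k: "R.\<kappa>\<^sub>5 = k5" by (simp add: R.\<kappa>\<^sub>5_def k5_def)
      have "0 < vR2 (K m) (N m) (Nz m) (Y m) (f m)" using vR_pos by blast
      note bound = R.char_gammaR_hat[OF this, of strong "alpha m" t]
      \<comment> \<open>Split into two null sequences, so that the limit under the square root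
        follows from \<open>card_tendsto\<close>.\<close>
      have e1: "k5 * ?c m / real (N m) = k5 * (?c m / sqrt (x m) * (1 / sqrt (x m)))"
        by (simp add: x_def)
      have e2: "k5 * ?c m / sqrt (real (N m)) = k5 * (?c m / sqrt (x m))"
        by (simp add: x_def)
      have e3: "char std_normal_distribution t = of_real (exp (- (t\<^sup>2 / 2)))"
        by (simp add: char_std_normal_distribution)
      show ?thesis using bound unfolding k e1 e2 e3 p_def R.design_prob .
    qed
    have "(\<lambda>m. 1 / sqrt (x m)) \<longlonglongrightarrow> 0"
      by (intro tendsto_divide_0[OF tendsto_const] filterlim_at_top_imp_at_infinity filterlim_compose[OF sqrt_at_top x_inf])
    then have "(\<lambda>m. 2 * p m
      + \<bar>t\<bar> * (\<bar>t\<bar> * (96 * (k5 * (?c m / sqrt (x m)))) + 2 * sqrt (k5 * (?c m / sqrt (x m) * (1 / sqrt (x m)))) * t\<^sup>2))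
      \<longlonglongrightarrow> 2 * 0 + \<bar>t\<bar> * (\<bar>t\<bar> * (96 * (k5 * 0)) + 2 * sqrt (k5 * (0 * 0)) * t\<^sup>2)"
      by (intro tendsto_intros p_tendsto card_tendsto)
    then have "(\<lambda>m. 2 * p m
      + \<bar>t\<bar> * (\<bar>t\<bar> * (96 * (k5 * (?c m / sqrt (x m)))) + 2 * sqrt (k5 * (?c m / sqrt (x m) * (1 / sqrt (x m)))) * t\<^sup>2))
      \<longlonglongrightarrow> 0" by simp
    then have "(\<lambda>m. char (?P m) t - char std_normal_distribution t) \<longlonglongrightarrow> 0"
      by (rule Lim_null_comparison[rotated]) (intro always_eventually allI le)
    then show "(\<lambda>m. char (?P m) t) \<longlonglongrightarrow> char std_normal_distribution t"
      by (simp add: LIM_zero_iff)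
  qed (auto intro: real_dist_normal_dist prob_space.real_distribution_distr[OF measure_pmf.prob_space_axioms])
  have cons: "\<forall>\<epsilon>>0. (\<lambda>m. measure_pmf.prob (design (K m) (N m) (Nz m))
                   {Z. \<bar>real (N m) * (vR2_hat strong (K m) (N m) (Nz m) (Y m) (alpha m) (f m) Z
                                     - vRlim2 (K m) (N m) (Nz m) (Y m) (f m))\<bar> > \<epsilon>})
                 \<longlonglongrightarrow> 0"
    if fstar_bound: "\<exists>C. \<forall>\<^sub>F m in sequentially. \<forall>z\<in>treatments (K m).
              \<bar>fstar (K m) (N m) (Y m) (f m) z\<bar> \<le> C / Qnum (K m)"
  proof (intro allI impI)
    fix \<epsilon> :: real assume \<epsilon>: "0 < \<epsilon>"
    obtain C where C: "\<forall>\<^sub>F m in sequentially. \<forall>z\<in>treatments (K m).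
              \<bar>fstar (K m) (N m) (Y m) (f m) z\<bar> \<le> C / Qnum (K m)" using fstar_bound by blast
    define c where "c = \<epsilon>\<^sup>2 / (16 * (8 * C\<^sup>2 * M\<^sup>2 * \<Delta>\<^sup>2 * cu\<^sup>2 / cl\<^sup>2 + 1)\<^sup>2)"
    have "0 < 8 * C\<^sup>2 * M\<^sup>2 * \<Delta>\<^sup>2 * cu\<^sup>2 / cl\<^sup>2 + 1" by (intro add_nonneg_pos) auto
    then have "0 < c" using \<epsilon> unfolding c_def by simp
    then have "((\<lambda>y. 2 * exp (- (c * y))) \<longlongrightarrow> 0) at_top" by real_asymp
    from tendsto_add[OF p_tendsto filterlim_compose[OF this x_inf]]
    have lim: "(\<lambda>m. p m + 2 * exp (- (c * x m))) \<longlonglongrightarrow> 0" by simp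
    let ?q = "\<lambda>m. measure_pmf.prob (design (K m) (N m) (Nz m))
                   {Z. \<bar>real (N m) * (vR2_hat strong (K m) (N m) (Nz m) (Y m) (alpha m) (f m) Z
                                     - vRlim2 (K m) (N m) (Nz m) (Y m) (f m))\<bar> > \<epsilon>}"
    have "\<forall>\<^sub>F m in sequentially. ?q m \<le> p m + 2 * exp (- (c * x m))"
      using C
    proof eventually_elim
      case (elim m)
      interpret R: regular_experiment "K m" "N m" "Nz m" "Y m" "real (N0 m)" cl cu \<sigma> \<Delta> M by (rule reg)
      show ?case
        using R.vR2_hat_tail[of "f m" C \<epsilon> strong "alpha m"] elim \<epsilon>
        unfolding p_def R.design_prob c_def x_def by simp
    qed
    then show "?q \<longlonglongrightarrow> 0"
      by (intro tendsto_sandwich[OF _ _ tendsto_const lim]) auto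
  qed
  have "vR2 (K m) (N m) (Nz m) (Y m) (f m) \<le> vRlim2 (K m) (N m) (Nz m) (Y m) (f m)" for m
  proof -
    interpret R: regular_experiment "K m" "N m" "Nz m" "Y m" "real (N0 m)" cl cu \<sigma> \<Delta> M by (rule reg)
    show ?thesis unfolding vR2_def vRlim2_def by (rule R.quad_VY_le_DY)
  qed
  then show ?thesis using clt cons by blast
qed

end
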